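(* Let $B$ be a finite dimensional curved semisimple algebra over a perfect field $k$. Then $B$ is isomorphic, as a curved algebra, to a finite product of algebras of the following two types (called curved simple): (1) a dg algebra $R$ whose underlying graded algebra is simple; (2) a dg algebra $R$ of the form $S\otimes K$, where $S$ is a simple graded algebra with zero differential and $K$ is the acyclic dg algebra $K=k[x]/x^2$ with $x$ in cohomological degree $-1$ and $dx=1$.
   Context: Everything is over $k$ and cohomologically $\mathbb Z$-graded; $[a,b]=ab-(-1)^{|a||b|}ba$; $A^\#$ is the underlying graded algebra of $A$. A curved algebra is a unital graded algebra $A$ with a degree $1$ derivation $d$ and an element $h\in A^2$ (the curvature) with $dh=0$ and $d^2(a)=[h,a]$ for all $a$; the zero algebra is allowed, and a dg algebra is a curved algebra with $h=0$. A morphism of curved algebras $A\to B$ is a pair $(f,b)$ with $f$ a graded algebra map and $b\in B^1$ such that $f(da)=d(fa)+[b,fa]$ and $f(h_A)=h_B+db+b^2$; composition is $(g,c)(f,b)=(gf,c+g(b))$. Isomorphism of curved algebras refers to this category. For a finite dimensional curved algebra $A$ let $J$ be the radical of $A^\#$. The internal curved radical of $A$ is $J_-=\{x\in J: dx\in J\}$. $A$ is curved semisimple if $J_-=0$. *)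

theory Defs
  imports "HOL-Algebra.Algebra" "HOL-Library.Multiset" "HOL-Library.FuncSet"
begin

definition perfect_field :: "('k, 'm) ring_scheme \<Rightarrow> bool" where
  "perfect_field K \<longleftrightarrow> field K \<and>
     (\<forall>p::nat. Factorial_Ring.prime p \<and> [p] \<cdot>\<^bsub>K\<^esub> \<one>\<^bsub>K\<^esub> = \<zero>\<^bsub>K\<^esub> \<longrightarrow>
        (\<forall>a\<in>carrier K. \<exists>b\<in>carrier K. b [^]\<^bsub>K\<^esub> p = a))"


section \<open>Graded algebras\<close>

record ('k, 'a) galg = "('k, 'a) module" +
  grade :: "int \<Rightarrow> 'a set"

text \<open>
  \<open>c\<close> is the family of homogeneous components of \<open>a\<close>.
\<close>
definition homog_decomp :: "('k, 'a, 'm) galg_scheme \<Rightarrow> 'a \<Rightarrow> (int \<Rightarrow> 'a) \<Rightarrow> bool" where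
  "homog_decomp A a c \<longleftrightarrow>
     (\<forall>n. c n \<in> grade A n) \<and> finite {n. c n \<noteq> \<zero>\<^bsub>A\<^esub>} \<and>
     a = finsum A c {n. c n \<noteq> \<zero>\<^bsub>A\<^esub>}"

text \<open>
  Unital associative algebras over the field \<open>K\<close> with a grading by the integers. The locale
  \<^locale>\<open>ring\<close> does not exclude the zero ring, so the zero algebra is allowed.
\<close>
locale graded_algebra = K?: field K + A?: ring A + module K A
  for K :: "('k, 'm) ring_scheme" (structure) and A :: "('k, 'a, 'n) galg_scheme" (structure) +
  assumes smult_mult_left:
      "\<lbrakk>c \<in> carrier K; x \<in> carrier A; y \<in> carrier A\<rbrakk> \<Longrightarrow>
       (c \<odot>\<^bsub>A\<^esub> x) \<otimes>\<^bsub>A\<^esub> y = c \<odot>\<^bsub>A\<^esub> (x \<otimes>\<^bsub>A\<^esub> y)"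
    and smult_mult_right:
      "\<lbrakk>c \<in> carrier K; x \<in> carrier A; y \<in> carrier A\<rbrakk> \<Longrightarrow>
       x \<otimes>\<^bsub>A\<^esub> (c \<odot>\<^bsub>A\<^esub> y) = c \<odot>\<^bsub>A\<^esub> (x \<otimes>\<^bsub>A\<^esub> y)"
    and grade_submodule: "submodule (grade A n) K A"
    and grade_direct_sum: "a \<in> carrier A \<Longrightarrow> \<exists>!c. homog_decomp A a c"
    and grade_one: "\<one>\<^bsub>A\<^esub> \<in> grade A 0"
    and grade_mult: "\<lbrakk>x \<in> grade A i; y \<in> grade A j\<rbrakk> \<Longrightarrow> x \<otimes>\<^bsub>A\<^esub> y \<in> grade A (i + j)"

definition fin_dim :: "('k, 'm) ring_scheme \<Rightarrow> ('k, 'a, 'n) galg_scheme \<Rightarrow> bool" where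
  "fin_dim K A \<longleftrightarrow>
     (\<exists>G. finite G \<and> G \<subseteq> carrier A \<and>
        (\<forall>a\<in>carrier A. \<exists>c. c \<in> G \<rightarrow> carrier K \<and> a = (\<Oplus>\<^bsub>A\<^esub>x\<in>G. c x \<odot>\<^bsub>A\<^esub> x)))"

text \<open>In a graded algebra, ideals are graded, i.e. closed under homogeneous components.\<close>
definition homogeneous :: "('k, 'a, 'm) galg_scheme \<Rightarrow> 'a set \<Rightarrow> bool" where
  "homogeneous A I \<longleftrightarrow> (\<forall>a\<in>I. \<forall>c. homog_decomp A a c \<longrightarrow> (\<forall>n. c n \<in> I))"

definition simple_galg :: "('k, 'a, 'm) galg_scheme \<Rightarrow> bool" where
  "simple_galg A \<longleftrightarrow> carrier A \<noteq> {\<zero>\<^bsub>A\<^esub>} \<and>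
     (\<forall>I. ideal I A \<and> homogeneous A I \<longrightarrow> I = {\<zero>\<^bsub>A\<^esub>} \<or> I = carrier A)"

definition graded_left_ideal :: "('k, 'a, 'm) galg_scheme \<Rightarrow> 'a set \<Rightarrow> bool" where
  "graded_left_ideal A I \<longleftrightarrow> additive_subgroup I A \<and> homogeneous A I \<and>
     (\<forall>a\<in>carrier A. \<forall>x\<in>I. a \<otimes>\<^bsub>A\<^esub> x \<in> I)"

definition max_graded_left_ideal :: "('k, 'a, 'm) galg_scheme \<Rightarrow> 'a set \<Rightarrow> bool" where
  "max_graded_left_ideal A M \<longleftrightarrow> graded_left_ideal A M \<and> M \<noteq> carrier A \<and>
     (\<forall>I. graded_left_ideal A I \<and> M \<subseteq> I \<longrightarrow> I = M \<or> I = carrier A)"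

text \<open>
  The (graded) Jacobson radical. For finite dimensional algebras graded by the integers it is
  also the largest nilpotent ideal and the Jacobson radical of the underlying ungraded ring.
  The zero algebra has no maximal left ideal and is its own radical.
\<close>
definition gr_radical :: "('k, 'a, 'm) galg_scheme \<Rightarrow> 'a set" where
  "gr_radical A = {x \<in> carrier A. \<forall>M. max_graded_left_ideal A M \<longrightarrow> x \<in> M}"

text \<open>\<open>(-1)\<^sup>n a\<close>\<close>
definition signed :: "('k, 'a, 'm) galg_scheme \<Rightarrow> int \<Rightarrow> 'a \<Rightarrow> 'a" where
  "signed A n a = (if even n then a else \<ominus>\<^bsub>A\<^esub> a)"

text \<open>The graded commutator of \<open>a\<close> and \<open>b\<close>, homogeneous of respective degrees \<open>i\<close> and \<open>j\<close>.\<close>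
definition gcomm :: "('k, 'a, 'm) galg_scheme \<Rightarrow> int \<Rightarrow> int \<Rightarrow> 'a \<Rightarrow> 'a \<Rightarrow> 'a" where
  "gcomm A i j a b = a \<otimes>\<^bsub>A\<^esub> b \<ominus>\<^bsub>A\<^esub> signed A (i * j) (b \<otimes>\<^bsub>A\<^esub> a)"

definition k_linear ::
  "('k, 'm) ring_scheme \<Rightarrow> ('k, 'a, 'n) galg_scheme \<Rightarrow> ('k, 'b, 'p) galg_scheme \<Rightarrow> ('a \<Rightarrow> 'b) \<Rightarrow> bool"
  where
  "k_linear K A B f \<longleftrightarrow> f \<in> carrier A \<rightarrow> carrier B \<and>
     (\<forall>x\<in>carrier A. \<forall>y\<in>carrier A. f (x \<oplus>\<^bsub>A\<^esub> y) = f x \<oplus>\<^bsub>B\<^esub> f y) \<and>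
     (\<forall>c\<in>carrier K. \<forall>x\<in>carrier A. f (c \<odot>\<^bsub>A\<^esub> x) = c \<odot>\<^bsub>B\<^esub> f x)"

definition galg_hom ::
  "('k, 'm) ring_scheme \<Rightarrow> ('k, 'a, 'n) galg_scheme \<Rightarrow> ('k, 'b, 'p) galg_scheme \<Rightarrow> ('a \<Rightarrow> 'b) set"
  where
  "galg_hom K A B =
     {f \<in> ring_hom A B. k_linear K A B f \<and> (\<forall>n. \<forall>a\<in>grade A n. f a \<in> grade B n)}"


section \<open>Curved algebras\<close>

record ('k, 'a) calg = "('k, 'a) galg" +
  diff :: "'a \<Rightarrow> 'a"
  curv :: "'a"

locale curved_algebra = graded_algebra K A
  for K :: "('k, 'm) ring_scheme" (structure) and A :: "('k, 'a) calg" (structure) +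
  assumes diff_linear: "k_linear K A A (diff A)"
    and diff_degree: "a \<in> grade A n \<Longrightarrow> diff A a \<in> grade A (n + 1)"
    and diff_mult: "\<lbrakk>a \<in> grade A n; b \<in> carrier A\<rbrakk> \<Longrightarrow>
      diff A (a \<otimes>\<^bsub>A\<^esub> b) = diff A a \<otimes>\<^bsub>A\<^esub> b \<oplus>\<^bsub>A\<^esub> signed A n (a \<otimes>\<^bsub>A\<^esub> diff A b)"
    and curv_degree: "curv A \<in> grade A 2"
    and diff_curv: "diff A (curv A) = \<zero>\<^bsub>A\<^esub>"
    and diff_diff: "a \<in> grade A n \<Longrightarrow> diff A (diff A a) = gcomm A 2 n (curv A) a"

definition dg_algebra :: "('k, 'm) ring_scheme \<Rightarrow> ('k, 'a) calg \<Rightarrow> bool" where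
  "dg_algebra K A \<longleftrightarrow> curved_algebra K A \<and> curv A = \<zero>\<^bsub>A\<^esub>"

definition curved_hom ::
  "('k, 'm) ring_scheme \<Rightarrow> ('k, 'a) calg \<Rightarrow> ('k, 'b) calg \<Rightarrow> (('a \<Rightarrow> 'b) \<times> 'b) set" where
  "curved_hom K A B = {(f, b). f \<in> galg_hom K A B \<and> b \<in> grade B 1 \<and>
     (\<forall>n. \<forall>a\<in>grade A n. f (diff A a) = diff B (f a) \<oplus>\<^bsub>B\<^esub> gcomm B 1 n b (f a)) \<and>
     f (curv A) = curv B \<oplus>\<^bsub>B\<^esub> diff B b \<oplus>\<^bsub>B\<^esub> b \<otimes>\<^bsub>B\<^esub> b}"

definition curved_comp ::
  "('k, 'c) calg \<Rightarrow> ('b \<Rightarrow> 'c) \<times> 'c \<Rightarrow> ('a \<Rightarrow> 'b) \<times> 'b \<Rightarrow> ('a \<Rightarrow> 'c) \<times> 'c" where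
  "curved_comp C G F = (fst G \<circ> fst F, snd G \<oplus>\<^bsub>C\<^esub> fst G (snd F))"

text \<open>Maps are only relevant on carriers.\<close>
definition is_curved_id :: "('k, 'a) calg \<Rightarrow> ('a \<Rightarrow> 'a) \<times> 'a \<Rightarrow> bool" where
  "is_curved_id A F \<longleftrightarrow> (\<forall>x\<in>carrier A. fst F x = x) \<and> snd F = \<zero>\<^bsub>A\<^esub>"

definition curved_isomorphic ::
  "('k, 'm) ring_scheme \<Rightarrow> ('k, 'a) calg \<Rightarrow> ('k, 'b) calg \<Rightarrow> bool" where
  "curved_isomorphic K A B \<longleftrightarrow>
     (\<exists>F\<in>curved_hom K A B. \<exists>G\<in>curved_hom K B A.
        is_curved_id A (curved_comp A G F) \<and> is_curved_id B (curved_comp B F G))"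

text \<open>
  Isomorphism of dg algebras, i.e. by morphisms \<open>(f, 0)\<close>. This is finer than
  \<^const>\<open>curved_isomorphic\<close>, even between dg algebras.
\<close>
definition dg_isomorphic ::
  "('k, 'm) ring_scheme \<Rightarrow> ('k, 'a) calg \<Rightarrow> ('k, 'b) calg \<Rightarrow> bool" where
  "dg_isomorphic K A B \<longleftrightarrow>
     (\<exists>f g. (f, \<zero>\<^bsub>B\<^esub>) \<in> curved_hom K A B \<and> (g, \<zero>\<^bsub>A\<^esub>) \<in> curved_hom K B A \<and>
        (\<forall>x\<in>carrier A. g (f x) = x) \<and> (\<forall>y\<in>carrier B. f (g y) = y))"

definition curved_radical :: "('k, 'a) calg \<Rightarrow> 'a set" where
  "curved_radical A = {x \<in> gr_radical A. diff A x \<in> gr_radical A}"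

definition curved_semisimple :: "('k, 'a) calg \<Rightarrow> bool" where
  "curved_semisimple A \<longleftrightarrow> curved_radical A = {\<zero>\<^bsub>A\<^esub>}"

text \<open>The product over a finite index set; the empty product is the zero algebra.\<close>
definition prod_calg :: "'i set \<Rightarrow> ('i \<Rightarrow> ('k, 'a) calg) \<Rightarrow> ('k, 'i \<Rightarrow> 'a) calg" where
  "prod_calg I R =
     \<lparr> carrier = (\<Pi>\<^sub>E i\<in>I. carrier (R i)),
       monoid.mult = (\<lambda>x y. \<lambda>i\<in>I. x i \<otimes>\<^bsub>R i\<^esub> y i),
       one = (\<lambda>i\<in>I. \<one>\<^bsub>R i\<^esub>),
       ring.zero = (\<lambda>i\<in>I. \<zero>\<^bsub>R i\<^esub>),
       add = (\<lambda>x y. \<lambda>i\<in>I. x i \<oplus>\<^bsub>R i\<^esub> y i),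
       smult = (\<lambda>c x. \<lambda>i\<in>I. c \<odot>\<^bsub>R i\<^esub> x i),
       grade = (\<lambda>n. \<Pi>\<^sub>E i\<in>I. grade (R i) n),
       diff = (\<lambda>x. \<lambda>i\<in>I. diff (R i) (x i)),
       curv = (\<lambda>i\<in>I. curv (R i)) \<rparr>"


section \<open>Tensor products\<close>

text \<open>
  The degree \<open>n\<close> part of the graded tensor product is the direct sum of the \<open>A\<^sup>i \<otimes> B\<^sup>j\<close> with
  \<open>i + j = n\<close>. Accordingly, the tensor product is presented as finite formal sums of symbols
  \<open>(i, a, j, b)\<close>, standing for \<open>a \<otimes> b\<close> with \<open>a\<close> of degree \<open>i\<close> and \<open>b\<close> of degree \<open>j\<close>, modulo
  bilinearity. Scalars are absorbed into \<open>a\<close>.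
\<close>
type_synonym ('a, 'b) formal_sum = "(int \<times> 'a \<times> int \<times> 'b) multiset"

definition formal_sums ::
  "('k, 'a) calg \<Rightarrow> ('k, 'b) calg \<Rightarrow> ('a, 'b) formal_sum set" where
  "formal_sums A B = {M. \<forall>(i, a, j, b)\<in>set_mset M. a \<in> grade A i \<and> b \<in> grade B j}"

inductive tensor_eq ::
  "('k, 'm) ring_scheme \<Rightarrow> ('k, 'a) calg \<Rightarrow> ('k, 'b) calg \<Rightarrow>
     ('a, 'b) formal_sum \<Rightarrow> ('a, 'b) formal_sum \<Rightarrow> bool"
  for K :: "('k, 'm) ring_scheme" and A :: "('k, 'a) calg" and B :: "('k, 'b) calg" where
  refl: "M \<in> formal_sums A B \<Longrightarrow> tensor_eq K A B M M"
| sym: "tensor_eq K A B M N \<Longrightarrow> tensor_eq K A B N M"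
| trans: "tensor_eq K A B M N \<Longrightarrow> tensor_eq K A B N P \<Longrightarrow> tensor_eq K A B M P"
| plus: "tensor_eq K A B M N \<Longrightarrow> tensor_eq K A B M' N' \<Longrightarrow> tensor_eq K A B (M + M') (N + N')"
| zero: "b \<in> grade B j \<Longrightarrow> tensor_eq K A B {#(i, \<zero>\<^bsub>A\<^esub>, j, b)#} {#}"
| add_left: "a \<in> grade A i \<Longrightarrow> a' \<in> grade A i \<Longrightarrow> b \<in> grade B j \<Longrightarrow>
    tensor_eq K A B {#(i, a \<oplus>\<^bsub>A\<^esub> a', j, b)#} {#(i, a, j, b), (i, a', j, b)#}"
| add_right: "a \<in> grade A i \<Longrightarrow> b \<in> grade B j \<Longrightarrow> b' \<in> grade B j \<Longrightarrow>
    tensor_eq K A B {#(i, a, j, b \<oplus>\<^bsub>B\<^esub> b')#} {#(i, a, j, b), (i, a, j, b')#}"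
| smult: "c \<in> carrier K \<Longrightarrow> a \<in> grade A i \<Longrightarrow> b \<in> grade B j \<Longrightarrow>
    tensor_eq K A B {#(i, c \<odot>\<^bsub>A\<^esub> a, j, b)#} {#(i, a, j, c \<odot>\<^bsub>B\<^esub> b)#}"

definition tensor_class ::
  "('k, 'm) ring_scheme \<Rightarrow> ('k, 'a) calg \<Rightarrow> ('k, 'b) calg \<Rightarrow>
     ('a, 'b) formal_sum \<Rightarrow> ('a, 'b) formal_sum set" where
  "tensor_class K A B M = {N. tensor_eq K A B M N}"

text \<open>\<open>(a \<otimes> b) (a' \<otimes> b') = (-1)\<^bsup>|b||a'|\<^esup> (a a' \<otimes> b b')\<close>\<close>
definition formal_mult ::
  "('k, 'a) calg \<Rightarrow> ('k, 'b) calg \<Rightarrow>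
     ('a, 'b) formal_sum \<Rightarrow> ('a, 'b) formal_sum \<Rightarrow> ('a, 'b) formal_sum" where
  "formal_mult A B M N =
     (\<Sum>(i, a, j, b)\<in>#M. image_mset (\<lambda>(i', a', j', b').
        (i + i', signed A (j * i') (a \<otimes>\<^bsub>A\<^esub> a'), j + j', b \<otimes>\<^bsub>B\<^esub> b')) N)"

text \<open>\<open>d(a \<otimes> b) = da \<otimes> b + (-1)\<^bsup>|a|\<^esup> a \<otimes> db\<close>\<close>
definition formal_diff ::
  "('k, 'a) calg \<Rightarrow> ('k, 'b) calg \<Rightarrow> ('a, 'b) formal_sum \<Rightarrow> ('a, 'b) formal_sum" where
  "formal_diff A B M =
     (\<Sum>(i, a, j, b)\<in>#M. {#(i + 1, diff A a, j, b), (i, signed A i a, j + 1, diff B b)#})"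

text \<open>The curvature is \<open>h \<otimes> 1 + 1 \<otimes> h\<close>, which vanishes for dg algebras.\<close>
definition tensor_calg ::
  "('k, 'm) ring_scheme \<Rightarrow> ('k, 'a) calg \<Rightarrow> ('k, 'b) calg \<Rightarrow> ('k, ('a, 'b) formal_sum set) calg"
  where
  "tensor_calg K A B =
     \<lparr> carrier = tensor_class K A B ` formal_sums A B,
       monoid.mult = (\<lambda>U V. \<Union>M\<in>U. \<Union>N\<in>V. tensor_class K A B (formal_mult A B M N)),
       one = tensor_class K A B {#(0, \<one>\<^bsub>A\<^esub>, 0, \<one>\<^bsub>B\<^esub>)#},
       ring.zero = tensor_class K A B {#},
       add = (\<lambda>U V. \<Union>M\<in>U. \<Union>N\<in>V. tensor_class K A B (M + N)),
       smult = (\<lambda>c U. \<Union>M\<in>U. tensor_class K A B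
                  (image_mset (\<lambda>(i, a, j, b). (i, c \<odot>\<^bsub>A\<^esub> a, j, b)) M)),
       grade = (\<lambda>n. tensor_class K A B `
                  {M \<in> formal_sums A B. \<forall>(i, a, j, b)\<in>set_mset M. i + j = n}),
       diff = (\<lambda>U. \<Union>M\<in>U. tensor_class K A B (formal_diff A B M)),
       curv = tensor_class K A B {#(2, curv A, 0, \<one>\<^bsub>B\<^esub>), (0, \<one>\<^bsub>A\<^esub>, 2, curv B)#} \<rparr>"


section \<open>Curved simple algebras\<close>

text \<open>
  \<open>k[x]/x\<^sup>2\<close> with \<open>x\<close> in degree \<open>-1\<close> and \<open>dx = 1\<close>; the pair \<open>(u, v)\<close> stands for \<open>u + v x\<close>.
\<close>
definition acyclic_dual_numbers :: "('k, 'm) ring_scheme \<Rightarrow> ('k, 'k \<times> 'k) calg" where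
  "acyclic_dual_numbers K =
     \<lparr> carrier = carrier K \<times> carrier K,
       monoid.mult = (\<lambda>(u, v) (u', v'). (u \<otimes>\<^bsub>K\<^esub> u', u \<otimes>\<^bsub>K\<^esub> v' \<oplus>\<^bsub>K\<^esub> v \<otimes>\<^bsub>K\<^esub> u')),
       one = (\<one>\<^bsub>K\<^esub>, \<zero>\<^bsub>K\<^esub>),
       ring.zero = (\<zero>\<^bsub>K\<^esub>, \<zero>\<^bsub>K\<^esub>),
       add = (\<lambda>(u, v) (u', v'). (u \<oplus>\<^bsub>K\<^esub> u', v \<oplus>\<^bsub>K\<^esub> v')),
       smult = (\<lambda>c (u, v). (c \<otimes>\<^bsub>K\<^esub> u, c \<otimes>\<^bsub>K\<^esub> v)),
       grade = (\<lambda>n. if n = 0 then carrier K \<times> {\<zero>\<^bsub>K\<^esub>}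
                    else if n = -1 then {\<zero>\<^bsub>K\<^esub>} \<times> carrier K
                    else {(\<zero>\<^bsub>K\<^esub>, \<zero>\<^bsub>K\<^esub>)}),
       diff = (\<lambda>(u, v). (v, \<zero>\<^bsub>K\<^esub>)),
       curv = (\<zero>\<^bsub>K\<^esub>, \<zero>\<^bsub>K\<^esub>) \<rparr>"

text \<open>
  In the second alternative it is no restriction that the carrier of \<open>S\<close> has the same element
  type as that of \<open>R\<close>, because \<open>S\<close> embeds into \<open>R\<close> as \<open>S \<otimes> 1\<close>.
\<close>
definition curved_simple :: "('k, 'm) ring_scheme \<Rightarrow> ('k, 'a) calg \<Rightarrow> bool" where
  "curved_simple K R \<longleftrightarrow> dg_algebra K R \<and>
     (simple_galg R \<or>
      (\<exists>S :: ('k, 'a) calg. dg_algebra K S \<and> (\<forall>s\<in>carrier S. diff S s = \<zero>\<^bsub>S\<^esub>) \<and>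
         simple_galg S \<and> dg_isomorphic K R (tensor_calg K S (acyclic_dual_numbers K))))"

end

theory Submission
  imports Defs
begin

text \<open>
  If \<open>J\<^sub>- = 0\<close>, then \<open>d\<close> induces an injection of \<open>J\<close> into \<open>B/J\<close>. Choose a decomposition of
  \<open>1\<close> into orthogonal primitive idempotents \<open>f\<close> of degree \<open>0\<close> and twist by
  \<open>b = \<Sum> d(f) f\<close>, so that \<open>d f = 0\<close> for all \<open>f\<close>. Modulo \<open>J\<close>, each Peirce block \<open>f B g\<close> is
  concentrated in a single degree \<open>\<delta> f - \<delta> g\<close> (the finite dimensional graded division algebras
  are concentrated in degree \<open>0\<close>), and injectivity of \<open>d\<close> on \<open>J\<close> forces \<open>J \<inter> f B g\<close> into degree
  \<open>\<delta> f - \<delta> g - 1\<close>. Hence \<open>d\<close> vanishes in degree \<open>\<delta> f - \<delta> g\<close>, the cycles \<open>S\<close> are a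
  complement of \<open>J\<close>, and the curvature, which now commutes with all \<open>f\<close> and has degree \<open>2\<close>,
  is zero. The isomorphism classes of the idempotents give central idempotents \<open>e\<close> for which
  \<open>e S\<close> is simple. If \<open>e J \<noteq> 0\<close>, then \<open>d(e J)\<close> is a nonzero ideal of \<open>e S\<close>, so \<open>e = d x\<close> for some
  \<open>x\<close> in \<open>e J\<close> of degree \<open>-1\<close>, and \<open>e B = e S \<oplus> e S x\<close> is \<open>e S \<otimes> k[x]/x\<^sup>2\<close>.
\<close>

section \<open>Graded components\<close>

text \<open>The obstacle is that \<open>d\<close> preserves neither the radical nor a chosen
  idempotent, so the structure of \<open>B/J\<close> says nothing about \<open>d\<close> directly.
  Twisting alters the differential and the curvature but not the graded algebra, hence neither
  \<open>J\<close> nor the idempotents, and as \<open>[b, J]\<close> lies in \<open>J\<close>, the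
  condition \<open>J_- = 0\<close> survives it. The element \<open>b\<close> solves
  \<open>[b, f] = d f\<close> for all idempotents of the decomposition at once. Everything
  afterwards rests on one dichotomy for a nonzero homogeneous element of a block
  \<open>f B g\<close>: outside \<open>J\<close> it is invertible between \<open>f\<close> and
  \<open>g\<close>, which determines its degree; inside \<open>J\<close> it is carried out of
  \<open>J\<close> by \<open>d\<close>, so its degree is one less. Blocks thus have at most two
  adjacent degrees, and vanishing statements become degree counts. Isomorphisms of idempotents may
  have any degree, since the ideals in question are two-sided and graded and elements of nonzero
  degree link idempotents as well. This is where the shifts \<open>\<delta>\<close> come
  from.\<close>

definition hcomp :: "('k, 'a, 'n) galg_scheme \<Rightarrow> int \<Rightarrow> 'a \<Rightarrow> 'a" where
  "hcomp A n a = (THE c. homog_decomp A a c) n"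

text \<open>A common frame for multiplications, projections, signs and differentials: two such maps
  agree as soon as they agree on homogeneous elements.\<close>

definition additive_on :: "('k, 'a, 'n) galg_scheme \<Rightarrow> ('a \<Rightarrow> 'a) \<Rightarrow> bool" where
  "additive_on A f \<longleftrightarrow> f \<in> carrier A \<rightarrow> carrier A \<and>
     (\<forall>x\<in>carrier A. \<forall>y\<in>carrier A. f (x \<oplus>\<^bsub>A\<^esub> y) = f x \<oplus>\<^bsub>A\<^esub> f y)"

lemma k_linear_additive: "k_linear K A A f \<Longrightarrow> additive_on A f"
  by (simp add: k_linear_def additive_on_def)

text \<open>The plain operation symbols refer to \<open>A\<close> instead of \<open>K\<close>.\<close>
locale galg = graded_algebra K A
  for K :: "('k, 'm) ring_scheme" and A :: "('k, 'a, 'n) galg_scheme" (structure)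
begin

lemma grade_sub: "grade A n \<subseteq> carrier A"
  using submoduleE(1)[OF grade_submodule] .

lemma grade_carrier: "x \<in> grade A n \<Longrightarrow> x \<in> carrier A"
  using grade_sub by blast

lemma grade_add [simp]: "\<lbrakk>x \<in> grade A n; y \<in> grade A n\<rbrakk> \<Longrightarrow> x \<oplus> y \<in> grade A n"
  using submoduleE(5)[OF grade_submodule] .

lemma grade_neg [simp]: "x \<in> grade A n \<Longrightarrow> \<ominus> x \<in> grade A n"
  using submoduleE(3)[OF grade_submodule] .

lemma grade_minus [simp]: "\<lbrakk>x \<in> grade A n; y \<in> grade A n\<rbrakk> \<Longrightarrow> x \<ominus> y \<in> grade A n"
  by (simp add: a_minus_def)

lemma grade_smult [simp]: "\<lbrakk>c \<in> carrier K; x \<in> grade A n\<rbrakk> \<Longrightarrow> c \<odot> x \<in> grade A n"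
  using submoduleE(4)[OF grade_submodule] .

lemma grade_zero [simp]: "\<zero> \<in> grade A n"
  by (metis A.r_neg grade_add grade_carrier grade_neg submoduleE(2)[OF grade_submodule] ex_in_conv)

lemma grade_mult_0 [simp]:
  "\<lbrakk>f \<in> grade A 0; x \<in> grade A n\<rbrakk> \<Longrightarrow> f \<otimes> x \<in> grade A n"
  "\<lbrakk>f \<in> grade A 0; x \<in> grade A n\<rbrakk> \<Longrightarrow> x \<otimes> f \<in> grade A n"
  using grade_mult[of f 0 x n] grade_mult[of x n f 0] by simp_all

lemma grade_pow: "x \<in> grade A 0 \<Longrightarrow> x [^] (k::nat) \<in> grade A 0"
  by (induction k) (auto simp: grade_one)

lemma grade_signed [simp]: "x \<in> grade A n \<Longrightarrow> signed A m x \<in> grade A n"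
  by (simp add: signed_def)

lemma grade_finsum: "(\<And>i. i \<in> I \<Longrightarrow> f i \<in> grade A n) \<Longrightarrow> finsum A f I \<in> grade A n"
proof (induction I rule: infinite_finite_induct)
  case (insert i I)
  then have "f \<in> I \<rightarrow> carrier A" "f i \<in> carrier A" using grade_carrier by blast+
  with insert show ?case by simp
qed auto

lemma additive_onD:
  assumes "additive_on A f"
  shows "x \<in> carrier A \<Longrightarrow> f x \<in> carrier A"
    and "\<lbrakk>x \<in> carrier A; y \<in> carrier A\<rbrakk> \<Longrightarrow> f (x \<oplus> y) = f x \<oplus> f y"
    and "f \<zero> = \<zero>"
    and "x \<in> carrier A \<Longrightarrow> f (\<ominus> x) = \<ominus> f x"
    and "\<lbrakk>x \<in> carrier A; y \<in> carrier A\<rbrakk> \<Longrightarrow> f (x \<ominus> y) = f x \<ominus> f y"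
proof -
  have c: "\<And>x. x \<in> carrier A \<Longrightarrow> f x \<in> carrier A"
    and a: "\<And>x y. \<lbrakk>x \<in> carrier A; y \<in> carrier A\<rbrakk> \<Longrightarrow> f (x \<oplus> y) = f x \<oplus> f y"
    using assms by (auto simp: additive_on_def)
  have "f \<zero> \<oplus> f \<zero> = f \<zero>" using a[of \<zero> \<zero>] by simp
  then show z: "f \<zero> = \<zero>" using c[of \<zero>] by simp
  have n: "f (\<ominus> x) = \<ominus> f x" if "x \<in> carrier A" for x
    using a[of "\<ominus> x" x] that c z by (simp add: A.l_neg A.minus_equality)
  show "x \<in> carrier A \<Longrightarrow> f (\<ominus> x) = \<ominus> f x" by (rule n)
  show "\<lbrakk>x \<in> carrier A; y \<in> carrier A\<rbrakk> \<Longrightarrow> f (x \<ominus> y) = f x \<ominus> f y"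
    by (simp add: a_minus_def a n)
qed (use assms in \<open>auto simp: additive_on_def\<close>)

lemma additive_on_finsum:
  assumes f: "additive_on A f"
  shows "(\<And>i. i \<in> I \<Longrightarrow> g i \<in> carrier A) \<Longrightarrow> f (finsum A g I) = (\<Oplus>i\<in>I. f (g i))"
proof (induction I rule: infinite_finite_induct)
  case (insert i I)
  then have "g \<in> I \<rightarrow> carrier A" "g i \<in> carrier A" by auto
  moreover from this have "(\<lambda>i. f (g i)) \<in> I \<rightarrow> carrier A" using additive_onD(1)[OF f] by auto
  ultimately show ?case using insert by (simp add: additive_onD[OF f])
qed (simp_all add: additive_onD[OF f])

lemma additive_on_mult:
  assumes "f \<in> carrier A"
  shows "additive_on A (\<lambda>x. f \<otimes> x)" "additive_on A (\<lambda>x. x \<otimes> f)"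
  using assms by (auto simp: additive_on_def A.r_distr A.l_distr)

lemma additive_on_smult: "c \<in> carrier K \<Longrightarrow> additive_on A (\<lambda>x. c \<odot> x)"
  by (auto simp: additive_on_def smult_r_distr)

lemma hcomp_decomp: "a \<in> carrier A \<Longrightarrow> homog_decomp A a (\<lambda>n. hcomp A n a)"
  unfolding hcomp_def using theI'[OF grade_direct_sum] by auto

lemma hcomp_grade [simp]: "a \<in> carrier A \<Longrightarrow> hcomp A n a \<in> grade A n"
  using hcomp_decomp by (auto simp: homog_decomp_def)

lemma hcomp_carrier [simp]: "a \<in> carrier A \<Longrightarrow> hcomp A n a \<in> carrier A"
  using hcomp_grade grade_carrier by blast

lemma hcomp_support: "a \<in> carrier A \<Longrightarrow> finite {n. hcomp A n a \<noteq> \<zero>}"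
  using hcomp_decomp by (auto simp: homog_decomp_def)

text \<open>\<open>T\<close> may exceed the support, so that several elements can be decomposed over
  one index set.\<close>

lemma hcomp_eqI:
  assumes "finite T" "\<And>n. c n \<in> grade A n" "\<And>n. n \<notin> T \<Longrightarrow> c n = \<zero>" "a = finsum A c T"
  shows "hcomp A n a = c n"
proof -
  have c: "c n \<in> carrier A" for n using assms(2) grade_carrier by blast
  have sub: "{n. c n \<noteq> \<zero>} \<subseteq> T" using assms(3) by auto
  have "finsum A c {n. c n \<noteq> \<zero>} = finsum A c T"
    using A.add.finprod_mono_neutral_cong_left[OF assms(1) sub, of c c] c by auto
  then have h: "homog_decomp A a c"
    using assms sub by (auto simp: homog_decomp_def intro: finite_subset)
  have "a \<in> carrier A" using assms(4) c by auto
  then have "(\<lambda>n. hcomp A n a) = c" using grade_direct_sum hcomp_decomp h by blast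
  then show ?thesis by (simp add: fun_eq_iff)
qed

lemma hcomp_sum:
  assumes "a \<in> carrier A" "finite T" "\<And>n. n \<notin> T \<Longrightarrow> hcomp A n a = \<zero>"
  shows "a = (\<Oplus>n\<in>T. hcomp A n a)"
proof -
  have sub: "{n. hcomp A n a \<noteq> \<zero>} \<subseteq> T" using assms(3) by auto
  have "finsum A (\<lambda>n. hcomp A n a) {n. hcomp A n a \<noteq> \<zero>} = (\<Oplus>n\<in>T. hcomp A n a)"
    by (rule A.add.finprod_mono_neutral_cong_left[OF assms(2) sub]) (use assms in auto)
  then show ?thesis using hcomp_decomp[OF assms(1)] by (simp add: homog_decomp_def)
qed

lemma hcomp_unique: "\<lbrakk>a \<in> carrier A; homog_decomp A a c\<rbrakk> \<Longrightarrow> hcomp A n a = c n"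
  using the1_equality[OF grade_direct_sum] by (simp add: hcomp_def)

lemma homogeneous_iff:
  "I \<subseteq> carrier A \<Longrightarrow> homogeneous A I \<longleftrightarrow> (\<forall>a\<in>I. \<forall>n. hcomp A n a \<in> I)"
  unfolding homogeneous_def by (metis hcomp_decomp hcomp_unique subset_iff)

text \<open>The images of the components of \<open>a\<close>, reindexed by \<open>n + i\<close>,
  decompose \<open>f a\<close>, and decompositions are unique.\<close>

lemma hcomp_additive_shift:
  assumes f: "additive_on A f" and d: "\<And>n x. x \<in> grade A n \<Longrightarrow> f x \<in> grade A (n + i)"
    and a: "a \<in> carrier A"
  shows "hcomp A (n + i) (f a) = f (hcomp A n a)"
proof -
  let ?X = "{n. hcomp A n a \<noteq> \<zero>}"
  let ?c = "\<lambda>m. f (hcomp A (m - i) a)"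
  have T: "finite ?X" using a by (rule hcomp_support)
  have "hcomp A (n + i) (f a) = ?c (n + i)"
  proof (rule hcomp_eqI)
    show "finite ((\<lambda>n. n + i) ` ?X)" using T by simp
    show "?c m \<in> grade A m" for m using d[OF hcomp_grade[OF a, of "m - i"]] by simp
    show "?c m = \<zero>" if "m \<notin> (\<lambda>n. n + i) ` ?X" for m
    proof -
      have "m - i \<notin> ?X" using that image_eqI[of m "\<lambda>n. n + i" "m - i" ?X] by auto
      then show ?thesis using additive_onD(3)[OF f] by simp
    qed
    have "f a = f (\<Oplus>n\<in>?X. hcomp A n a)" using hcomp_sum[OF a T] by simp
    also have "\<dots> = (\<Oplus>n\<in>?X. f (hcomp A n a))" by (rule additive_on_finsum[OF f]) (use a in auto)
    also have "\<dots> = finsum A ?c ((\<lambda>n. n + i) ` ?X)"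
      using A.add.finprod_reindex[of ?c "\<lambda>n. n + i" ?X] additive_onD(1)[OF f] a by (auto simp: inj_on_def)
    finally show "f a = finsum A ?c ((\<lambda>n. n + i) ` ?X)" .
  qed
  then show ?thesis by simp
qed

lemma hcomp_same: "a \<in> grade A n \<Longrightarrow> hcomp A m a = (if m = n then a else \<zero>)"
  by (rule hcomp_eqI[of "{n}"]) (auto simp: A.finsum_insert grade_carrier)

lemma hcomp_additive: "additive_on A (hcomp A n)"
  unfolding additive_on_def
proof (intro conjI ballI)
  fix x y assume xy: "x \<in> carrier A" "y \<in> carrier A"
  let ?X = "{n. hcomp A n x \<noteq> \<zero>} \<union> {n. hcomp A n y \<noteq> \<zero>}"
  have T: "finite ?X" using xy hcomp_support by simp
  show "hcomp A n (x \<oplus> y) = hcomp A n x \<oplus> hcomp A n y"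
  proof (rule hcomp_eqI[OF T])
    have "x = (\<Oplus>n\<in>?X. hcomp A n x)" "y = (\<Oplus>n\<in>?X. hcomp A n y)"
      using hcomp_sum[OF xy(1) T] hcomp_sum[OF xy(2) T] by auto
    then show "x \<oplus> y = (\<Oplus>n\<in>?X. hcomp A n x \<oplus> hcomp A n y)"
      using A.finsum_addf[of "\<lambda>n. hcomp A n x" ?X "\<lambda>n. hcomp A n y"] xy by auto
  qed (use xy in auto)
qed auto

lemmas hcomp_hom [simp] = additive_onD(2-5)[OF hcomp_additive]

lemma hcomp_mult_left:
  assumes "f \<in> grade A i" "a \<in> carrier A"
  shows "hcomp A n (f \<otimes> a) = f \<otimes> hcomp A (n - i) a"
proof -
  have "\<And>m x. x \<in> grade A m \<Longrightarrow> f \<otimes> x \<in> grade A (m + i)"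
    using grade_mult[OF assms(1)] by (simp add: add.commute)
  from hcomp_additive_shift[OF additive_on_mult(1) this assms(2), of "n - i"] grade_carrier[OF assms(1)]
  show ?thesis by simp
qed

lemma hcomp_mult_right:
  assumes "f \<in> grade A i" "a \<in> carrier A"
  shows "hcomp A n (a \<otimes> f) = hcomp A (n - i) a \<otimes> f"
  using hcomp_additive_shift[OF additive_on_mult(2) _ assms(2), of f i "n - i"] assms grade_carrier[OF assms(1)]
  by (simp add: grade_mult)

lemma hcomp_smult:
  assumes "c \<in> carrier K" "a \<in> carrier A"
  shows "hcomp A n (c \<odot> a) = c \<odot> hcomp A n a"
  using hcomp_additive_shift[OF additive_on_smult _ assms(2), of c 0 "n"] assms by simp

lemma homog_induct [consumes 1, case_names homog add]:
  assumes a: "a \<in> carrier A" and h: "\<And>n x. x \<in> grade A n \<Longrightarrow> P x"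
    and add: "\<And>x y. \<lbrakk>x \<in> carrier A; y \<in> carrier A; P x; P y\<rbrakk> \<Longrightarrow> P (x \<oplus> y)"
  shows "P a"
proof -
  have "P (\<Oplus>n\<in>T. hcomp A n a)" for T
  proof (induction T rule: infinite_finite_induct)
    case (insert n T)
    then show ?case using a h[OF hcomp_grade[OF a]] by (auto intro!: add)
  qed (auto intro: h[OF grade_zero])
  moreover have "(\<Oplus>n\<in>{n. hcomp A n a \<noteq> \<zero>}. hcomp A n a) = a"
    using hcomp_sum[OF a hcomp_support[OF a]] by simp
  ultimately show ?thesis by metis
qed

lemma eq_zero_if_hcomp:
  assumes "a \<in> carrier A" "\<And>n. hcomp A n a = \<zero>" shows "a = \<zero>"
  using hcomp_sum[OF assms(1), of "{}"] assms(2) by simp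

lemma additive_eq:
  assumes "additive_on A f" "additive_on A g" "\<And>n x. x \<in> grade A n \<Longrightarrow> f x = g x" "a \<in> carrier A"
  shows "f a = g a"
  using assms(4)
proof (induction rule: homog_induct)
  case (add x y)
  then show ?case using additive_onD(2)[OF assms(1)] additive_onD(2)[OF assms(2)] by simp
qed (use assms in auto)

text \<open>Finitely many spanning elements have finitely many nonzero components in total, and
  linear combinations acquire no others.\<close>

lemma bounded_if_fin_dim:
  assumes "fin_dim K A"
  obtains N :: int where "\<And>n. N < \<bar>n\<bar> \<Longrightarrow> grade A n = {\<zero>}"
proof -
  obtain G where G: "finite G" "G \<subseteq> carrier A"
    and span: "\<And>a. a \<in> carrier A \<Longrightarrow> \<exists>c. c \<in> G \<rightarrow> carrier K \<and> a = (\<Oplus>x\<in>G. c x \<odot> x)"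
    using assms unfolding fin_dim_def by auto
  let ?X = "\<Union>g\<in>G. {n. hcomp A n g \<noteq> \<zero>}"
  have T: "finite ?X" using G hcomp_support by auto
  then have fin: "finite (abs ` ?X)" by (rule finite_imageI)
  \<comment> \<open>If no spanning element has a nonzero component, this is \<open>Max\<close> of
    the empty set; any value serves then, because every degree is trivial.\<close>
  define N where "N = Max (abs ` ?X)"
  have N: "\<bar>n\<bar> \<le> N" if "n \<in> ?X" for n
    unfolding N_def by (rule Max_ge[OF fin imageI[OF that]])
  have "a = \<zero>" if n: "N < \<bar>n\<bar>" and a: "a \<in> grade A n" for n a
  proof -
    obtain c where c: "c \<in> G \<rightarrow> carrier K" "a = (\<Oplus>x\<in>G. c x \<odot> x)"
      using span[OF grade_carrier[OF a]] by (elim exE conjE)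
    have "a = hcomp A n (\<Oplus>x\<in>G. c x \<odot> x)" unfolding c(2)[symmetric] by (simp add: hcomp_same[OF a])
    also have "\<dots> = (\<Oplus>x\<in>G. hcomp A n (c x \<odot> x))"
      by (rule additive_on_finsum[OF hcomp_additive]) (use c G in auto)
    also have "\<dots> = (\<Oplus>x\<in>G. \<zero>)"
    proof (rule A.finsum_cong')
      fix x assume x: "x \<in> G"
      then have "hcomp A n x = \<zero>" using N[of n] n by force
      moreover have "c x \<in> carrier K" "x \<in> carrier A" using c(1) G x by auto
      ultimately show "hcomp A n (c x \<odot> x) = \<zero>" using hcomp_smult by simp
    qed auto
    finally show ?thesis by simp
  qed
  then have "\<And>n. N < \<bar>n\<bar> \<Longrightarrow> grade A n = {\<zero>}" by auto
  then show ?thesis using that by blast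
qed

end

text \<open>A substitute for the dimension.\<close>
definition rank_on :: "('k, 'm) ring_scheme \<Rightarrow> ('k, 'a, 'n) module_scheme \<Rightarrow> 'a set \<Rightarrow> ('a set \<Rightarrow> nat) \<Rightarrow> bool" where
  "rank_on K A U r \<longleftrightarrow>
     (\<forall>V W. submodule V K A \<and> submodule W K A \<and> V \<subset> W \<and> W \<subseteq> U \<longrightarrow> r V < r W)"

context galg begin

lemma submodule_zero_mem: "submodule V K A \<Longrightarrow> \<zero> \<in> V"
  using subgroup.one_closed[OF submodule.axioms(1), of V K A] by simp

lemma submodule_Int: "\<lbrakk>submodule V K A; submodule W K A\<rbrakk> \<Longrightarrow> submodule (V \<inter> W) K A"
  using submoduleE[of V] submoduleE[of W] submodule_zero_mem[of V] submodule_zero_mem[of W]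
  by (intro submoduleI) auto

lemma submodule_minus: "\<lbrakk>submodule V K A; x \<in> V; y \<in> V\<rbrakk> \<Longrightarrow> x \<ominus> y \<in> V"
  using submoduleE[of V] by (simp add: a_minus_def)

lemma add_minus_add_cancel:
  assumes "a \<in> carrier A" "b \<in> carrier A" "c \<in> carrier A"
  shows "(a \<oplus> b) \<ominus> (a \<oplus> c) = b \<ominus> c"
  using assms by algebra

text \<open>Models \<open>dim V = dim (V \<inter> U) + dim (V / (V \<inter> U))\<close>, where the
  last term is at most one because \<open>U'\<close> exceeds \<open>U\<close> only by multiples of
  \<open>g\<close>. If both terms agreed for \<open>V \<subset> W\<close>, some \<open>v\<close> in
  \<open>V\<close> would have a nonzero coefficient at \<open>g\<close> and could be used to reduce
  every \<open>w\<close> in \<open>W\<close> to an element of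
  \<open>W \<inter> U = V \<inter> U\<close>.\<close>

lemma rank_on_insert:
  assumes U: "submodule U K A" and r: "rank_on K A U r" and g: "g \<in> carrier A"
    and U': "\<And>v. v \<in> U' \<Longrightarrow> \<exists>c\<in>carrier K. \<exists>u\<in>U. v = c \<odot> g \<oplus> u"
  shows "rank_on K A U' (\<lambda>V. r (V \<inter> U) + (if V \<subseteq> U then 0 else 1))"
proof -
  have mono: "r V \<le> r W" if "submodule V K A" "submodule W K A" "V \<subseteq> W" "W \<subseteq> U" for V W
    using r that unfolding rank_on_def by (cases "V = W") (auto simp: psubset_eq less_imp_le)
  have "r (V \<inter> U) + (if V \<subseteq> U then 0 else 1) < r (W \<inter> U) + (if W \<subseteq> U then 0 else 1)"
    if V: "submodule V K A" and W: "submodule W K A" and VW: "V \<subset> W" and WU: "W \<subseteq> U'" for V W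
  proof (rule ccontr)
    assume contra: "\<not> ?thesis"
    have sm: "submodule (V \<inter> U) K A" "submodule (W \<inter> U) K A" using submodule_Int V W U by auto
    have le: "r (V \<inter> U) \<le> r (W \<inter> U)" using mono[OF sm] VW by auto
    have imp: "W \<subseteq> U \<Longrightarrow> V \<subseteq> U" using VW by auto
    have eq: "r (V \<inter> U) = r (W \<inter> U)" and iff: "W \<subseteq> U \<longleftrightarrow> V \<subseteq> U"
      using contra le imp by (auto split: if_splits)
    have eqs: "V \<inter> U = W \<inter> U"
    proof (rule ccontr)
      assume "V \<inter> U \<noteq> W \<inter> U"
      then have "V \<inter> U \<subset> W \<inter> U" using VW by auto
      then have "r (V \<inter> U) < r (W \<inter> U)" using r sm unfolding rank_on_def by auto
      with eq show False by simp
    qed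
    have "\<not> V \<subseteq> U" using eqs iff VW by auto
    then obtain v where v: "v \<in> V" "v \<notin> U" by auto
    then obtain c u where cu: "c \<in> carrier K" "u \<in> U" "v = c \<odot> g \<oplus> u" using WU VW U'[of v] by auto
    have uc: "u \<in> carrier A" using cu submoduleE(1)[OF U] by auto
    have cn: "c \<noteq> \<zero>\<^bsub>K\<^esub>" using v cu g uc by auto
    have "w \<in> V" if w: "w \<in> W" for w
    proof -
      obtain c' u' where cu': "c' \<in> carrier K" "u' \<in> U" "w = c' \<odot> g \<oplus> u'" using w WU U'[of w] by auto
      have uc': "u' \<in> carrier A" using cu' submoduleE(1)[OF U] by auto
      \<comment> \<open>The multiple of \<open>v\<close> that cancels the coefficient of
        \<open>g\<close> in \<open>w\<close>.\<close>
      define s where "s = c' \<otimes>\<^bsub>K\<^esub> inv\<^bsub>K\<^esub> c"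
      have ic: "inv\<^bsub>K\<^esub> c \<in> carrier K" "inv\<^bsub>K\<^esub> c \<otimes>\<^bsub>K\<^esub> c = \<one>\<^bsub>K\<^esub>"
        using cn cu K.field_Units by auto
      have s: "s \<in> carrier K" "s \<otimes>\<^bsub>K\<^esub> c = c'"
        using ic cu cu' by (simp_all add: s_def K.m_assoc)
      have sv: "s \<odot> v = c' \<odot> g \<oplus> s \<odot> u"
        using cu s g uc by (simp add: smult_r_distr flip: s(2)) (simp add: smult_assoc1)
      have wv: "w \<ominus> s \<odot> v = u' \<ominus> s \<odot> u"
        unfolding sv cu'(3) by (rule add_minus_add_cancel) (use cu' s g uc uc' cu in auto)
      have svV: "s \<odot> v \<in> V" using submoduleE(4)[OF V] s v by simp
      have "w \<ominus> s \<odot> v \<in> W" using submodule_minus[OF W w] svV VW by auto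
      moreover have "w \<ominus> s \<odot> v \<in> U"
        unfolding wv using submodule_minus[OF U cu'(2)] submoduleE(4)[OF U] s cu by simp
      ultimately have "w \<ominus> s \<odot> v \<in> V" using eqs by auto
      then have "w \<ominus> s \<odot> v \<oplus> s \<odot> v \<in> V" using submoduleE(5)[OF V] svV by simp
      moreover have "w \<ominus> s \<odot> v \<oplus> s \<odot> v = w"
        using submoduleE(1)[OF W] submoduleE(1)[OF V] w svV by (simp add: a_minus_def A.a_assoc A.l_neg subset_iff)
      ultimately show ?thesis by simp
    qed
    then show False using VW by auto
  qed
  then show ?thesis unfolding rank_on_def by blast
qed

lemma submodule_extend:
  assumes U: "submodule U K A" and g: "g \<in> carrier A"
  shows "submodule {c \<odot> g \<oplus> u | c u. c \<in> carrier K \<and> u \<in> U} K A" (is "submodule ?W K A")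
proof (rule submoduleI)
  note E = submoduleE[OF U]
  have car: "\<And>u. u \<in> U \<Longrightarrow> u \<in> carrier A" using E(1) by blast
  have W: "c \<odot> g \<oplus> u \<in> ?W" if "c \<in> carrier K" "u \<in> U" for c u using that by blast
  show "?W \<subseteq> carrier A" using g car by auto
  show "\<zero> \<in> ?W" using W[OF K.zero_closed submodule_zero_mem[OF U]] g by simp
  show "\<ominus> a \<in> ?W" if aW: "a \<in> ?W" for a
  proof -
    obtain c u where a: "a = c \<odot> g \<oplus> u" "c \<in> carrier K" "u \<in> U" using aW by blast
    then have "\<ominus> a = (\<ominus>\<^bsub>K\<^esub> c) \<odot> g \<oplus> \<ominus> u" using g car[of u] by (simp add: smult_l_minus A.minus_add)
    then show ?thesis using W[of "\<ominus>\<^bsub>K\<^esub> c" "\<ominus> u"] E(3) a by simp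
  qed
  show "a \<oplus> b \<in> ?W" if ab: "a \<in> ?W" "b \<in> ?W" for a b
  proof -
    obtain c u c' u' where a: "a = c \<odot> g \<oplus> u" "c \<in> carrier K" "u \<in> U"
      "b = c' \<odot> g \<oplus> u'" "c' \<in> carrier K" "u' \<in> U" using ab by blast
    then have "a \<oplus> b = (c \<oplus>\<^bsub>K\<^esub> c') \<odot> g \<oplus> (u \<oplus> u')"
      using g car[of u] car[of u'] by (simp add: smult_l_distr A.a_ac)
    then show ?thesis using W[of "c \<oplus>\<^bsub>K\<^esub> c'" "u \<oplus> u'"] E(5) a by simp
  qed
  show "k \<odot> a \<in> ?W" if k: "k \<in> carrier K" and aW: "a \<in> ?W" for k a
  proof -
    obtain c u where a: "a = c \<odot> g \<oplus> u" "c \<in> carrier K" "u \<in> U" using aW by blast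
    then have "k \<odot> a = (k \<otimes>\<^bsub>K\<^esub> c) \<odot> g \<oplus> k \<odot> u"
      using g car[of u] k by (simp add: smult_r_distr smult_assoc1)
    then show ?thesis using W[of "k \<otimes>\<^bsub>K\<^esub> c" "k \<odot> u"] E(4) a k by simp
  qed
qed

text \<open>Spanning vectors are adjoined one at a time. Strict monotonicity is all that is carried
  along, so linear dependence among them does no harm.\<close>

lemma rank_exists:
  assumes "fin_dim K A"
  obtains r where "rank_on K A (carrier A) r"
proof -
  obtain G where G: "finite G" "G \<subseteq> carrier A"
    and span: "\<And>a. a \<in> carrier A \<Longrightarrow> \<exists>c. c \<in> G \<rightarrow> carrier K \<and> a = (\<Oplus>x\<in>G. c x \<odot> x)"
    using assms unfolding fin_dim_def by auto
  let ?span = "\<lambda>G. {(\<Oplus>x\<in>G. c x \<odot> x) | c. c \<in> G \<rightarrow> carrier K}"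
  have "\<exists>U r. submodule U K A \<and> ?span G \<subseteq> U \<and> rank_on K A U r"
    using G
  proof (induction G)
    case empty
    have "submodule {\<zero>} K A" by (rule submoduleI) auto
    moreover have "rank_on K A {\<zero>} (\<lambda>V. 0)" unfolding rank_on_def
      using submodule_zero_mem by fastforce
    ultimately show ?case by (intro exI[of _ "{\<zero>}"]) auto
  next
    case (insert g G)
    then have gG: "g \<in> carrier A" "G \<subseteq> carrier A" by auto
    obtain U r where U: "submodule U K A" and GU: "?span G \<subseteq> U" and r: "rank_on K A U r"
      using insert by auto
    let ?W = "{c \<odot> g \<oplus> u | c u. c \<in> carrier K \<and> u \<in> U}"
    have "?span (insert g G) \<subseteq> ?W"
    proof
      fix y assume "y \<in> ?span (insert g G)"
      then obtain c where c: "c \<in> insert g G \<rightarrow> carrier K" "y = (\<Oplus>x\<in>insert g G. c x \<odot> x)" by auto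
      then have "y = c g \<odot> g \<oplus> (\<Oplus>x\<in>G. c x \<odot> x)"
        using insert gG by (auto intro!: A.finsum_insert)
      moreover have "(\<Oplus>x\<in>G. c x \<odot> x) \<in> U" using GU c(1) by blast
      ultimately show "y \<in> ?W" using c(1) by blast
    qed
    moreover have "\<exists>r. rank_on K A ?W r"
      using rank_on_insert[OF U r gG(1), of ?W] by blast
    ultimately show ?case using submodule_extend[OF U gG(1)] by blast
  qed
  then obtain U r where U: "submodule U K A" "?span G \<subseteq> U" and r: "rank_on K A U r" by blast
  have "carrier A \<subseteq> U" using span U(2) by blast
  then have "U = carrier A" using submoduleE(1)[OF U(1)] by blast
  with r that show ?thesis by simp
qed

lemma submodule_image:
  assumes V: "submodule V K A" and f: "additive_on A f"
    and smult: "\<And>k x. \<lbrakk>k \<in> carrier K; x \<in> carrier A\<rbrakk> \<Longrightarrow> f (k \<odot> x) = k \<odot> f x"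
  shows "submodule (f ` V) K A"
proof (rule submoduleI)
  show "f ` V \<subseteq> carrier A" using submoduleE(1)[OF V] additive_onD(1)[OF f] by auto
  show "\<zero> \<in> f ` V" using imageI[OF submodule_zero_mem[OF V], of f] additive_onD(3)[OF f] by simp
next
  fix a assume "a \<in> f ` V"
  then obtain x where x: "x \<in> V" "a = f x" by blast
  have "x \<in> carrier A" using x submoduleE(1)[OF V] by blast
  then show "\<ominus> a \<in> f ` V"
    using imageI[OF submoduleE(3)[OF V x(1)], of f] x(2) additive_onD(4)[OF f] by simp
next
  fix a b assume "a \<in> f ` V" "b \<in> f ` V"
  then obtain x y where x: "x \<in> V" "a = f x" "y \<in> V" "b = f y" by blast
  have "x \<in> carrier A" "y \<in> carrier A" using x submoduleE(1)[OF V] by blast+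
  then show "a \<oplus> b \<in> f ` V"
    using imageI[OF submoduleE(5)[OF V x(1,3)], of f] x(2,4) additive_onD(2)[OF f] by simp
next
  fix k a assume k: "k \<in> carrier K" and "a \<in> f ` V"
  then obtain x where x: "x \<in> V" "a = f x" by blast
  have "x \<in> carrier A" using x submoduleE(1)[OF V] by blast
  then show "k \<odot> a \<in> f ` V"
    using imageI[OF submoduleE(4)[OF V k x(1)], of f] x(2) smult[OF k] by simp
qed

end

section \<open>The radical\<close>

context galg begin

lemma add_minus_cancel:
  assumes "a \<in> carrier A" "b \<in> carrier A"
  shows "(a \<oplus> b) \<ominus> a = b" "(a \<oplus> b) \<ominus> b = a" "(a \<ominus> b) \<oplus> b = a" "a \<ominus> (a \<ominus> b) = b"
  using assms by algebra+

lemma minus_distrib: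
  assumes "a \<in> carrier A" "b \<in> carrier A" "c \<in> carrier A"
  shows "(a \<ominus> b) \<otimes> c = a \<otimes> c \<ominus> b \<otimes> c" "c \<otimes> (a \<ominus> b) = c \<otimes> a \<ominus> c \<otimes> b"
  using assms by algebra+

lemma minus_add_minus:
  assumes "a \<in> carrier A" "b \<in> carrier A" "c \<in> carrier A" "d \<in> carrier A"
  shows "(a \<oplus> b) \<ominus> (c \<oplus> d) = (a \<ominus> c) \<oplus> (b \<ominus> d)"
  using assms by algebra

lemma smult_minus:
  assumes "c \<in> carrier K" "a \<in> carrier A" "b \<in> carrier A"
  shows "c \<odot> (a \<ominus> b) = c \<odot> a \<ominus> c \<odot> b"
  using assms by (simp add: a_minus_def smult_r_distr smult_r_minus)

text \<open>Closure under negation is absent from the list because it comes from multiplication by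
  \<open>\<ominus> \<one>\<close>.\<close>

lemma graded_left_ideal_iff:
  "graded_left_ideal A I \<longleftrightarrow> I \<subseteq> carrier A \<and> \<zero> \<in> I \<and> (\<forall>x\<in>I. \<forall>y\<in>I. x \<oplus> y \<in> I) \<and>
     (\<forall>x\<in>I. \<forall>n. hcomp A n x \<in> I) \<and> (\<forall>a\<in>carrier A. \<forall>x\<in>I. a \<otimes> x \<in> I)"
proof
  assume I: "graded_left_ideal A I"
  then have s: "additive_subgroup I A" by (simp add: graded_left_ideal_def)
  from I show "I \<subseteq> carrier A \<and> \<zero> \<in> I \<and> (\<forall>x\<in>I. \<forall>y\<in>I. x \<oplus> y \<in> I) \<and>
     (\<forall>x\<in>I. \<forall>n. hcomp A n x \<in> I) \<and> (\<forall>a\<in>carrier A. \<forall>x\<in>I. a \<otimes> x \<in> I)"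
    using additive_subgroup.a_subset[OF s] additive_subgroup.zero_closed[OF s]
      additive_subgroup.a_closed[OF s] homogeneous_iff[of I]
    by (simp add: graded_left_ideal_def)
next
  assume I: "I \<subseteq> carrier A \<and> \<zero> \<in> I \<and> (\<forall>x\<in>I. \<forall>y\<in>I. x \<oplus> y \<in> I) \<and>
     (\<forall>x\<in>I. \<forall>n. hcomp A n x \<in> I) \<and> (\<forall>a\<in>carrier A. \<forall>x\<in>I. a \<otimes> x \<in> I)"
  have neg: "\<ominus> x \<in> I" if "x \<in> I" for x
  proof -
    have "(\<ominus> \<one>) \<otimes> x \<in> I" using I that by simp
    moreover have "(\<ominus> \<one>) \<otimes> x = \<ominus> x" using I that by (simp add: A.l_minus subset_iff)
    ultimately show ?thesis by simp
  qed
  have "additive_subgroup I A"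
    unfolding additive_subgroup_def using I neg
    by (intro A.add.subgroupI) (auto simp: a_inv_def)
  then show "graded_left_ideal A I" using I homogeneous_iff[of I] by (simp add: graded_left_ideal_def)
qed

lemma graded_left_idealD:
  assumes "graded_left_ideal A I"
  shows "I \<subseteq> carrier A" "\<zero> \<in> I" "\<lbrakk>x \<in> I; y \<in> I\<rbrakk> \<Longrightarrow> x \<oplus> y \<in> I" "x \<in> I \<Longrightarrow> hcomp A n x \<in> I"
    "\<lbrakk>a \<in> carrier A; x \<in> I\<rbrakk> \<Longrightarrow> a \<otimes> x \<in> I" "x \<in> I \<Longrightarrow> \<ominus> x \<in> I" "\<lbrakk>x \<in> I; y \<in> I\<rbrakk> \<Longrightarrow> x \<ominus> y \<in> I"
proof -
  have s: "additive_subgroup I A" using assms by (simp add: graded_left_ideal_def)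
  show n: "x \<in> I \<Longrightarrow> \<ominus> x \<in> I" for x
    by (rule additive_subgroup.a_inv_closed[OF s])
  show "\<lbrakk>x \<in> I; y \<in> I\<rbrakk> \<Longrightarrow> x \<ominus> y \<in> I"
    using assms n by (simp add: a_minus_def graded_left_ideal_iff)
qed (use assms in \<open>auto simp: graded_left_ideal_iff\<close>)

lemma graded_left_ideal_one: "\<lbrakk>graded_left_ideal A I; \<one> \<in> I\<rbrakk> \<Longrightarrow> I = carrier A"
  using graded_left_idealD[of I] by (metis A.r_one subsetI subset_antisym)

lemma max_graded_left_ideal_one:
  assumes "max_graded_left_ideal A M" shows "\<one> \<notin> M" "graded_left_ideal A M"
  using assms graded_left_ideal_one by (auto simp: max_graded_left_ideal_def)

text \<open>The left ideal \<open>I b + M\<close> is graded because \<open>b\<close> is homogeneous.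
  It is the test object for maximality of \<open>M\<close>.\<close>

lemma graded_left_ideal_sum:
  assumes I: "graded_left_ideal A I" and b: "b \<in> grade A m" and M: "graded_left_ideal A M"
  shows "graded_left_ideal A {x \<otimes> b \<oplus> y | x y. x \<in> I \<and> y \<in> M}" (is "graded_left_ideal A ?L")
proof -
  note I' = graded_left_idealD[OF I] and M' = graded_left_idealD[OF M]
  have bc: "b \<in> carrier A" using b by (rule grade_carrier)
  have cI: "\<And>x. x \<in> I \<Longrightarrow> x \<in> carrier A" and cM: "\<And>x. x \<in> M \<Longrightarrow> x \<in> carrier A"
    using I'(1) M'(1) by auto
  have L: "x \<otimes> b \<oplus> y \<in> ?L" if "x \<in> I" "y \<in> M" for x y using that by blast
  show ?thesis
    unfolding graded_left_ideal_iff
  proof (intro conjI ballI allI)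
    show "?L \<subseteq> carrier A" using cI cM bc by auto
    show "\<zero> \<in> ?L" using L[OF I'(2) M'(2)] bc by simp
  next
    fix u v assume "u \<in> ?L" "v \<in> ?L"
    then obtain x y x' y' where u: "u = x \<otimes> b \<oplus> y" "x \<in> I" "y \<in> M" "v = x' \<otimes> b \<oplus> y'" "x' \<in> I" "y' \<in> M" by blast
    have "u \<oplus> v = (x \<oplus> x') \<otimes> b \<oplus> (y \<oplus> y')"
      using u bc cI[of x] cI[of x'] cM[of y] cM[of y'] by (simp add: A.l_distr A.a_ac)
    then show "u \<oplus> v \<in> ?L" using L[of "x \<oplus> x'" "y \<oplus> y'"] I'(3) M'(3) u by simp
  next
    fix u n assume "u \<in> ?L"
    then obtain x y where u: "u = x \<otimes> b \<oplus> y" "x \<in> I" "y \<in> M" by blast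
    then have "hcomp A n u = hcomp A (n - m) x \<otimes> b \<oplus> hcomp A n y"
      using cI[of x] cM[of y] bc hcomp_mult_right[OF b] by simp
    then show "hcomp A n u \<in> ?L" using L I'(4) M'(4) u by simp
  next
    fix a u assume a: "a \<in> carrier A" and "u \<in> ?L"
    then obtain x y where u: "u = x \<otimes> b \<oplus> y" "x \<in> I" "y \<in> M" by blast
    have "a \<otimes> u = (a \<otimes> x) \<otimes> b \<oplus> a \<otimes> y"
      using u a bc cI[of x] cM[of y] by (simp add: A.r_distr A.m_assoc)
    then show "a \<otimes> u \<in> ?L" using L[of "a \<otimes> x" "a \<otimes> y"] I'(5) M'(5) a u by simp
  qed
qed

lemma graded_left_ideal_carrier: "graded_left_ideal A (carrier A)"
  by (auto simp: graded_left_ideal_iff)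

abbreviation J where "J \<equiv> gr_radical A"

lemma radical_graded_left_ideal: "graded_left_ideal A J"
proof -
  have "\<And>M. max_graded_left_ideal A M \<Longrightarrow> graded_left_ideal A M" by (simp add: max_graded_left_ideal_def)
  then show ?thesis
    unfolding graded_left_ideal_iff gr_radical_def by (auto intro: graded_left_idealD(2-5))
qed

lemmas radical_closed = graded_left_idealD[OF radical_graded_left_ideal]

lemma radical_carrier [simp]: "x \<in> J \<Longrightarrow> x \<in> carrier A"
  by (simp add: gr_radical_def)

text \<open>For homogeneous \<open>b\<close>, the left ideal quotient \<open>M : b\<close> of a maximal \<open>M\<close> is maximal or everything.\<close>
lemma radical_mult_right_homog:
  assumes x: "x \<in> J" and b: "b \<in> grade A m"
  shows "x \<otimes> b \<in> J"
proof -
  have bc: "b \<in> carrier A" using b by (rule grade_carrier)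
  have xc: "x \<in> carrier A" using x by simp
  have "x \<otimes> b \<in> M" if M: "max_graded_left_ideal A M" for M
  proof -
    have M1: "graded_left_ideal A M" using M by (simp add: max_graded_left_ideal_def)
    note M' = graded_left_idealD[OF M1]
    let ?Q = "{a \<in> carrier A. a \<otimes> b \<in> M}"
    have Q: "graded_left_ideal A ?Q"
      unfolding graded_left_ideal_iff
    proof (intro conjI ballI allI)
      show "?Q \<subseteq> carrier A" by auto
      show "\<zero> \<in> ?Q" using M'(2) bc by simp
    next
      fix u v assume "u \<in> ?Q" "v \<in> ?Q"
      then show "u \<oplus> v \<in> ?Q" using M'(3)[of "u \<otimes> b" "v \<otimes> b"] bc by (simp add: A.l_distr)
    next
      fix u n assume u: "u \<in> ?Q"
      then have "hcomp A (n + m) (u \<otimes> b) = hcomp A n u \<otimes> b" using hcomp_mult_right[OF b] by simp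
      then show "hcomp A n u \<in> ?Q" using M'(4)[of "u \<otimes> b" "n + m"] u by simp
    next
      fix a u assume "a \<in> carrier A" "u \<in> ?Q"
      then show "a \<otimes> u \<in> ?Q" using M'(5)[of a "u \<otimes> b"] bc by (simp add: A.m_assoc)
    qed
    show ?thesis
    proof (cases "?Q = carrier A")
      case False
      have "max_graded_left_ideal A ?Q"
        unfolding max_graded_left_ideal_def
      proof (intro conjI allI impI)
        fix I assume I: "graded_left_ideal A I \<and> ?Q \<subseteq> I"
        note I' = graded_left_idealD[OF conjunct1[OF I]]
        show "I = ?Q \<or> I = carrier A"
        proof (rule disjCI)
          assume "I \<noteq> carrier A"
          \<comment> \<open>Maximality of \<open>M\<close> leaves two values for
            \<open>I b + M\<close>. If it is \<open>M\<close>, then \<open>I b\<close> lies in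
            \<open>M\<close> and \<open>I = ?Q\<close>. If it is everything, then
            \<open>a b = i b + y\<close> for each \<open>a\<close>, so \<open>a \<ominus> i\<close>
            lies in \<open>?Q\<close> and hence \<open>a\<close> in \<open>I\<close>, which was
            excluded.\<close>
          let ?L = "{x \<otimes> b \<oplus> y | x y. x \<in> I \<and> y \<in> M}"
          have L: "graded_left_ideal A ?L" using graded_left_ideal_sum[OF conjunct1[OF I] b M1] .
          have "M \<subseteq> ?L"
          proof
            fix y assume y: "y \<in> M"
            then have "y = \<zero> \<otimes> b \<oplus> y" using M'(1) bc by (auto simp: subset_iff)
            then show "y \<in> ?L" using y I'(2) by blast
          qed
          then have "?L = M \<or> ?L = carrier A" using M L unfolding max_graded_left_ideal_def by blast
          moreover have "?L \<noteq> carrier A"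
          proof
            assume L: "?L = carrier A"
            have "a \<in> I" if a: "a \<in> carrier A" for a
            proof -
              have "a \<otimes> b \<in> ?L" using L a bc by simp
              then obtain i y where iy: "a \<otimes> b = i \<otimes> b \<oplus> y" "i \<in> I" "y \<in> M" by blast
              have c: "i \<in> carrier A" "y \<in> carrier A" using iy I'(1) M'(1) by auto
              have "(a \<ominus> i) \<otimes> b = y"
                using a bc c by (simp add: minus_distrib iy(1) add_minus_cancel)
              then have "a \<ominus> i \<in> ?Q" using iy a c by simp
              then have "a \<ominus> i \<oplus> i \<in> I" using I I'(3) iy by blast
              then show ?thesis using a c by (simp add: a_minus_def A.a_assoc A.l_neg)
            qed
            with \<open>I \<noteq> carrier A\<close> show False using I'(1) by auto
          qed
          ultimately have LM: "?L = M" by simp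
          have "i \<in> ?Q" if i: "i \<in> I" for i
          proof -
            have ic: "i \<in> carrier A" using i I'(1) by auto
            have "i \<otimes> b \<oplus> \<zero> \<in> ?L" using i M'(2) by blast
            then show ?thesis using LM ic bc by simp
          qed
          then show "I = ?Q" using I by blast
        qed
      qed (use Q False in auto)
      then have "x \<in> ?Q" using x unfolding gr_radical_def by blast
      then show ?thesis by simp
    qed (use xc in auto)
  qed
  moreover have "x \<otimes> b \<in> carrier A" using xc bc by (rule A.m_closed)
  ultimately show ?thesis unfolding gr_radical_def by blast
qed

lemma radical_mult_right:
  assumes x: "x \<in> J" and b: "b \<in> carrier A"
  shows "x \<otimes> b \<in> J"
  using b
proof (induction rule: homog_induct)
  case (homog n b)
  then show ?case by (rule radical_mult_right_homog[OF x])
next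
  case (add b c)
  then show ?case using radical_carrier[OF x] radical_closed(3) by (simp add: A.r_distr)
qed

lemma radical_signed: "x \<in> J \<Longrightarrow> signed A n x \<in> J"
  using radical_closed(6) by (simp add: signed_def)

end

locale fdalg = galg K A
  for K :: "('k, 'm) ring_scheme" and A :: "('k, 'a, 'n) galg_scheme" (structure) +
  assumes fd: "fin_dim K A"
begin

text \<open>From an index of least rank on, no member can be properly smaller.\<close>

lemma descending_stable:
  assumes V: "\<And>n::nat. submodule (V n) K A" and dec: "\<And>n. V (Suc n) \<subseteq> V n"
  obtains n where "\<And>m. n \<le> m \<Longrightarrow> V m = V n"
proof -
  obtain r where "rank_on K A (carrier A) r" using rank_exists[OF fd] .
  then have r: "r V < r W" if "submodule V K A" "submodule W K A" "V \<subset> W" for V W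
    using that submoduleE(1) unfolding rank_on_def by blast
  obtain n where n: "\<And>m. r (V n) \<le> r (V m)"
    using ex_has_least_nat[of "\<lambda>_. True" 0 "\<lambda>n. r (V n)"] by auto
  have "V m = V n" if "n \<le> m" for m
  proof -
    have "V m \<subseteq> V n" using lift_Suc_antimono_le[of V, OF dec that] .
    moreover have "\<not> V m \<subset> V n" using r[OF V[of m] V[of n]] n[of m] by linarith
    ultimately show ?thesis by blast
  qed
  then show ?thesis using that by blast
qed

text \<open>If a maximal \<open>M\<close> missed \<open>a\<close>, then \<open>A a + M = A\<close>,
  so \<open>\<one>\<close> would be congruent modulo \<open>M\<close> to some \<open>t = b a\<close>
  of degree \<open>0\<close>. From \<open>1 - t^(k+1) = (1 - t) + t (1 - t^k)\<close> all
  \<open>1 - t^k\<close> lie in the left ideal \<open>M\<close>, and nilpotency of \<open>t\<close>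
  puts \<open>\<one>\<close> there.\<close>

lemma radical_if_nil:
  assumes a: "a \<in> grade A m"
    and nil: "\<And>b. b \<in> grade A (- m) \<Longrightarrow> \<exists>k::nat. (b \<otimes> a) [^] k = \<zero>"
  shows "a \<in> J"
proof -
  have ac: "a \<in> carrier A" using a by (rule grade_carrier)
  have "a \<in> M" if M: "max_graded_left_ideal A M" for M
  proof (rule ccontr)
    assume na: "a \<notin> M"
    have M1: "graded_left_ideal A M" using M by (simp add: max_graded_left_ideal_def)
    note M' = graded_left_idealD[OF M1]
    let ?L = "{x \<otimes> a \<oplus> y | x y. x \<in> carrier A \<and> y \<in> M}"
    have L: "graded_left_ideal A ?L" using graded_left_ideal_sum[OF graded_left_ideal_carrier a M1] .
    have "M \<subseteq> ?L"
    proof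
      fix y assume y: "y \<in> M"
      then have "y = \<zero> \<otimes> a \<oplus> y" using M'(1) ac by (auto simp: subset_iff)
      then show "y \<in> ?L" using y A.zero_closed by blast
    qed
    moreover have "a \<in> ?L"
    proof -
      have "a = \<one> \<otimes> a \<oplus> \<zero>" using ac by simp
      then show ?thesis using M'(2) A.one_closed by blast
    qed
    ultimately have "?L = carrier A" using M L na unfolding max_graded_left_ideal_def by blast
    then have "\<one> \<in> ?L" by simp
    then obtain x y where xy: "\<one> = x \<otimes> a \<oplus> y" "x \<in> carrier A" "y \<in> M" by blast
    have yc: "y \<in> carrier A" using xy M'(1) by auto
    \<comment> \<open>Passing to components of degree \<open>0\<close> in
      \<open>\<one> = x \<otimes> a \<oplus> y\<close> replaces \<open>x\<close> by a homogeneous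
      coefficient, to which \<open>nil\<close> applies.\<close>
    let ?b = "hcomp A (- m) x" let ?t = "?b \<otimes> a"
    have "hcomp A 0 \<one> = ?t \<oplus> hcomp A 0 y"
      unfolding xy(1) using xy(2) yc ac hcomp_mult_right[OF a xy(2), of 0] by simp
    then have 1: "\<one> = ?t \<oplus> hcomp A 0 y" using hcomp_same[OF grade_one] by simp
    have t: "?t \<in> carrier A" using xy ac by simp
    have "\<one> \<ominus> ?t = hcomp A 0 y"
      using add_minus_cancel(1)[of ?t "hcomp A 0 y"] t yc by (simp flip: 1)
    then have 2: "\<one> \<ominus> ?t \<in> M" using M'(4)[OF xy(3)] by simp
    have "\<one> \<ominus> ?t [^] k \<in> M" for k :: nat
    proof (induction k)
      case 0
      then show ?case using M'(2) by (simp add: a_minus_def A.r_neg)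
    next
      case (Suc k)
      have "\<one> \<ominus> ?t [^] Suc k = (\<one> \<ominus> ?t) \<oplus> ?t \<otimes> (\<one> \<ominus> ?t [^] k)"
      proof -
        have p: "?t [^] Suc k = ?t \<otimes> ?t [^] k" using t by (rule A.nat_pow_Suc2)
        have "?t [^] k \<in> carrier A" using t by simp
        moreover have "(a \<ominus> b) \<oplus> (b \<ominus> c) = a \<ominus> c"
          if "a \<in> carrier A" "b \<in> carrier A" "c \<in> carrier A" for a b c
          using that by algebra
        ultimately show ?thesis unfolding p using t by (simp add: minus_distrib)
      qed
      then show ?case using M'(3)[OF 2 M'(5)[OF t Suc]] by simp
    qed
    moreover obtain k :: nat where "?t [^] k = \<zero>" using nil[of ?b] xy by auto
    ultimately have "\<one> \<ominus> \<zero> \<in> M" by metis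
    then have "\<one> \<in> M" by (simp add: a_minus_def)
    then show False using max_graded_left_ideal_one[OF M] by simp
  qed
  then show ?thesis using ac unfolding gr_radical_def by blast
qed

text \<open>Fitting's lemma: both chains \<open>A\<^sub>0 t\<^sup>n\<close> and \<open>t\<^sup>n A\<^sub>0\<close> become stationary.\<close>
lemma nonnilpotent_idempotent:
  assumes t: "t \<in> grade A 0" and nn: "\<And>k::nat. t [^] k \<noteq> \<zero>"
  obtains e c where "e \<in> grade A 0" "c \<in> grade A 0" "e \<otimes> e = e" "e \<noteq> \<zero>" "e = c \<otimes> t"
    "\<And>f. \<lbrakk>f \<in> carrier A; f \<otimes> t = t\<rbrakk> \<Longrightarrow> f \<otimes> e = e"
    "\<And>f. \<lbrakk>f \<in> carrier A; t \<otimes> f = t\<rbrakk> \<Longrightarrow> e \<otimes> f = e"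
proof -
  have tc [simp]: "t \<in> carrier A" using t by (rule grade_carrier)
  have pc: "t [^] n \<in> carrier A" for n :: nat by simp
  have sub: "submodule ((\<lambda>x. x \<otimes> y) ` grade A 0) K A" "submodule ((\<lambda>x. y \<otimes> x) ` grade A 0) K A"
    if y: "y \<in> carrier A" for y
    using submodule_image[OF grade_submodule additive_on_mult(2)[OF y]]
      submodule_image[OF grade_submodule additive_on_mult(1)[OF y]] y
    by (simp_all add: smult_mult_left smult_mult_right)
  let ?V = "\<lambda>n::nat. (\<lambda>x. x \<otimes> t [^] n) ` grade A 0"
  let ?W = "\<lambda>n::nat. (\<lambda>x. t [^] n \<otimes> x) ` grade A 0"
  have "?V (Suc n) \<subseteq> ?V n" for n
  proof
    fix a assume "a \<in> ?V (Suc n)"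
    then obtain x where x: "x \<in> grade A 0" "a = x \<otimes> t [^] Suc n" by blast
    have "a = (x \<otimes> t) \<otimes> t [^] n"
      unfolding x(2) A.nat_pow_Suc2[OF tc] by (rule A.m_assoc[symmetric]) (use x(1) grade_carrier in auto)
    then show "a \<in> ?V n" by (rule image_eqI) (simp add: x t)
  qed
  from descending_stable[of ?V, OF sub(1)[OF pc] this] obtain n1 where n1: "\<And>m. n1 \<le> m \<Longrightarrow> ?V m = ?V n1" by blast
  have "?W (Suc n) \<subseteq> ?W n" for n
  proof
    fix a assume "a \<in> ?W (Suc n)"
    then obtain x where x: "x \<in> grade A 0" "a = t [^] Suc n \<otimes> x" by blast
    then have "a = t [^] n \<otimes> (t \<otimes> x)" using grade_carrier[OF x(1)] by (simp add: A.m_assoc)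
    then show "a \<in> ?W n" by (rule image_eqI) (simp add: x t)
  qed
  from descending_stable[of ?W, OF sub(2)[OF pc] this] obtain n2 where n2: "\<And>m. n2 \<le> m \<Longrightarrow> ?W m = ?W n2" by blast
  \<comment> \<open>Both chains are stationary here, so \<open>n\<close> and \<open>n + n\<close>
    give the same submodules. The successor guarantees a factor \<open>t\<close> to split off, as
    \<open>e = c \<otimes> t\<close> demands even if both chains are constant.\<close>
  define n where "n = Suc (max n1 n2)"
  define s where "s = t [^] n"
  have sc [simp]: "s \<in> carrier A" by (simp add: s_def)
  have ss: "t [^] (n + n) = s \<otimes> s" by (simp add: s_def A.nat_pow_mult)
  have "?V n = ?V (n + n)" using n1[of n] n1[of "n + n"] by (simp add: n_def)
  moreover have "s \<in> ?V n" by (rule image_eqI[of _ _ \<one>]) (auto simp: s_def grade_one)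
  ultimately obtain c where c: "c \<in> grade A 0" "s = c \<otimes> (s \<otimes> s)" unfolding ss[symmetric] by blast
  have "?W n = ?W (n + n)" using n2[of n] n2[of "n + n"] by (simp add: n_def)
  moreover have "s \<in> ?W n" by (rule image_eqI[of _ _ \<one>]) (auto simp: s_def grade_one)
  ultimately obtain c' where c': "c' \<in> grade A 0" "s = (s \<otimes> s) \<otimes> c'" unfolding ss[symmetric] by blast
  have cc [simp]: "c \<in> carrier A" "c' \<in> carrier A" using c c' grade_carrier by blast+
  \<comment> \<open>From \<open>s = c s s = s s c'\<close> one gets
    \<open>c s = c s s c' = s c'\<close>. The form \<open>s c'\<close> shows that left units of
    \<open>t\<close> fix \<open>e\<close>, the form \<open>c s\<close> does the same for right
    units.\<close>
  define e where "e = c \<otimes> s"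
  have e2: "e = s \<otimes> c'"
  proof -
    have "c \<otimes> s = c \<otimes> ((s \<otimes> s) \<otimes> c')" using c' by simp
    also have "\<dots> = (c \<otimes> (s \<otimes> s)) \<otimes> c'" by (simp add: A.m_assoc)
    finally show ?thesis using c by (simp add: e_def)
  qed
  have es: "e \<otimes> s = s" using c by (simp add: e_def A.m_assoc)
  have ee: "e \<otimes> e = e"
  proof -
    have ec: "e \<in> carrier A" by (simp add: e_def)
    have "e \<otimes> (s \<otimes> c') = s \<otimes> c'" using A.m_assoc[OF ec sc cc(2)] es by simp
    then show ?thesis by (simp flip: e2)
  qed
  have "s \<noteq> \<zero>" using nn by (simp add: s_def)
  then have en: "e \<noteq> \<zero>" using es by auto
  have sg: "s \<in> grade A 0" using t by (simp add: s_def grade_pow)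
  show ?thesis
  proof (rule that[of e "c \<otimes> t [^] max n1 n2"])
    show "e = (c \<otimes> t [^] max n1 n2) \<otimes> t" by (simp add: e_def s_def n_def A.m_assoc)
    show "f \<otimes> e = e" if f: "f \<in> carrier A" "f \<otimes> t = t" for f
    proof -
      have "s = t \<otimes> t [^] max n1 n2" unfolding s_def n_def by (rule A.nat_pow_Suc2) simp
      then have "f \<otimes> s = s" using f by (simp flip: A.m_assoc)
      then show ?thesis using f by (simp add: e2 flip: A.m_assoc)
    qed
    show "e \<otimes> f = e" if f: "f \<in> carrier A" "t \<otimes> f = t" for f
    proof -
      have "s \<otimes> f = s" using f by (simp add: s_def n_def A.m_assoc)
      then show ?thesis using f by (simp add: e_def A.m_assoc)
    qed
    show "e \<in> grade A 0" using c sg by (simp add: e_def)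
    show "c \<otimes> t [^] max n1 n2 \<in> grade A 0" using c t by (simp add: grade_pow)
  qed (use ee en in auto)
qed

end

section \<open>Primitive idempotents\<close>

definition idem0 :: "('k, 'a, 'n) galg_scheme \<Rightarrow> 'a \<Rightarrow> bool" where
  "idem0 A f \<longleftrightarrow> f \<in> grade A 0 \<and> f \<otimes>\<^bsub>A\<^esub> f = f"

definition primitive :: "('k, 'a, 'n) galg_scheme \<Rightarrow> 'a \<Rightarrow> bool" where
  "primitive A f \<longleftrightarrow> idem0 A f \<and> f \<noteq> \<zero>\<^bsub>A\<^esub> \<and>
     (\<forall>e. idem0 A e \<and> f \<otimes>\<^bsub>A\<^esub> e = e \<and> e \<otimes>\<^bsub>A\<^esub> f = e \<longrightarrow> e = \<zero>\<^bsub>A\<^esub> \<or> e = f)"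

text \<open>The degree \<open>m\<close> part of the Peirce block \<open>f A g\<close>, for
  idempotents \<open>f\<close> and \<open>g\<close>.\<close>

definition corner :: "('k, 'a, 'n) galg_scheme \<Rightarrow> 'a \<Rightarrow> int \<Rightarrow> 'a \<Rightarrow> 'a set" where
  "corner A f m g = {a \<in> grade A m. f \<otimes>\<^bsub>A\<^esub> a = a \<and> a \<otimes>\<^bsub>A\<^esub> g = a}"

text \<open>Equivalence of idempotents up to a shift: right multiplication by \<open>a\<close> is an
  isomorphism from \<open>A f\<close> to \<open>A g\<close> that raises degrees by
  \<open>m\<close>.\<close>

definition idem_iso :: "('k, 'a, 'n) galg_scheme \<Rightarrow> int \<Rightarrow> 'a \<Rightarrow> 'a \<Rightarrow> bool" where
  "idem_iso A m f g \<longleftrightarrow> (\<exists>a\<in>corner A f m g. \<exists>b\<in>corner A g (- m) f. a \<otimes>\<^bsub>A\<^esub> b = f \<and> b \<otimes>\<^bsub>A\<^esub> a = g)"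

context galg begin

lemma idem_iso_refl: "idem0 A f \<Longrightarrow> idem_iso A 0 f f"
  by (auto simp: idem_iso_def corner_def idem0_def)

lemma idem_iso_sym: "idem_iso A m f g \<Longrightarrow> idem_iso A (- m) g f"
  by (auto simp: idem_iso_def)

lemma corner_mult:
  assumes "a \<in> corner A f m g" "b \<in> corner A g n h" "f \<in> carrier A" "h \<in> carrier A"
  shows "a \<otimes> b \<in> corner A f (m + n) h"
proof -
  have c: "a \<in> carrier A" "b \<in> carrier A" using assms grade_carrier by (auto simp: corner_def)
  have "f \<otimes> (a \<otimes> b) = (f \<otimes> a) \<otimes> b" using c assms by (simp add: A.m_assoc)
  then have "f \<otimes> (a \<otimes> b) = a \<otimes> b" using assms by (simp add: corner_def)
  moreover have "(a \<otimes> b) \<otimes> h = a \<otimes> b" using c assms by (simp add: A.m_assoc corner_def)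
  ultimately show ?thesis using assms by (simp add: corner_def grade_mult)
qed

lemma corner_carrier: "a \<in> corner A f m g \<Longrightarrow> a \<in> carrier A"
  by (auto simp: corner_def intro: grade_carrier)

lemma idem0_carrier: "idem0 A f \<Longrightarrow> f \<in> carrier A"
  by (auto simp: idem0_def intro: grade_carrier)

lemma idem_iso_trans:
  assumes "idem_iso A m f g" "idem_iso A n g h" "f \<in> carrier A" "g \<in> carrier A" "h \<in> carrier A"
  shows "idem_iso A (m + n) f h"
proof -
  obtain a b where ab: "a \<in> corner A f m g" "b \<in> corner A g (- m) f" "a \<otimes> b = f" "b \<otimes> a = g"
    using assms(1) by (auto simp: idem_iso_def)
  obtain c d where cd: "c \<in> corner A g n h" "d \<in> corner A h (- n) g" "c \<otimes> d = g" "d \<otimes> c = h"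
    using assms(2) by (auto simp: idem_iso_def)
  note car = ab(1,2)[THEN corner_carrier] cd(1,2)[THEN corner_carrier]
  have 1: "a \<otimes> c \<in> corner A f (m + n) h" using corner_mult ab cd assms by blast
  have 2: "d \<otimes> b \<in> corner A h (- (m + n)) f"
    using corner_mult[of d h "- n" g b "- m" f] ab cd assms by (simp add: algebra_simps)
  have "(a \<otimes> c) \<otimes> (d \<otimes> b) = a \<otimes> ((c \<otimes> d) \<otimes> b)" using car by (simp add: A.m_assoc)
  then have 3: "(a \<otimes> c) \<otimes> (d \<otimes> b) = f" using ab cd by (simp add: corner_def)
  have "(d \<otimes> b) \<otimes> (a \<otimes> c) = d \<otimes> ((b \<otimes> a) \<otimes> c)" using car by (simp add: A.m_assoc)
  then have 4: "(d \<otimes> b) \<otimes> (a \<otimes> c) = h" using ab cd by (simp add: corner_def)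
  from 1 2 3 4 show ?thesis unfolding idem_iso_def by blast
qed

end

context fdalg begin

text \<open>A self-isomorphism of nonzero degree would have nonzero powers in infinitely many degrees.\<close>
lemma idem_iso_self:
  assumes f: "idem0 A f" "f \<noteq> \<zero>" and iso: "idem_iso A m f f"
  shows "m = 0"
proof (rule ccontr)
  assume m: "m \<noteq> 0"
  obtain N where N: "\<And>n. N < \<bar>n\<bar> \<Longrightarrow> grade A n = {\<zero>}" using bounded_if_fin_dim[OF fd] by blast
  have fc: "f \<in> carrier A" using f by (simp add: idem0_carrier)
  have pow: "idem_iso A (int k * m) f f" for k
  proof (induction k)
    case 0
    then show ?case using idem_iso_refl[OF f(1)] by simp
  next
    case (Suc k)
    then show ?case using idem_iso_trans[OF iso Suc fc fc fc] by (simp add: algebra_simps)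
  qed
  obtain k where k: "N < \<bar>int k * m\<bar>"
  proof
    have "int (nat \<bar>N\<bar> + 1) \<le> int (nat \<bar>N\<bar> + 1) * \<bar>m\<bar>"
      using m mult_left_mono[of 1 "\<bar>m\<bar>" "int (nat \<bar>N\<bar> + 1)"] by simp
    moreover have "N < int (nat \<bar>N\<bar> + 1)" by simp
    ultimately have "N < int (nat \<bar>N\<bar> + 1) * \<bar>m\<bar>" by linarith
    then show "N < \<bar>int (nat \<bar>N\<bar> + 1) * m\<bar>" by (simp add: abs_mult)
  qed
  obtain a b where ab: "a \<in> corner A f (int k * m) f" "b \<in> corner A f (- (int k * m)) f" "a \<otimes> b = f"
    using pow[of k] by (auto simp: idem_iso_def)
  have "a = \<zero>" using ab(1) N[OF k] by (auto simp: corner_def)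
  then have "f = \<zero>" using ab corner_carrier[OF ab(2)] by simp
  with f show False by simp
qed

text \<open>Outside the radical, some \<open>b a\<close> is not nilpotent. Compressed to
  \<open>g A g\<close> it produces, by Fitting, a nonzero idempotent below \<open>g\<close> that is
  a left multiple of \<open>a\<close>, and primitivity makes this idempotent equal to
  \<open>g\<close>.\<close>

lemma primitive_left_inverse:
  assumes f: "idem0 A f" and g: "primitive A g" and a: "a \<in> corner A f m g" "a \<notin> J"
  obtains b where "b \<in> corner A g (- m) f" "b \<otimes> a = g"
proof -
  have gi: "g \<in> grade A 0" "g \<otimes> g = g" using g by (auto simp: primitive_def idem0_def)
  have fi: "f \<in> grade A 0" "f \<otimes> f = f" using f by (auto simp: idem0_def)
  have ag: "a \<in> grade A m" "f \<otimes> a = a" "a \<otimes> g = a" using a by (auto simp: corner_def)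
  have car: "g \<in> carrier A" "f \<in> carrier A" "a \<in> carrier A" using gi fi ag grade_carrier by auto
  obtain b where b: "b \<in> grade A (- m)" "\<And>k::nat. (b \<otimes> a) [^] k \<noteq> \<zero>"
    using radical_if_nil[OF ag(1)] a(2) by blast
  have bc: "b \<in> carrier A" using b(1) by (rule grade_carrier)
  \<comment> \<open>The factor \<open>g\<close> places \<open>t\<close> in \<open>g A g\<close>. As
    \<open>a g = a\<close>, it does not affect \<open>a t^k = a (b a)^k\<close>, so \<open>t\<close>
    is still not nilpotent.\<close>
  define t where "t = g \<otimes> (b \<otimes> a)"
  have tc: "t \<in> carrier A" using car bc by (simp add: t_def)
  have t0: "t \<in> grade A 0" using grade_mult[OF b(1) ag(1)] gi by (simp add: t_def)
  have at: "a \<otimes> t = a \<otimes> (b \<otimes> a)"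
    using car bc ag by (simp add: t_def flip: A.m_assoc)
  have pow: "a \<otimes> t [^] k = a \<otimes> (b \<otimes> a) [^] k" for k :: nat
  proof (induction k)
    case (Suc k)
    have "a \<otimes> t [^] Suc k = (a \<otimes> t) \<otimes> t [^] k"
      unfolding A.nat_pow_Suc2[OF tc] using tc car by (simp add: A.m_assoc)
    also have "\<dots> = (a \<otimes> b) \<otimes> (a \<otimes> t [^] k)" unfolding at using car bc tc by (simp add: A.m_assoc)
    also have "\<dots> = a \<otimes> ((b \<otimes> a) \<otimes> (b \<otimes> a) [^] k)" unfolding Suc using car bc by (simp add: A.m_assoc)
    also have "(b \<otimes> a) \<otimes> (b \<otimes> a) [^] k = (b \<otimes> a) [^] Suc k"
      using A.nat_pow_Suc2[of "b \<otimes> a" k] car bc by simp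
    finally show ?case .
  qed (use car in auto)
  have tn: "t [^] k \<noteq> \<zero>" for k :: nat
  proof
    assume 0: "t [^] k = \<zero>"
    have "b \<otimes> (a \<otimes> (b \<otimes> a) [^] k) = \<zero>" unfolding pow[symmetric] 0 using car bc by simp
    then have "(b \<otimes> a) [^] Suc k = \<zero>"
      using A.nat_pow_Suc2[of "b \<otimes> a" k] car bc by (simp add: A.m_assoc)
    then show False using b(2) by blast
  qed
  obtain e c where ec: "e \<in> grade A 0" "c \<in> grade A 0" "e \<otimes> e = e" "e \<noteq> \<zero>" "e = c \<otimes> t"
    "\<And>f. \<lbrakk>f \<in> carrier A; f \<otimes> t = t\<rbrakk> \<Longrightarrow> f \<otimes> e = e"
    "\<And>f. \<lbrakk>f \<in> carrier A; t \<otimes> f = t\<rbrakk> \<Longrightarrow> e \<otimes> f = e"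
    using nonnilpotent_idempotent[OF t0 tn] by blast
  have "g \<otimes> t = t" "t \<otimes> g = t"
    using car bc gi ag by (simp_all add: t_def A.m_assoc) (simp flip: A.m_assoc)
  then have "g \<otimes> e = e" "e \<otimes> g = e" using ec(6,7) car by blast+
  then have eg: "e = g" using g ec by (auto simp: primitive_def idem0_def)
  have cc: "c \<in> carrier A" using ec(2) by (rule grade_carrier)
  \<comment> \<open>From \<open>g = c t = c g b a\<close>; the outer \<open>g\<close> and the final
    \<open>f\<close> move the left inverse into the block \<open>g A f\<close> and are harmless
    because \<open>g g = g\<close> and \<open>f a = a\<close>.\<close>
  let ?b = "g \<otimes> (c \<otimes> (g \<otimes> (b \<otimes> f)))"
  show ?thesis
  proof (rule that[of ?b])
    have "?b \<in> grade A (- m)" using gi fi ec b by simp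
    moreover have "g \<otimes> ?b = ?b" using car cc bc gi by (simp flip: A.m_assoc)
    moreover have "?b \<otimes> f = ?b" using car cc bc fi by (simp add: A.m_assoc)
    ultimately show "?b \<in> corner A g (- m) f" by (simp add: corner_def)
    have "?b \<otimes> a = g \<otimes> (c \<otimes> t)" using car cc bc ag by (simp add: A.m_assoc t_def)
    then show "?b \<otimes> a = g" using ec(5) eg gi by simp
  qed
qed

text \<open>With \<open>b a = g\<close>, the product \<open>a b\<close> is an idempotent below
  \<open>f\<close>. It is nonzero since \<open>g = b (a b) a\<close>, so primitivity of
  \<open>f\<close> makes it \<open>f\<close>.\<close>

lemma primitive_iso:
  assumes f: "primitive A f" and g: "primitive A g" and a: "a \<in> corner A f m g" "a \<notin> J"
  obtains b where "b \<in> corner A g (- m) f" "a \<otimes> b = f" "b \<otimes> a = g"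
proof -
  have f0: "idem0 A f" using f by (simp add: primitive_def)
  have gi: "g \<in> grade A 0" "g \<otimes> g = g" "g \<noteq> \<zero>" using g by (auto simp: primitive_def idem0_def)
  obtain b where b: "b \<in> corner A g (- m) f" "b \<otimes> a = g"
    using primitive_left_inverse[OF f0 g a] .
  have car: "a \<in> carrier A" "b \<in> carrier A" "f \<in> carrier A" "g \<in> carrier A"
    using corner_carrier[OF a(1)] corner_carrier[OF b(1)] idem0_carrier[OF f0] grade_carrier[OF gi(1)] by auto
  define e where "e = a \<otimes> b"
  have "e \<otimes> e = a \<otimes> ((b \<otimes> a) \<otimes> b)" using car by (simp add: e_def A.m_assoc)
  then have ee: "e \<otimes> e = e" using b by (simp add: e_def corner_def)
  have "e \<in> corner A f (m + - m) f" unfolding e_def using corner_mult[OF a(1) b(1)] car by simp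
  then have ef: "e \<in> grade A 0" "f \<otimes> e = e" "e \<otimes> f = e" by (auto simp: corner_def)
  have "e \<noteq> \<zero>"
  proof
    assume e: "e = \<zero>"
    have "g = (b \<otimes> a) \<otimes> (b \<otimes> a)" using b gi by simp
    also have "\<dots> = b \<otimes> (e \<otimes> a)" using car by (simp add: e_def A.m_assoc)
    finally show False using e car gi by simp
  qed
  then have "e = f" using f ee ef by (auto simp: primitive_def idem0_def)
  then show ?thesis using that[OF b(1)] b e_def by simp
qed

text \<open>Induction on the rank of the left ideal \<open>A f\<close>. A proper idempotent
  \<open>e\<close> below \<open>f\<close> splits it into \<open>e\<close> and
  \<open>f \<ominus> e\<close>, and both left ideals shrink because neither contains
  \<open>f\<close>.\<close>

lemma primitive_decomposition:
  assumes "idem0 A f"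
  shows "\<exists>P. finite P \<and> (\<forall>p\<in>P. primitive A p \<and> f \<otimes> p = p \<and> p \<otimes> f = p) \<and>
    (\<forall>p\<in>P. \<forall>q\<in>P. p \<noteq> q \<longrightarrow> p \<otimes> q = \<zero>) \<and> (\<Oplus>p\<in>P. p) = f"
proof -
  obtain r where "rank_on K A (carrier A) r" using rank_exists[OF fd] .
  then have r: "r V < r W" if "submodule V K A" "submodule W K A" "V \<subset> W" for V W
    using that submoduleE(1) unfolding rank_on_def by blast
  let ?V = "\<lambda>f. {x \<in> carrier A. x \<otimes> f = x}"
  have V: "submodule (?V f) K A" if "f \<in> carrier A" for f
    by (rule submoduleI) (use that in \<open>auto simp: A.l_distr A.l_minus smult_mult_left\<close>)
  show ?thesis
    using assms
  proof (induction "r (?V f)" arbitrary: f rule: less_induct)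
    case less
    have f: "f \<in> grade A 0" "f \<otimes> f = f" using less.prems by (auto simp: idem0_def)
    then have fc: "f \<in> carrier A" using grade_carrier by blast
    have sub: "r (?V e) < r (?V f)" if e: "e \<in> carrier A" "e \<otimes> f = e" "e \<otimes> e = e" "e \<noteq> f" "f \<otimes> e = e" for e
    proof (rule r[OF V V])
      have "x \<otimes> f = x" if "x \<in> carrier A" "x \<otimes> e = x" for x
      proof -
        have "x \<otimes> f = (x \<otimes> e) \<otimes> f" using that by simp
        also have "\<dots> = x \<otimes> (e \<otimes> f)" by (rule A.m_assoc) (use that e fc in auto)
        finally show ?thesis using e that by simp
      qed
      then have "?V e \<subseteq> ?V f" by blast
      moreover have "f \<in> ?V f" "f \<notin> ?V e" using f fc e(4,5) by simp_all
      ultimately show "?V e \<subset> ?V f" by blast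
    qed (use e fc in auto)
    show ?case
    proof (cases "f = \<zero> \<or> primitive A f")
      case True
      then show ?thesis
      proof
        assume "f = \<zero>"
        then show ?thesis by (intro exI[of _ "{}"]) simp
      next
        assume "primitive A f"
        then show ?thesis using f fc by (intro exI[of _ "{f}"]) (simp add: A.finsum_insert)
      qed
    next
      case False
      then obtain e where e: "idem0 A e" "f \<otimes> e = e" "e \<otimes> f = e" "e \<noteq> \<zero>" "e \<noteq> f"
        using less.prems by (auto simp: primitive_def)
      have ei: "e \<in> grade A 0" "e \<otimes> e = e" using e by (auto simp: idem0_def)
      have ec: "e \<in> carrier A" using ei(1) by (rule grade_carrier)
      define e' where "e' = f \<ominus> e"
      have e'c: "e' \<in> carrier A" using ec fc by (simp add: e'_def)
      have e'0: "e' \<in> grade A 0" using ei f by (simp add: e'_def)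
      have e'f: "e' \<otimes> f = e'" "f \<otimes> e' = e'"
        using e f ec fc by (simp_all add: e'_def a_minus_def A.l_distr A.r_distr A.l_minus A.r_minus)
      have ee': "e \<otimes> e' = \<zero>" "e' \<otimes> e = \<zero>"
        using e ei f ec fc by (simp_all add: e'_def a_minus_def A.l_distr A.r_distr A.l_minus A.r_minus A.r_neg)
      have e'e': "e' \<otimes> e' = e'"
      proof -
        have "e' \<otimes> (f \<ominus> e) = e'" using ec fc e'c e'f ee' by (simp add: minus_distrib) (simp add: a_minus_def)
        then show ?thesis by (simp add: e'_def)
      qed
      have sum: "e \<oplus> e' = f" using ec fc add_minus_cancel(3)[of f e] A.a_comm[of e] by (simp add: e'_def)
      have "e' \<noteq> f"
      proof
        assume "e' = f"
        then show False using ee' e by simp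
      qed
      then have "r (?V e') < r (?V f)" using sub[of e'] e'c e'f e'e' by simp
      from less.hyps[OF this] obtain P' where P': "finite P'"
        "\<And>p. p \<in> P' \<Longrightarrow> primitive A p \<and> e' \<otimes> p = p \<and> p \<otimes> e' = p"
        "\<And>p q. \<lbrakk>p \<in> P'; q \<in> P'; p \<noteq> q\<rbrakk> \<Longrightarrow> p \<otimes> q = \<zero>" "(\<Oplus>p\<in>P'. p) = e'"
        using e'0 e'e' by (auto simp: idem0_def)
      have "r (?V e) < r (?V f)" using sub[of e] ec e ei by simp
      from less.hyps[OF this] obtain P where P: "finite P"
        "\<And>p. p \<in> P \<Longrightarrow> primitive A p \<and> e \<otimes> p = p \<and> p \<otimes> e = p"
        "\<And>p q. \<lbrakk>p \<in> P; q \<in> P; p \<noteq> q\<rbrakk> \<Longrightarrow> p \<otimes> q = \<zero>" "(\<Oplus>p\<in>P. p) = e"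
        using e by blast
      have car: "p \<in> carrier A" if "p \<in> P \<union> P'" for p
      proof -
        have "p \<in> grade A 0" using that P(2) P'(2) by (auto simp: primitive_def idem0_def)
        then show ?thesis by (rule grade_carrier)
      qed
      have orth: "p \<otimes> q = \<zero> \<and> q \<otimes> p = \<zero>" if "p \<in> P" "q \<in> P'" for p q
      proof -
        have c: "p \<in> carrier A" "q \<in> carrier A" using car that by auto
        have pe: "e \<otimes> p = p" "p \<otimes> e = p" "e' \<otimes> q = q" "q \<otimes> e' = q" using P(2) P'(2) that by auto
        have "p \<otimes> q = (p \<otimes> e) \<otimes> (e' \<otimes> q)" using pe by simp
        also have "\<dots> = p \<otimes> ((e \<otimes> e') \<otimes> q)" using c ec e'c by (simp add: A.m_assoc)
        finally have 1: "p \<otimes> q = \<zero>" using ee' c by simp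
        have "q \<otimes> p = (q \<otimes> e') \<otimes> (e \<otimes> p)" using pe by simp
        also have "\<dots> = q \<otimes> ((e' \<otimes> e) \<otimes> p)" using c ec e'c by (simp add: A.m_assoc)
        finally show ?thesis using 1 ee' c by simp
      qed
      have disj: "P \<inter> P' = {}"
      proof (rule ccontr)
        assume "P \<inter> P' \<noteq> {}"
        then obtain p where p: "p \<in> P" "p \<in> P'" by blast
        then have "p \<otimes> p = \<zero>" using orth by blast
        moreover have "p \<otimes> p = p" "p \<noteq> \<zero>" using P(2)[OF p(1)] by (auto simp: primitive_def idem0_def)
        ultimately show False by simp
      qed
      have absorb: "f \<otimes> p = p \<and> p \<otimes> f = p" if p: "p \<in> P \<union> P'" for p
      proof -
        obtain h where h: "h \<in> carrier A" "h \<otimes> p = p" "p \<otimes> h = p" "f \<otimes> h = h" "h \<otimes> f = h"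
          using p
        proof
          assume "p \<in> P"
          then show thesis using that[of e] P(2)[of p] ec e by simp
        next
          assume "p \<in> P'"
          then show thesis using that[of e'] P'(2)[of p] e'c e'f by simp
        qed
        have "(f \<otimes> h) \<otimes> p = f \<otimes> (h \<otimes> p)" by (rule A.m_assoc) (use h car[OF p] fc in auto)
        moreover have "(p \<otimes> h) \<otimes> f = p \<otimes> (h \<otimes> f)" by (rule A.m_assoc) (use h car[OF p] fc in auto)
        ultimately show ?thesis using h by simp
      qed
      have "(\<Oplus>p\<in>P \<union> P'. p) = (\<Oplus>p\<in>P. p) \<oplus> (\<Oplus>p\<in>P'. p)"
        by (rule A.finsum_Un_disjoint) (use P(1) P'(1) disj car in auto)
      then have s: "(\<Oplus>p\<in>P \<union> P'. p) = f" using P(4) P'(4) sum by simp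
      have "\<forall>p\<in>P \<union> P'. primitive A p \<and> f \<otimes> p = p \<and> p \<otimes> f = p" using P(2) P'(2) absorb by blast
      moreover have "\<forall>p\<in>P \<union> P'. \<forall>q\<in>P \<union> P'. p \<noteq> q \<longrightarrow> p \<otimes> q = \<zero>"
        using P(3) P'(3) orth by blast
      moreover have "finite (P \<union> P')" using P(1) P'(1) by simp
      ultimately show ?thesis using s by (intro exI[of _ "P \<union> P'"] conjI)
    qed
  qed
qed

end

text \<open>
  \<open>\<rho>\<close> names the isomorphism classes in a complete set of orthogonal primitive idempotents,
  and \<open>\<delta>\<close> records the degree shifts, so that modulo the radical the grading of the block
  \<open>f A g\<close> is concentrated in degree \<open>\<delta> f - \<delta> g\<close>.
\<close>
definition peirce_frame ::
  "('k, 'a, 'n) galg_scheme \<Rightarrow> 'a set \<Rightarrow> ('a \<Rightarrow> 'a) \<Rightarrow> ('a \<Rightarrow> int) \<Rightarrow> bool" where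
  "peirce_frame A P \<rho> \<delta> \<longleftrightarrow> finite P \<and> P \<subseteq> grade A 0 \<and> \<zero>\<^bsub>A\<^esub> \<notin> P \<and>
     (\<forall>p\<in>P. \<forall>q\<in>P. p \<otimes>\<^bsub>A\<^esub> q = (if p = q then p else \<zero>\<^bsub>A\<^esub>)) \<and> finsum A (\<lambda>p. p) P = \<one>\<^bsub>A\<^esub> \<and>
     (\<forall>f\<in>P. \<forall>g\<in>P. \<rho> f = \<rho> g \<longrightarrow> idem_iso A (\<delta> f - \<delta> g) f g) \<and>
     (\<forall>f\<in>P. \<forall>g\<in>P. \<forall>m. \<forall>a\<in>corner A f m g. a \<notin> gr_radical A \<longrightarrow>
        \<rho> f = \<rho> g \<and> m = \<delta> f - \<delta> g \<and> (\<exists>b\<in>corner A g (- m) f. a \<otimes>\<^bsub>A\<^esub> b = f \<and> b \<otimes>\<^bsub>A\<^esub> a = g))"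

text \<open>\<open>\<delta>\<close> measures each idempotent against the representative of its class
  by a chosen isomorphism. Two isomorphisms of different degrees between the same idempotents would
  compose to a self-isomorphism of nonzero degree, so every isomorphism has degree
  \<open>\<delta> f - \<delta> g\<close>.\<close>

lemma (in fdalg) peirce_frame_exists: "\<exists>P \<rho> \<delta>. peirce_frame A P \<rho> \<delta>"
proof -
  have "idem0 A \<one>" by (simp add: idem0_def grade_one)
  from primitive_decomposition[OF this] obtain P where P: "finite P"
    "\<And>p. p \<in> P \<Longrightarrow> primitive A p"
    "\<And>p q. \<lbrakk>p \<in> P; q \<in> P; p \<noteq> q\<rbrakk> \<Longrightarrow> p \<otimes> q = \<zero>" "(\<Oplus>p\<in>P. p) = \<one>"
    by blast
  have id: "\<And>p. p \<in> P \<Longrightarrow> idem0 A p" and nz: "\<And>p. p \<in> P \<Longrightarrow> p \<noteq> \<zero>"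
    using P(2) by (auto simp: primitive_def)
  then have car: "\<And>p. p \<in> P \<Longrightarrow> p \<in> carrier A" by (simp add: idem0_carrier)
  define eqv where "eqv f g \<longleftrightarrow> (\<exists>m. idem_iso A m f g)" for f g
  define \<rho> where "\<rho> f = (SOME g. g \<in> P \<and> eqv f g)" for f
  define \<delta> where "\<delta> f = (SOME m. idem_iso A m f (\<rho> f))" for f
  have \<rho>: "\<rho> f \<in> P \<and> eqv f (\<rho> f)" if "f \<in> P" for f
    unfolding \<rho>_def by (rule someI[of _ f]) (use that id idem_iso_refl in \<open>auto simp: eqv_def\<close>)
  have \<delta>: "idem_iso A (\<delta> f) f (\<rho> f)" if "f \<in> P" for f
    unfolding \<delta>_def by (rule someI_ex) (use \<rho>[OF that] in \<open>simp add: eqv_def\<close>)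
  have \<rho>eq: "\<rho> f = \<rho> g" if fg: "f \<in> P" "g \<in> P" "idem_iso A m f g" for f g m
  proof -
    \<comment> \<open>Equivalent idempotents satisfy the same predicate, so the choice operator
      returns the same representative for both.\<close>
    have "eqv f h \<longleftrightarrow> eqv g h" if "h \<in> P" for h
      unfolding eqv_def using fg that car idem_iso_trans idem_iso_sym by meson
    then have "(\<lambda>h. h \<in> P \<and> eqv f h) = (\<lambda>h. h \<in> P \<and> eqv g h)" by auto
    then show ?thesis by (simp add: \<rho>_def)
  qed
  have iso: "idem_iso A (\<delta> f - \<delta> g) f g" if fg: "f \<in> P" "g \<in> P" "\<rho> f = \<rho> g" for f g
    using idem_iso_trans[OF \<delta>[OF fg(1)] _ car car car, of "- \<delta> g" g] idem_iso_sym[OF \<delta>[OF fg(2)]] fg \<rho>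
    by auto
  have deg: "m = \<delta> f - \<delta> g" if fg: "f \<in> P" "g \<in> P" "idem_iso A m f g" for f g m
  proof -
    have "\<rho> g = \<rho> f" using \<rho>eq[OF fg] by simp
    then have "idem_iso A (m + (\<delta> g - \<delta> f)) f f"
      using idem_iso_trans[OF fg(3) iso[of g f]] fg car by simp
    then have "m + (\<delta> g - \<delta> f) = 0" using idem_iso_self fg id nz by blast
    then show ?thesis by simp
  qed
  have "peirce_frame A P \<rho> \<delta>"
    unfolding peirce_frame_def
  proof (intro conjI ballI allI impI)
    show "P \<subseteq> grade A 0" using id by (auto simp: idem0_def)
    show "\<zero> \<notin> P" using nz by auto
    show "p \<otimes> q = (if p = q then p else \<zero>)" if "p \<in> P" "q \<in> P" for p q
      using that P(3) id by (auto simp: idem0_def)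
    show "idem_iso A (\<delta> f - \<delta> g) f g" if "f \<in> P" "g \<in> P" "\<rho> f = \<rho> g" for f g
      using iso that .
    fix f g m a assume fg: "f \<in> P" "g \<in> P" and a: "a \<in> corner A f m g" "a \<notin> J"
    then obtain b where b: "b \<in> corner A g (- m) f" "a \<otimes> b = f" "b \<otimes> a = g"
      using primitive_iso[of f g a m] P(2) by blast
    then show "\<exists>b\<in>corner A g (- m) f. a \<otimes> b = f \<and> b \<otimes> a = g" by blast
    have "idem_iso A m f g" using a b unfolding idem_iso_def by blast
    then show "\<rho> f = \<rho> g" "m = \<delta> f - \<delta> g" using \<rho>eq deg fg by blast+
  qed (use P in auto)
  then show ?thesis by blast
qed

section \<open>Twisting the differential\<close>

text \<open>
  The automorphism \<open>a \<mapsto> (-1)\<^bsup>|a|\<^esup> a\<close>. It extends the graded commutator with an element \<open>b\<close> of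
  degree \<open>1\<close> to inhomogeneous \<open>a\<close>, as \<open>b a - parity a b\<close>.
\<close>
definition parity :: "('k, 'a, 'n) galg_scheme \<Rightarrow> 'a \<Rightarrow> 'a" where
  "parity A a = (\<Oplus>\<^bsub>A\<^esub>n\<in>{n. hcomp A n a \<noteq> \<zero>\<^bsub>A\<^esub>}. signed A n (hcomp A n a))"

context galg begin

lemma signed_carrier [simp]: "x \<in> carrier A \<Longrightarrow> signed A n x \<in> carrier A"
  by (simp add: signed_def)

lemma signed_zero [simp]: "signed A n \<zero> = \<zero>"
  by (simp add: signed_def)

lemma signed_add: "\<lbrakk>x \<in> carrier A; y \<in> carrier A\<rbrakk> \<Longrightarrow> signed A n (x \<oplus> y) = signed A n x \<oplus> signed A n y"
  by (simp add: signed_def A.minus_add A.a_comm)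

lemma signed_mult_left: "\<lbrakk>x \<in> carrier A; y \<in> carrier A\<rbrakk> \<Longrightarrow> signed A n x \<otimes> y = signed A n (x \<otimes> y)"
  by (simp add: signed_def A.l_minus)

lemma signed_mult_right: "\<lbrakk>x \<in> carrier A; y \<in> carrier A\<rbrakk> \<Longrightarrow> x \<otimes> signed A n y = signed A n (x \<otimes> y)"
  by (simp add: signed_def A.r_minus)

lemma signed_smult: "\<lbrakk>c \<in> carrier K; x \<in> carrier A\<rbrakk> \<Longrightarrow> c \<odot> signed A n x = signed A n (c \<odot> x)"
  by (simp add: signed_def smult_r_minus)

lemma signed_signed: "x \<in> carrier A \<Longrightarrow> signed A n (signed A m x) = signed A (n + m) x"
  by (auto simp: signed_def)

lemma additive_on_signed: "additive_on A (signed A n)"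
  by (simp add: additive_on_def signed_add)

lemma additive_on_comp: "\<lbrakk>additive_on A f; additive_on A g\<rbrakk> \<Longrightarrow> additive_on A (\<lambda>x. f (g x))"
  by (auto simp: additive_on_def)

lemma parity_eq:
  assumes "finite T" "a \<in> carrier A" "\<And>n. n \<notin> T \<Longrightarrow> hcomp A n a = \<zero>"
  shows "parity A a = (\<Oplus>n\<in>T. signed A n (hcomp A n a))"
  unfolding parity_def
  by (rule A.add.finprod_mono_neutral_cong_left) (use assms in auto)

lemma parity_carrier [simp]: "a \<in> carrier A \<Longrightarrow> parity A a \<in> carrier A"
  unfolding parity_def by (rule A.finsum_closed) auto

lemma parity_homog: "a \<in> grade A n \<Longrightarrow> parity A a = signed A n a"
  using parity_eq[of "{n}" a] grade_carrier[of a n] by (simp add: hcomp_same A.finsum_insert)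

lemma parity_additive: "additive_on A (parity A)"
  unfolding additive_on_def
proof (intro conjI ballI)
  fix x y assume xy: "x \<in> carrier A" "y \<in> carrier A"
  let ?T = "{n. hcomp A n x \<noteq> \<zero>} \<union> {n. hcomp A n y \<noteq> \<zero>}"
  have T: "finite ?T" using xy hcomp_support by simp
  have "parity A (x \<oplus> y) = (\<Oplus>n\<in>?T. signed A n (hcomp A n (x \<oplus> y)))"
    by (rule parity_eq) (use T xy in auto)
  also have "\<dots> = (\<Oplus>n\<in>?T. signed A n (hcomp A n x) \<oplus> signed A n (hcomp A n y))"
    by (rule A.finsum_cong') (use xy in \<open>auto simp: signed_add\<close>)
  also have "\<dots> = (\<Oplus>n\<in>?T. signed A n (hcomp A n x)) \<oplus> (\<Oplus>n\<in>?T. signed A n (hcomp A n y))"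
    by (rule A.finsum_addf) (use xy in auto)
  also have "(\<Oplus>n\<in>?T. signed A n (hcomp A n x)) = parity A x"
    by (rule parity_eq[symmetric]) (use T xy in auto)
  also have "(\<Oplus>n\<in>?T. signed A n (hcomp A n y)) = parity A y"
    by (rule parity_eq[symmetric]) (use T xy in auto)
  finally show "parity A (x \<oplus> y) = parity A x \<oplus> parity A y" .
qed auto

lemma parity_smult:
  assumes c: "c \<in> carrier K" and a: "a \<in> carrier A"
  shows "parity A (c \<odot> a) = c \<odot> parity A a"
proof (rule additive_eq[OF _ _ _ a])
  show "additive_on A (\<lambda>x. parity A (c \<odot> x))" "additive_on A (\<lambda>x. c \<odot> parity A x)"
    using additive_on_comp[OF parity_additive additive_on_smult[OF c]]
      additive_on_comp[OF additive_on_smult[OF c] parity_additive] .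
  show "parity A (c \<odot> x) = c \<odot> parity A x" if "x \<in> grade A n" for n x
    using c that grade_carrier[OF that] by (simp add: parity_homog[of _ n] signed_smult)
qed

lemma parity_mult:
  assumes a: "a \<in> grade A n" and c: "c \<in> carrier A"
  shows "parity A (a \<otimes> c) = signed A n (a \<otimes> parity A c)"
proof (rule additive_eq[OF _ _ _ c])
  have ac: "a \<in> carrier A" using a by (rule grade_carrier)
  show "additive_on A (\<lambda>x. parity A (a \<otimes> x))" "additive_on A (\<lambda>x. signed A n (a \<otimes> parity A x))"
    using additive_on_comp[OF parity_additive additive_on_mult(1)[OF ac]]
      additive_on_comp[OF additive_on_signed additive_on_comp[OF additive_on_mult(1)[OF ac] parity_additive]] .
  show "parity A (a \<otimes> x) = signed A n (a \<otimes> parity A x)" if x: "x \<in> grade A m" for m x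
    using ac grade_carrier[OF x]
    by (simp add: parity_homog[OF x] parity_homog[OF grade_mult[OF a x]] signed_mult_right signed_signed)
qed

text \<open>The radical is graded, so it allows sign changes in individual components. With this,
  \<open>[b, x]\<close> stays in the radical also for inhomogeneous \<open>x\<close>.\<close>

lemma radical_parity: "x \<in> J \<Longrightarrow> parity A x \<in> J"
proof -
  assume x: "x \<in> J"
  have "(\<Oplus>n\<in>T. signed A n (hcomp A n x)) \<in> J" for T
  proof (induction T rule: infinite_finite_induct)
    case (insert n T)
    have "(\<Oplus>n\<in>insert n T. signed A n (hcomp A n x)) =
        signed A n (hcomp A n x) \<oplus> (\<Oplus>n\<in>T. signed A n (hcomp A n x))"
      using insert x by (intro A.finsum_insert) auto
    then show ?case using insert radical_closed(3) radical_signed radical_closed(4)[OF x] by simp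
  qed (auto simp: radical_closed(2))
  then show ?thesis by (simp add: parity_def)
qed

end

section \<open>Curved algebras and their twists\<close>

locale curved = curved_algebra K A
  for K :: "('k, 'm) ring_scheme" and A :: "('k, 'a) calg" (structure)

sublocale curved \<subseteq> galg K A ..

text \<open>The sign is dictated by the convention for morphisms: \<open>(id, b)\<close> goes from
  \<open>A\<close> to the algebra with differential \<open>d'\<close> when
  \<open>d a = d' a + [b, a]\<close>.\<close>

definition twist :: "('k, 'a) calg \<Rightarrow> 'a \<Rightarrow> 'a \<Rightarrow> 'a" where
  "twist A b a = diff A a \<ominus>\<^bsub>A\<^esub> (b \<otimes>\<^bsub>A\<^esub> a \<ominus>\<^bsub>A\<^esub> parity A a \<otimes>\<^bsub>A\<^esub> b)"

text \<open>Solves \<open>h = h' + d' b + b b\<close> for \<open>h'\<close>, where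
  \<open>d' b = d b - [b, b] = d b - 2 b b\<close>.\<close>

definition twisted_curv :: "('k, 'a) calg \<Rightarrow> 'a \<Rightarrow> 'a" where
  "twisted_curv A b = (curv A \<ominus>\<^bsub>A\<^esub> diff A b) \<oplus>\<^bsub>A\<^esub> b \<otimes>\<^bsub>A\<^esub> b"

context curved begin

lemma diff_additive: "additive_on A (diff A)"
  using diff_linear by (rule k_linear_additive)

lemmas diff_hom = additive_onD[OF diff_additive]

lemma diff_smult: "\<lbrakk>c \<in> carrier K; x \<in> carrier A\<rbrakk> \<Longrightarrow> diff A (c \<odot> x) = c \<odot> diff A x"
  using diff_linear by (simp add: k_linear_def)

lemma gcomm_1:
  assumes "a \<in> grade A n" "b \<in> carrier A"
  shows "gcomm A 1 n b a = b \<otimes> a \<ominus> parity A a \<otimes> b"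
  using assms grade_carrier[OF assms(1)] by (simp add: gcomm_def parity_homog signed_mult_left)

lemma twist_homog:
  "\<lbrakk>a \<in> grade A n; b \<in> carrier A\<rbrakk> \<Longrightarrow> twist A b a = diff A a \<ominus> gcomm A 1 n b a"
  by (simp add: twist_def gcomm_1)

lemma twist_linear:
  assumes b: "b \<in> carrier A" shows "k_linear K A A (twist A b)"
  unfolding k_linear_def
proof (intro conjI ballI)
  show "twist A b \<in> carrier A \<rightarrow> carrier A" using b by (auto simp: twist_def diff_hom)
  show "twist A b (x \<oplus> y) = twist A b x \<oplus> twist A b y" if "x \<in> carrier A" "y \<in> carrier A" for x y
  proof -
    have "twist A b (x \<oplus> y) = (diff A x \<oplus> diff A y) \<ominus> ((b \<otimes> x \<oplus> b \<otimes> y) \<ominus> (parity A x \<otimes> b \<oplus> parity A y \<otimes> b))"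
      using that b by (simp add: twist_def diff_hom additive_onD(2)[OF parity_additive] A.r_distr A.l_distr)
    then show ?thesis using that b by (simp add: minus_add_minus twist_def diff_hom)
  qed
  show "twist A b (c \<odot> x) = c \<odot> twist A b x" if "c \<in> carrier K" "x \<in> carrier A" for c x
    using that b
    by (simp add: twist_def diff_smult smult_minus parity_smult smult_mult_left smult_mult_right diff_hom)
qed

lemma twist_degree:
  assumes "b \<in> grade A 1" "a \<in> grade A n"
  shows "twist A b a \<in> grade A (n + 1)"
proof -
  have "b \<otimes> a \<in> grade A (n + 1)" using grade_mult[OF assms] by (simp add: add.commute)
  moreover have "parity A a \<otimes> b \<in> grade A (n + 1)"
    using assms by (simp add: parity_homog grade_mult)
  ultimately show ?thesis using diff_degree[OF assms(2)] by (simp add: twist_def)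
qed

text \<open>The map \<open>a \<mapsto> b a - parity a b\<close> obeys the signed Leibniz rule
  because \<open>parity\<close> is multiplicative. Only the parity of \<open>n\<close> enters, and
  each case is an identity in a ring with \<open>x\<close> and \<open>y\<close> as free
  letters.\<close>

lemma twist_mult:
  assumes b: "b \<in> carrier A" and a: "a \<in> grade A n" and c: "c \<in> carrier A"
  shows "twist A b (a \<otimes> c) = twist A b a \<otimes> c \<oplus> signed A n (a \<otimes> twist A b c)"
proof -
  have ac: "a \<in> carrier A" using a by (rule grade_carrier)
  define s where "s = parity A c"
  define x where "x = diff A a"
  define y where "y = diff A c"
  have car: "s \<in> carrier A" "x \<in> carrier A" "y \<in> carrier A" using ac c by (simp_all add: s_def x_def y_def diff_hom)
  have D: "twist A b (a \<otimes> c) = (x \<otimes> c \<oplus> signed A n (a \<otimes> y)) \<ominus> (b \<otimes> (a \<otimes> c) \<ominus> signed A n (a \<otimes> s) \<otimes> b)"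
    by (simp add: twist_def x_def y_def s_def diff_mult[OF a c] parity_mult[OF a c])
  have Da: "twist A b a = x \<ominus> (b \<otimes> a \<ominus> signed A n a \<otimes> b)"
    by (simp add: twist_def x_def parity_homog[OF a])
  have Dc: "twist A b c = y \<ominus> (b \<otimes> c \<ominus> s \<otimes> b)"
    by (simp add: twist_def y_def s_def)
  show ?thesis
  proof (cases "even n")
    case True
    show ?thesis unfolding D Da Dc using True ac b c car by (simp add: signed_def) algebra
  next
    case False
    show ?thesis unfolding D Da Dc using False ac b c car by (simp add: signed_def) algebra
  qed
qed

text \<open>The curved identity for the twisted data. It combines
  \<open>d [b, a] = [d b, a] - [b, d a]\<close> with \<open>[b, [b, a]] = [b b, a]\<close>, both
  valid because \<open>b\<close> is odd.\<close>

lemma twist_twist: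
  assumes b: "b \<in> grade A 1" and a: "a \<in> grade A n"
  shows "twist A b (twist A b a) = twisted_curv A b \<otimes> a \<ominus> a \<otimes> twisted_curv A b"
proof -
  have bc: "b \<in> carrier A" and ac: "a \<in> carrier A" and hc: "curv A \<in> carrier A"
    using a b curv_degree grade_carrier by blast+
  define x where "x = diff A a"
  define y where "y = diff A b"
  define h where "h = curv A"
  have car: "h \<in> carrier A" "x \<in> carrier A" "y \<in> carrier A"
    using ac bc hc by (simp_all add: h_def x_def y_def diff_hom)
  have dx: "diff A x = h \<otimes> a \<ominus> a \<otimes> h"
    using diff_diff[OF a] by (simp add: x_def h_def gcomm_def signed_def)
  have dba: "diff A (b \<otimes> a) = y \<otimes> a \<ominus> b \<otimes> x"
    using diff_mult[OF b ac] by (simp add: x_def y_def signed_def a_minus_def)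
  have dab: "diff A (a \<otimes> b) = x \<otimes> b \<oplus> signed A n (a \<otimes> y)"
    using diff_mult[OF a bc] by (simp add: x_def y_def)
  have Da: "twist A b a = x \<ominus> (b \<otimes> a \<ominus> signed A n (a \<otimes> b))"
    using ac bc by (simp add: twist_def x_def parity_homog[OF a] signed_mult_left)
  define z where "z = twist A b a"
  have z: "z \<in> grade A (n + 1)" using twist_degree[OF b a] by (simp add: z_def)
  have Dz: "twist A b z = diff A z \<ominus> (b \<otimes> z \<ominus> signed A (n + 1) (z \<otimes> b))"
    using grade_carrier[OF z] bc by (simp add: twist_def parity_homog[OF z] signed_mult_left)
  have dz: "diff A z = diff A x \<ominus> (diff A (b \<otimes> a) \<ominus> signed A n (diff A (a \<otimes> b)))"
    unfolding z_def Da using car ac bc by (simp add: diff_hom signed_def)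
  show ?thesis
  proof (cases "even n")
    case True
    then have zz: "z = x \<ominus> (b \<otimes> a \<ominus> a \<otimes> b)" by (simp add: z_def Da signed_def)
    show ?thesis unfolding z_def[symmetric] Dz dz dx dba dab unfolding zz twisted_curv_def h_def[symmetric] y_def[symmetric]
      using True car ac bc by (simp add: signed_def) algebra
  next
    case False
    then have zz: "z = x \<oplus> \<ominus> (b \<otimes> a \<oplus> a \<otimes> b)" using ac bc by (simp add: z_def Da signed_def a_minus_def)
    show ?thesis unfolding z_def[symmetric] Dz dz dx dba dab unfolding zz twisted_curv_def h_def[symmetric] y_def[symmetric]
      using False car ac bc by (simp add: signed_def) algebra
  qed
qed

text \<open>Orthogonality gives \<open>b f = d(f) f\<close>. On the other side,
  \<open>f d(p) p\<close> is \<open>- d(f) p\<close> for \<open>p \<noteq> f\<close> and zero for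
  \<open>p = f\<close>; as the \<open>p\<close> add up to \<open>\<one>\<close>, this yields
  \<open>f b = d(f) f - d(f)\<close>. The difference of the two is \<open>d f\<close>.\<close>

lemma twist_kills:
  assumes P: "finite P" "P \<subseteq> grade A 0" "\<And>p q. \<lbrakk>p \<in> P; q \<in> P\<rbrakk> \<Longrightarrow> p \<otimes> q = (if p = q then p else \<zero>)"
    and sum: "(\<Oplus>p\<in>P. p) = \<one>" and f: "f \<in> P"
    and b: "b = (\<Oplus>p\<in>P. diff A p \<otimes> p)"
  shows "twist A b f = \<zero>"
proof -
  have car: "p \<in> carrier A" if "p \<in> P" for p using that P(2) grade_carrier by blast
  have fc: "f \<in> carrier A" using car f .
  have f0: "f \<in> grade A 0" using P f by auto
  have dcar: "diff A p \<in> carrier A" if "p \<in> P" for p using car[OF that] diff_hom by simp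
  have bc: "b \<in> carrier A" unfolding b using car dcar by (intro A.finsum_closed) auto
  have "b \<otimes> f = (\<Oplus>p\<in>P. (diff A p \<otimes> p) \<otimes> f)"
    unfolding b by (rule additive_on_finsum[OF additive_on_mult(2)[OF fc]]) (use car dcar in auto)
  also have "\<dots> = (\<Oplus>p\<in>P. if f = p then diff A p else \<zero>) \<otimes> f"
  proof -
    have "(\<Oplus>p\<in>P. if f = p then diff A p else \<zero>) \<otimes> f = (\<Oplus>p\<in>P. (if f = p then diff A p else \<zero>) \<otimes> f)"
      by (rule additive_on_finsum[OF additive_on_mult(2)[OF fc]]) (use car dcar in auto)
    also have "\<dots> = (\<Oplus>p\<in>P. (diff A p \<otimes> p) \<otimes> f)"
      by (rule A.finsum_cong') (use car dcar fc f P(3) in \<open>auto simp: A.m_assoc\<close>)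
    finally show ?thesis by simp
  qed
  also have "(\<Oplus>p\<in>P. if f = p then diff A p else \<zero>) = diff A f"
    by (rule A.add.finprod_singleton) (use f P dcar in auto)
  finally have bf: "b \<otimes> f = diff A f \<otimes> f" .
  \<comment> \<open>The Leibniz rule for \<open>f p\<close>, multiplied by \<open>p\<close> on the
    right; the left side is known because \<open>f p\<close> is \<open>f\<close> or zero.\<close>
  have fb: "f \<otimes> (diff A p \<otimes> p) = (if f = p then diff A p \<otimes> p else \<zero>) \<ominus> diff A f \<otimes> p" if p: "p \<in> P" for p
  proof -
    have "diff A (f \<otimes> p) = diff A f \<otimes> p \<oplus> f \<otimes> diff A p"
      using diff_mult[OF f0 car[OF p]] by (simp add: signed_def)
    moreover have "diff A (f \<otimes> p) \<otimes> p = (if f = p then diff A p \<otimes> p else \<zero>)"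
      using P(3)[OF f p] diff_hom(3) car[OF p] by simp
    ultimately have "(diff A f \<otimes> p \<oplus> f \<otimes> diff A p) \<otimes> p = (if f = p then diff A p \<otimes> p else \<zero>)" by metis
    moreover have "(diff A f \<otimes> p \<oplus> f \<otimes> diff A p) \<otimes> p = diff A f \<otimes> p \<oplus> f \<otimes> (diff A p \<otimes> p)"
      using car p dcar f fc P(3)[OF p p] by (simp add: A.l_distr A.m_assoc)
    ultimately have e: "(if f = p then diff A p \<otimes> p else \<zero>) = diff A f \<otimes> p \<oplus> f \<otimes> (diff A p \<otimes> p)" by simp
    show ?thesis unfolding e using car p dcar f fc add_minus_cancel(1)[of "diff A f \<otimes> p" "f \<otimes> (diff A p \<otimes> p)"] by simp
  qed
  have "f \<otimes> b = (\<Oplus>p\<in>P. f \<otimes> (diff A p \<otimes> p))"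
    unfolding b by (rule additive_on_finsum[OF additive_on_mult(1)[OF fc]]) (use car dcar in auto)
  also have "\<dots> = (\<Oplus>p\<in>P. (if f = p then diff A p \<otimes> p else \<zero>) \<oplus> diff A f \<otimes> (\<ominus> p))"
    by (rule A.finsum_cong') (use fb car dcar f in \<open>auto simp: a_minus_def A.r_minus\<close>)
  also have "\<dots> = (\<Oplus>p\<in>P. if f = p then diff A p \<otimes> p else \<zero>) \<oplus> (\<Oplus>p\<in>P. diff A f \<otimes> (\<ominus> p))"
    by (rule A.finsum_addf) (use car dcar f in auto)
  also have "(\<Oplus>p\<in>P. if f = p then diff A p \<otimes> p else \<zero>) = diff A f \<otimes> f"
    using A.add.finprod_singleton[of f P "\<lambda>p. diff A p \<otimes> p"] f P car dcar by auto
  also have "(\<Oplus>p\<in>P. diff A f \<otimes> (\<ominus> p)) = diff A f \<otimes> (\<ominus> (\<Oplus>p\<in>P. p))"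
  proof -
    have "additive_on A (\<lambda>x. diff A f \<otimes> (\<ominus> x))"
      using dcar[OF f] by (auto simp: additive_on_def A.minus_add A.r_distr A.r_minus A.a_comm)
    from additive_on_finsum[OF this, of P "\<lambda>p. p"] car show ?thesis by simp
  qed
  also have "\<dots> = \<ominus> diff A f" unfolding sum using dcar[OF f] by (simp add: A.r_minus)
  finally have fb': "f \<otimes> b = diff A f \<otimes> f \<ominus> diff A f" by (simp add: a_minus_def)
  have "twist A b f = diff A f \<ominus> (b \<otimes> f \<ominus> f \<otimes> b)"
    by (simp add: twist_def parity_homog[OF f0] signed_def)
  then show ?thesis unfolding bf fb' using dcar[OF f] fc
    by (simp add: add_minus_cancel(4))
qed

end

section \<open>Peirce decomposition\<close>

text \<open>The operations stay those of \<open>A\<close>, only the unit becomes the idempotent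
  \<open>e\<close>. The curvature is set to zero because this is applied after a twist that removes
  it.\<close>

definition subalg :: "('k, 'a) calg \<Rightarrow> 'a set \<Rightarrow> 'a \<Rightarrow> ('a \<Rightarrow> 'a) \<Rightarrow> ('k, 'a) calg" where
  "subalg A C e D = A\<lparr>carrier := C, one := e, grade := (\<lambda>n. grade A n \<inter> C), diff := D, curv := \<zero>\<^bsub>A\<^esub>\<rparr>"

lemma subalg_simps [simp]:
  "carrier (subalg A C e D) = C" "monoid.one (subalg A C e D) = e" "monoid.mult (subalg A C e D) = monoid.mult A"
  "ring.add (subalg A C e D) = ring.add A" "ring.zero (subalg A C e D) = ring.zero A"
  "module.smult (subalg A C e D) = module.smult A"
  "grade (subalg A C e D) n = grade A n \<inter> C" "diff (subalg A C e D) = D" "curv (subalg A C e D) = \<zero>\<^bsub>A\<^esub>"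
  by (simp_all add: subalg_def)

text \<open>Serves the blocks cut out by central idempotents as well as the cycles inside them.
  \<open>D\<close> is a derivation of all of \<open>A\<close>, while
  \<open>D (D x) = \<zero>\<close> is demanded on \<open>C\<close> alone.\<close>

locale graded_corner = galg K A
  for K :: "('k, 'm) ring_scheme" and A :: "('k, 'a) calg" (structure) +
  fixes C :: "'a set" and e :: 'a and D :: "'a \<Rightarrow> 'a"
  assumes sub: "submodule C K A"
    and hom: "x \<in> C \<Longrightarrow> hcomp A n x \<in> C"
    and unit: "e \<in> C" "e \<in> grade A 0" "x \<in> C \<Longrightarrow> e \<otimes> x = x" "x \<in> C \<Longrightarrow> x \<otimes> e = x"
    and mult: "\<lbrakk>x \<in> C; y \<in> C\<rbrakk> \<Longrightarrow> x \<otimes> y \<in> C"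
    and D_add: "additive_on A D"
    and D_smult: "\<lbrakk>c \<in> carrier K; x \<in> carrier A\<rbrakk> \<Longrightarrow> D (c \<odot> x) = c \<odot> D x"
    and D_deg: "a \<in> grade A n \<Longrightarrow> D a \<in> grade A (n + 1)"
    and D_mult: "\<lbrakk>a \<in> grade A n; y \<in> carrier A\<rbrakk> \<Longrightarrow> D (a \<otimes> y) = D a \<otimes> y \<oplus> signed A n (a \<otimes> D y)"
    and D_C: "x \<in> C \<Longrightarrow> D x \<in> C"
    and D_D: "x \<in> C \<Longrightarrow> D (D x) = \<zero>"
begin

abbreviation S where "S \<equiv> subalg A C e D"

lemma C_carrier: "x \<in> C \<Longrightarrow> x \<in> carrier A"
  using submoduleE(1)[OF sub] by auto

lemmas C_closed = submodule_zero_mem[OF sub] submoduleE(3,4,5)[OF sub]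

lemma S_abelian: "abelian_group S"
proof (rule abelian_groupI)
  fix x assume "x \<in> carrier S"
  then show "\<exists>y\<in>carrier S. y \<oplus>\<^bsub>S\<^esub> x = \<zero>\<^bsub>S\<^esub>"
    using C_closed(2) C_carrier by (intro bexI[of _ "\<ominus> x"]) (auto simp: A.l_neg)
qed (auto simp: C_closed C_carrier A.a_ac)

lemma S_ring: "ring S"
proof (rule ringI)
  show "abelian_group S" by (rule S_abelian)
  show "monoid S"
    by (rule monoidI) (auto simp: mult unit C_carrier A.m_assoc)
qed (auto simp: C_carrier A.l_distr A.r_distr)

lemma S_module: "module K S"
  by (rule moduleI)
     (auto simp: K.is_cring S_abelian C_closed C_carrier smult_l_distr smult_r_distr smult_assoc1)

text \<open>Negation is a description over the carrier, so it has to be compared with that of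
  \<open>A\<close> although the addition is shared.\<close>

lemma S_neg: "x \<in> C \<Longrightarrow> \<ominus>\<^bsub>S\<^esub> x = \<ominus> x"
  using abelian_group.minus_equality[OF S_abelian, of "\<ominus> x" x] C_closed(2) C_carrier by (auto simp: A.l_neg)

lemma S_signed: "x \<in> C \<Longrightarrow> signed S n x = signed A n x"
  by (simp add: signed_def S_neg)

lemma S_finsum: "f \<in> T \<rightarrow> C \<Longrightarrow> finsum S f T = finsum A f T"
proof (induction T rule: infinite_finite_induct)
  case (infinite T)
  then show ?case
    using abelian_monoid.finsum_infinite[OF abelian_group.axioms(1)[OF S_abelian], of T f]
    by (simp add: A.finsum_infinite)
next
  case empty
  then show ?case using abelian_monoid.finsum_empty[OF abelian_group.axioms(1)[OF S_abelian], of f] by simp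
next
  case (insert i T)
  then have f: "f i \<in> C" "f \<in> T \<rightarrow> C" by auto
  have "finsum S f (insert i T) = f i \<oplus>\<^bsub>S\<^esub> finsum S f T"
    by (rule abelian_monoid.finsum_insert[OF abelian_group.axioms(1)[OF S_abelian]]) (use insert f in auto)
  moreover have "finsum A f (insert i T) = f i \<oplus> finsum A f T"
    by (rule A.finsum_insert) (use insert f C_carrier in auto)
  ultimately show ?case using insert.IH[OF f(2)] by simp
qed

lemma S_decomp: "homog_decomp S a c \<longleftrightarrow> homog_decomp A a c \<and> (\<forall>n. c n \<in> C)"
  using S_finsum[of c] by (auto simp: homog_decomp_def)

lemma S_hcomp: "x \<in> C \<Longrightarrow> hcomp S n x = hcomp A n x"
proof -
  assume x: "x \<in> C"
  have "(\<lambda>c. homog_decomp S x c) = (\<lambda>c. homog_decomp A x c)"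
  proof
    fix c
    show "homog_decomp S x c = homog_decomp A x c"
      using hom[OF x] hcomp_unique[OF C_carrier[OF x]] S_decomp by metis
  qed
  then show ?thesis by (simp add: hcomp_def)
qed

lemma S_graded_algebra: "graded_algebra K S"
proof -
  interpret S: ring S by (rule S_ring)
  interpret SM: module K S by (rule S_module)
  show ?thesis
  proof (intro graded_algebra.intro graded_algebra_axioms.intro)
    show "field K" by (rule K.field_axioms)
    show "ring S" by (rule S_ring)
    show "module K S" by (rule S_module)
    show "submodule (grade S n) K S" for n
      by (rule SM.submoduleI) (auto simp: C_closed S_neg C_carrier)
    show "\<exists>!c. homog_decomp S a c" if "a \<in> carrier S" for a
    proof (rule ex1I)
      have a: "a \<in> C" using that by simp
      show "homog_decomp S a (\<lambda>n. hcomp A n a)"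
        using S_decomp hcomp_decomp[OF C_carrier[OF a]] hom[OF a] by blast
      show "c = (\<lambda>n. hcomp A n a)" if "homog_decomp S a c" for c
        using hcomp_unique[OF C_carrier[OF a]] that S_decomp by auto
    qed
  qed (auto simp: smult_mult_left smult_mult_right C_carrier mult unit grade_mult)
qed

lemma S_dg: "dg_algebra K S"
proof -
  interpret S: ring S by (rule S_ring)

  have "curved_algebra K S"
  proof (intro curved_algebra.intro curved_algebra_axioms.intro)
    show "graded_algebra K S" by (rule S_graded_algebra)
    show "k_linear K S S (diff S)"
      using D_C D_smult C_carrier additive_onD(2)[OF D_add] by (auto simp: k_linear_def)
    show "diff S a \<in> grade S (n + 1)" if "a \<in> grade S n" for a n
      using that D_deg D_C by auto
    show "diff S (a \<otimes>\<^bsub>S\<^esub> b) = diff S a \<otimes>\<^bsub>S\<^esub> b \<oplus>\<^bsub>S\<^esub> signed S n (a \<otimes>\<^bsub>S\<^esub> diff S b)"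
      if "a \<in> grade S n" "b \<in> carrier S" for a n b
      using that D_mult[of a n b] C_carrier D_C mult by (simp add: S_signed)
    show "curv S \<in> grade S 2" using C_closed by simp
    show "diff S (curv S) = \<zero>\<^bsub>S\<^esub>" using additive_onD(3)[OF D_add] by simp
    show "diff S (diff S a) = gcomm S 2 n (curv S) a" if "a \<in> grade S n" for a n
    proof -
      have a: "a \<in> C" using that by simp
      have "gcomm S 2 n (curv S) a = \<zero> \<ominus>\<^bsub>S\<^esub> signed S (2 * n) \<zero>"
        using C_carrier[OF a] by (simp add: gcomm_def)
      also have "\<dots> = \<zero>" using S_neg[OF C_closed(1)] S_signed[OF C_closed(1)]
        by (simp add: a_minus_def C_closed(1))
      finally show ?thesis using D_D[OF a] by simp
    qed
  qed
  then show ?thesis by (simp add: dg_algebra_def)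
qed

end

text \<open>The situation right after the twist. \<open>D\<close> is not yet assumed to square to
  zero: that the curvature vanishes is itself deduced from the degrees of the blocks, and
  \<open>peirce_dg\<close> adds the condition afterwards.\<close>

locale peirce_diff = galg K A
  for K :: "('k, 'm) ring_scheme" and A :: "('k, 'a) calg" (structure) +
  fixes P \<rho> \<delta> D
  assumes frame: "peirce_frame A P \<rho> \<delta>"
    and D_add: "additive_on A D"
    and D_deg: "a \<in> grade A n \<Longrightarrow> D a \<in> grade A (n + 1)"
    and D_mult: "\<lbrakk>a \<in> grade A n; y \<in> carrier A\<rbrakk> \<Longrightarrow> D (a \<otimes> y) = D a \<otimes> y \<oplus> signed A n (a \<otimes> D y)"
    and D_idem: "f \<in> P \<Longrightarrow> D f = \<zero>"
    and D_inj: "\<lbrakk>x \<in> J; D x \<in> J\<rbrakk> \<Longrightarrow> x = \<zero>"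
begin

lemmas D_hom = additive_onD[OF D_add]

lemma P_finite: "finite P" and P_grade: "f \<in> P \<Longrightarrow> f \<in> grade A 0" and P_nonzero: "f \<in> P \<Longrightarrow> f \<noteq> \<zero>"
  and P_mult: "\<lbrakk>f \<in> P; g \<in> P\<rbrakk> \<Longrightarrow> f \<otimes> g = (if f = g then f else \<zero>)"
  and P_sum: "(\<Oplus>f\<in>P. f) = \<one>"
  and P_iso: "\<lbrakk>f \<in> P; g \<in> P; \<rho> f = \<rho> g\<rbrakk> \<Longrightarrow> idem_iso A (\<delta> f - \<delta> g) f g"
  using frame by (auto simp: peirce_frame_def)

lemma P_inv:
  assumes "f \<in> P" "g \<in> P" "a \<in> corner A f m g" "a \<notin> J"
  obtains b where "\<rho> f = \<rho> g" "m = \<delta> f - \<delta> g" "b \<in> corner A g (- m) f" "a \<otimes> b = f" "b \<otimes> a = g"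
  using frame assms unfolding peirce_frame_def by blast

lemma P_carrier: "f \<in> P \<Longrightarrow> f \<in> carrier A"
  using P_grade grade_carrier by blast

lemma D_left:
  assumes f: "f \<in> P" and x: "x \<in> carrier A" shows "D (f \<otimes> x) = f \<otimes> D x"
  using D_mult[OF P_grade[OF f] x] D_idem[OF f] P_carrier[OF f] x D_hom(1)[OF x] by (simp add: signed_def)

lemma D_right:
  assumes f: "f \<in> P" and x: "x \<in> carrier A" shows "D (x \<otimes> f) = D x \<otimes> f"
proof (rule additive_eq[OF _ _ _ x])
  show "additive_on A (\<lambda>x. D (x \<otimes> f))" "additive_on A (\<lambda>x. D x \<otimes> f)"
    using additive_on_comp D_add additive_on_mult(2)[OF P_carrier[OF f]] by blast+
  show "D (x \<otimes> f) = D x \<otimes> f" if "x \<in> grade A n" for n x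
    using D_mult[OF that P_carrier[OF f]] D_idem[OF f] P_carrier[OF f] grade_carrier[OF that] D_hom(1)
    by simp
qed

lemma corner_P: "\<lbrakk>f \<in> P; g \<in> P; x \<in> grade A m\<rbrakk> \<Longrightarrow> f \<otimes> x \<otimes> g \<in> corner A f m g"
proof -
  assume fg: "f \<in> P" "g \<in> P" and x: "x \<in> grade A m"
  note c = P_carrier[OF fg(1)] P_carrier[OF fg(2)] grade_carrier[OF x]
  have "f \<otimes> (f \<otimes> x \<otimes> g) = (f \<otimes> f) \<otimes> x \<otimes> g" using c by (simp add: A.m_assoc)
  then have 1: "f \<otimes> (f \<otimes> x \<otimes> g) = f \<otimes> x \<otimes> g" using P_mult[OF fg(1) fg(1)] by simp
  have "f \<otimes> x \<otimes> g \<otimes> g = f \<otimes> x \<otimes> (g \<otimes> g)" using c by (simp add: A.m_assoc)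
  then have 2: "f \<otimes> x \<otimes> g \<otimes> g = f \<otimes> x \<otimes> g" using P_mult[OF fg(2) fg(2)] by simp
  show ?thesis using 1 2 x P_grade fg by (simp add: corner_def)
qed

lemma D_corner:
  assumes "f \<in> P" "g \<in> P" "x \<in> corner A f m g" shows "D x \<in> corner A f (m + 1) g"
proof -
  have x: "x \<in> grade A m" "f \<otimes> x = x" "x \<otimes> g = x" using assms(3) by (auto simp: corner_def)
  note xc = grade_carrier[OF x(1)]
  show ?thesis using D_left[OF assms(1) xc] D_right[OF assms(2) xc] D_deg[OF x(1)] x by (simp add: corner_def)
qed

text \<open>By \<open>D_inj\<close> one of \<open>x\<close> and \<open>D x\<close> lies outside
  \<open>J\<close>. That one is invertible between \<open>f\<close> and \<open>g\<close>, so its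
  degree, \<open>m\<close> or \<open>m + 1\<close>, equals
  \<open>\<delta> f - \<delta> g\<close>.\<close>

lemma corner_cases:
  assumes fg: "f \<in> P" "g \<in> P" and x: "x \<in> corner A f m g" "x \<noteq> \<zero>"
  shows "\<rho> f = \<rho> g \<and> (m = \<delta> f - \<delta> g \<and> x \<notin> J \<or> m = \<delta> f - \<delta> g - 1 \<and> x \<in> J)"
proof (cases "x \<in> J")
  case True
  then have "D x \<notin> J" using D_inj x(2) by blast
  from P_inv[OF fg D_corner[OF fg x(1)] this] have "\<rho> f = \<rho> g" "m + 1 = \<delta> f - \<delta> g" by auto
  then show ?thesis using True by auto
next
  case False
  from P_inv[OF fg x(1) this] show ?thesis using False by auto
qed

lemma P_expand:
  assumes x: "x \<in> carrier A"
  shows "x = (\<Oplus>f\<in>P. f \<otimes> x)" "x = (\<Oplus>f\<in>P. x \<otimes> f)"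
  using additive_on_finsum[OF additive_on_mult(2)[OF x], of P "\<lambda>f. f"]
    additive_on_finsum[OF additive_on_mult(1)[OF x], of P "\<lambda>f. f"] P_carrier P_sum x by simp_all

lemma zero_if_blocks:
  assumes x: "x \<in> carrier A" and z: "\<And>f g. \<lbrakk>f \<in> P; g \<in> P\<rbrakk> \<Longrightarrow> f \<otimes> x \<otimes> g = \<zero>"
  shows "x = \<zero>"
proof -
  have "f \<otimes> x = \<zero>" if f: "f \<in> P" for f
  proof -
    have "f \<otimes> x = (\<Oplus>g\<in>P. f \<otimes> x \<otimes> g)" using P_expand(2)[of "f \<otimes> x"] P_carrier[OF f] x by simp
    also have "\<dots> = (\<Oplus>g\<in>P. \<zero>)" by (rule A.finsum_cong') (use z f in auto)
    finally show ?thesis by simp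
  qed
  then have "(\<Oplus>f\<in>P. f \<otimes> x) = (\<Oplus>f\<in>P. \<zero>)" by (intro A.finsum_cong') auto
  then show ?thesis using P_expand(1)[OF x] by simp
qed

lemma eq_if_blocks:
  assumes x: "x \<in> carrier A" "y \<in> carrier A"
    and z: "\<And>f g. \<lbrakk>f \<in> P; g \<in> P\<rbrakk> \<Longrightarrow> f \<otimes> x \<otimes> g = f \<otimes> y \<otimes> g"
  shows "x = y"
proof -
  have "x \<ominus> y = \<zero>"
  proof (rule zero_if_blocks)
    show "f \<otimes> (x \<ominus> y) \<otimes> g = \<zero>" if "f \<in> P" "g \<in> P" for f g
    proof -
      have "f \<otimes> (x \<ominus> y) \<otimes> g = f \<otimes> x \<otimes> g \<ominus> f \<otimes> y \<otimes> g"
        using that[THEN P_carrier] x by (simp add: minus_distrib)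
      then show ?thesis using z[OF that] that[THEN P_carrier] x by (simp add: a_minus_def A.r_neg)
    qed
  qed (use x in auto)
  then show ?thesis using x by (simp add: A.r_right_minus_eq)
qed

lemma block_zero:
  assumes "f \<in> P" "g \<in> P" "\<rho> f \<noteq> \<rho> g" "x \<in> carrier A"
  shows "f \<otimes> x \<otimes> g = \<zero>"
  using assms(4)
proof (induction rule: homog_induct)
  case (homog n x)
  then show ?case using corner_cases[OF assms(1,2) corner_P[OF assms(1,2) homog]] assms(3) by blast
next
  case (add x y)
  then show ?case using assms(1,2)[THEN P_carrier] by (simp add: A.r_distr A.l_distr)
qed

text \<open>Off the diagonal \<open>f h g = h f g = 0\<close>; on the diagonal the blocks
  \<open>f A f\<close> live in degrees \<open>0\<close> and \<open>- 1\<close>.\<close>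

lemma central_degree_2:
  assumes h: "h \<in> grade A 2" and c: "\<And>f. f \<in> P \<Longrightarrow> h \<otimes> f = f \<otimes> h"
  shows "h = \<zero>"
proof (rule zero_if_blocks)
  show "h \<in> carrier A" using h by (rule grade_carrier)
  note hc = this
  fix f g assume fg: "f \<in> P" "g \<in> P"
  show "f \<otimes> h \<otimes> g = \<zero>"
  proof (cases "f = g")
    case True
    then show ?thesis using corner_cases[OF fg corner_P[OF fg h]] by auto
  next
    case False
    have "f \<otimes> h \<otimes> g = h \<otimes> (f \<otimes> g)"
      unfolding c[OF fg(1), symmetric] by (rule A.m_assoc) (use hc fg[THEN P_carrier] in auto)
    then show ?thesis using P_mult[OF fg] False hc by simp
  qed
qed

section \<open>Central idempotents of the isomorphism classes\<close>

definition e where "e c = (\<Oplus>f\<in>{f \<in> P. \<rho> f = c}. f)"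

lemma e_grade: "e c \<in> grade A 0"
  unfolding e_def by (rule grade_finsum) (auto simp: P_grade)

lemma e_carrier [simp]: "e c \<in> carrier A"
  using e_grade by (rule grade_carrier)

lemma e_P:
  assumes g: "g \<in> P"
  shows "e c \<otimes> g = (if \<rho> g = c then g else \<zero>)" "g \<otimes> e c = (if \<rho> g = c then g else \<zero>)"
proof -
  let ?Q = "{f \<in> P. \<rho> f = c}"
  have s: "(\<Oplus>f\<in>?Q. if g = f then f else \<zero>) = (if \<rho> g = c then g else \<zero>)"
  proof (cases "\<rho> g = c")
    case True
    then show ?thesis
      using A.add.finprod_singleton[of g ?Q "\<lambda>f. f"] g P_carrier P_finite by auto
  next
    case False
    have "(\<Oplus>f\<in>?Q. if g = f then f else \<zero>) = (\<Oplus>f\<in>?Q. \<zero>)" by (rule A.finsum_cong') (use False in auto)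
    then show ?thesis using False by simp
  qed
  have "e c \<otimes> g = (\<Oplus>f\<in>?Q. f \<otimes> g)"
    unfolding e_def by (rule additive_on_finsum[OF additive_on_mult(2)[OF P_carrier[OF g]]]) (auto simp: P_carrier)
  also have "\<dots> = (\<Oplus>f\<in>?Q. if g = f then f else \<zero>)"
    by (rule A.finsum_cong') (use g P_mult P_carrier in auto)
  finally show "e c \<otimes> g = (if \<rho> g = c then g else \<zero>)" using s by simp
  have "g \<otimes> e c = (\<Oplus>f\<in>?Q. g \<otimes> f)"
    unfolding e_def by (rule additive_on_finsum[OF additive_on_mult(1)[OF P_carrier[OF g]]]) (auto simp: P_carrier)
  also have "\<dots> = (\<Oplus>f\<in>?Q. if g = f then f else \<zero>)"
    by (rule A.finsum_cong') (use g P_mult P_carrier in auto)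
  finally show "g \<otimes> e c = (if \<rho> g = c then g else \<zero>)" using s by simp
qed

text \<open>Only blocks \<open>f A g\<close> within one class are nonzero, and there
  \<open>e c\<close> acts from both sides as the identity or from both sides as zero.\<close>

lemma e_central: "x \<in> carrier A \<Longrightarrow> e c \<otimes> x = x \<otimes> e c"
proof (rule eq_if_blocks)
  fix f g assume x: "x \<in> carrier A" and fg: "f \<in> P" "g \<in> P"
  note car = fg[THEN P_carrier] x
  have "f \<otimes> (e c \<otimes> x) \<otimes> g = (f \<otimes> e c) \<otimes> x \<otimes> g" using car by (simp add: A.m_assoc)
  moreover have "f \<otimes> (x \<otimes> e c) \<otimes> g = f \<otimes> x \<otimes> (e c \<otimes> g)" using car by (simp add: A.m_assoc)
  ultimately show "f \<otimes> (e c \<otimes> x) \<otimes> g = f \<otimes> (x \<otimes> e c) \<otimes> g"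
    using block_zero[OF fg _ x] car by (auto simp: e_P[OF fg(1)] e_P[OF fg(2)])
qed auto

lemma e_mult: "e c \<otimes> e c' = (if c = c' then e c else \<zero>)"
proof -
  have "e c \<otimes> e c' = (\<Oplus>f\<in>{f \<in> P. \<rho> f = c}. f \<otimes> e c')"
    unfolding e_def[of c] by (rule additive_on_finsum[OF additive_on_mult(2)[OF e_carrier]]) (auto simp: P_carrier)
  also have "\<dots> = (\<Oplus>f\<in>{f \<in> P. \<rho> f = c}. if c = c' then f else \<zero>)"
    by (rule A.finsum_cong') (auto simp: e_P P_carrier)
  finally show ?thesis by (simp add: e_def)
qed

lemma e_sum: "(\<Oplus>c\<in>\<rho> ` P. e c) = \<one>"
proof (rule eq_if_blocks)
  fix f g assume fg: "f \<in> P" "g \<in> P"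
  have "f \<otimes> (\<Oplus>c\<in>\<rho> ` P. e c) = (\<Oplus>c\<in>\<rho> ` P. f \<otimes> e c)"
    by (rule additive_on_finsum[OF additive_on_mult(1)[OF P_carrier[OF fg(1)]]]) auto
  also have "\<dots> = (\<Oplus>c\<in>\<rho> ` P. if \<rho> f = c then f else \<zero>)"
    by (rule A.finsum_cong') (use fg P_carrier in \<open>auto simp: e_P\<close>)
  also have "\<dots> = f"
    using A.add.finprod_singleton[of "\<rho> f" "\<rho> ` P" "\<lambda>_. f"] fg P_carrier P_finite by auto
  finally show "f \<otimes> (\<Oplus>c\<in>\<rho> ` P. e c) \<otimes> g = f \<otimes> \<one> \<otimes> g" using P_carrier fg by simp
qed auto

lemma D_e: "D (e c) = \<zero>"
proof -
  have "D (e c) = (\<Oplus>f\<in>{f \<in> P. \<rho> f = c}. D f)"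
    unfolding e_def by (rule additive_on_finsum[OF D_add]) (auto simp: P_carrier)
  also have "\<dots> = (\<Oplus>f\<in>{f \<in> P. \<rho> f = c}. \<zero>)" by (rule A.finsum_cong') (auto simp: D_idem)
  finally show ?thesis by simp
qed

lemma D_e_mult: "x \<in> carrier A \<Longrightarrow> D (e c \<otimes> x) = e c \<otimes> D x"
  using D_mult[OF e_grade] D_e D_hom(1) by (simp add: signed_def)

end

section \<open>Blocks and cycles\<close>

locale peirce_dg = peirce_diff +
  assumes D_smult: "\<lbrakk>k \<in> carrier K; x \<in> carrier A\<rbrakk> \<Longrightarrow> D (k \<odot> x) = k \<odot> D x"
    and D_D: "x \<in> carrier A \<Longrightarrow> D (D x) = \<zero>"
begin

definition block where "block c = {x \<in> carrier A. e c \<otimes> x = x}"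

text \<open>The part complementary to the radical: it meets \<open>J\<close> only in zero by
  \<open>D_inj\<close>, and it contains all elements of degree
  \<open>\<delta> f - \<delta> g\<close> of \<open>f A g\<close> for \<open>f\<close>,
  \<open>g\<close> in the class \<open>c\<close>.\<close>

definition cycles where "cycles c = {x \<in> carrier A. e c \<otimes> x = x \<and> D x = \<zero>}"

lemma e_right: "\<lbrakk>x \<in> carrier A; e c \<otimes> x = x\<rbrakk> \<Longrightarrow> x \<otimes> e c = x"
  using e_central[of x c] by simp

lemma hcomp_block: "\<lbrakk>x \<in> carrier A; e c \<otimes> x = x\<rbrakk> \<Longrightarrow> e c \<otimes> hcomp A n x = hcomp A n x"
  using hcomp_mult_left[OF e_grade, of x n c] by simp

lemma D_hcomp: "x \<in> carrier A \<Longrightarrow> D (hcomp A n x) = hcomp A (n + 1) (D x)"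
  using hcomp_additive_shift[OF D_add, of 1 x n] D_deg by simp

lemma D_mult_cycle:
  assumes y: "y \<in> carrier A" "D y = \<zero>" and x: "x \<in> carrier A"
  shows "D (x \<otimes> y) = D x \<otimes> y"
proof (rule additive_eq[OF _ _ _ x])
  show "additive_on A (\<lambda>x. D (x \<otimes> y))" "additive_on A (\<lambda>x. D x \<otimes> y)"
    using additive_on_comp D_add additive_on_mult(2)[OF y(1)] by blast+
  show "D (x \<otimes> y) = D x \<otimes> y" if "x \<in> grade A n" for n x
    using D_mult[OF that y(1)] y grade_carrier[OF that] D_hom(1) by simp
qed

lemma D_parity:
  assumes x: "x \<in> carrier A" shows "D (parity A x) = \<ominus> parity A (D x)"
proof (rule additive_eq[OF _ _ _ x])
  have "additive_on A (\<lambda>x. \<ominus> x)" by (auto simp: additive_on_def A.minus_add A.a_comm)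
  then show "additive_on A (\<lambda>x. D (parity A x))" "additive_on A (\<lambda>x. \<ominus> parity A (D x))"
    using additive_on_comp D_add parity_additive by blast+
  show "D (parity A x) = \<ominus> parity A (D x)" if "x \<in> grade A n" for n x
    using parity_homog[OF that] parity_homog[OF D_deg[OF that]] grade_carrier[OF that] D_hom by (simp add: signed_def)
qed

text \<open>Inserting \<open>parity\<close> cancels the sign in the Leibniz rule, so that
  \<open>s\<close> may be inhomogeneous. For a cycle \<open>s\<close> it exhibits
  \<open>s \<otimes> D y\<close> as a value of \<open>D\<close>.\<close>

lemma D_parity_mult:
  assumes s: "s \<in> carrier A" and y: "y \<in> carrier A"
  shows "D (parity A s \<otimes> y) = D (parity A s) \<otimes> y \<oplus> s \<otimes> D y"
proof (rule additive_eq[OF _ _ _ s])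
  note yc = additive_on_mult(2)[OF y] additive_on_mult(2)[OF D_hom(1)[OF y]]
  show "additive_on A (\<lambda>s. D (parity A s \<otimes> y))"
    using additive_on_comp[OF D_add additive_on_comp[OF yc(1) parity_additive]] .
  have "additive_on A (\<lambda>s. D (parity A s) \<otimes> y)"
    using additive_on_comp[OF yc(1) additive_on_comp[OF D_add parity_additive]] .
  with yc(2) show "additive_on A (\<lambda>s. D (parity A s) \<otimes> y \<oplus> s \<otimes> D y)"
    by (auto simp: additive_on_def A.a_ac Pi_iff)
  show "D (parity A s \<otimes> y) = D (parity A s) \<otimes> y \<oplus> s \<otimes> D y" if s: "s \<in> grade A n" for n s
  proof -
    have "signed A n (signed A n s \<otimes> D y) = s \<otimes> D y"
      using grade_carrier[OF s] y D_hom(1) by (simp add: signed_mult_left signed_signed) (simp add: signed_def)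
    then show ?thesis using D_mult[OF grade_signed[OF s] y, of n] by (simp add: parity_homog[OF s])
  qed
qed

lemma block_corner: "graded_corner K A (block c) (e c) D"
proof (intro graded_corner.intro graded_corner_axioms.intro)
  show "submodule (block c) K A"
    by (rule submoduleI) (auto simp: block_def A.r_distr A.r_minus smult_mult_right)
  show "e c \<in> block c" using e_mult[of c c] by (simp add: block_def)
  show "x \<otimes> y \<in> block c" if "x \<in> block c" "y \<in> block c" for x y
    using that by (simp add: block_def flip: A.m_assoc)
qed (auto simp: block_def hcomp_block e_right e_grade galg_axioms D_add D_smult D_deg D_mult D_D D_hom(1) simp flip: D_e_mult)

lemma cycles_corner: "graded_corner K A (cycles c) (e c) D"
proof (intro graded_corner.intro graded_corner_axioms.intro)
  show "submodule (cycles c) K A"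
    by (rule submoduleI) (auto simp: cycles_def A.r_distr A.r_minus smult_mult_right D_hom D_smult)
  show "e c \<in> cycles c" using e_mult[of c c] D_e by (simp add: cycles_def)
  show "x \<otimes> y \<in> cycles c" if "x \<in> cycles c" "y \<in> cycles c" for x y
    using that by (simp add: cycles_def D_mult_cycle flip: A.m_assoc)
qed (auto simp: cycles_def hcomp_block e_right e_grade galg_axioms D_add D_smult D_deg D_mult D_D D_hom D_hcomp)

text \<open>\<open>D b\<close> would have degree one above the highest degree in which the block is
  nonzero.\<close>

lemma corner_cycle:
  assumes "f \<in> P" "g \<in> P" "b \<in> corner A f (\<delta> f - \<delta> g) g"
  shows "D b = \<zero>"
  using corner_cases[OF assms(1,2) D_corner[OF assms]] by auto

lemma corner_in_cycles:
  assumes "f \<in> P" "g \<in> P" "\<rho> f = c" "b \<in> corner A f (\<delta> f - \<delta> g) g"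
  shows "b \<in> cycles c"
proof -
  have b: "b \<in> carrier A" "f \<otimes> b = b" using assms(4) corner_carrier[OF assms(4)] by (auto simp: corner_def)
  have "e c \<otimes> b = (e c \<otimes> f) \<otimes> b" using b P_carrier[OF assms(1)] by (simp add: A.m_assoc)
  then show ?thesis using e_P(1)[OF assms(1)] assms(3) b corner_cycle[OF assms(1,2,4)] by (simp add: cycles_def)
qed

lemma P_in_cycles: "f \<in> P \<Longrightarrow> f \<in> cycles (\<rho> f)"
  by (simp add: cycles_def P_carrier D_idem e_P)

lemma block_support:
  assumes y: "y \<in> carrier A" "e c \<otimes> y = y" and fg: "f \<in> P" "g \<in> P" and nz: "f \<otimes> y \<otimes> g \<noteq> \<zero>"
  shows "\<rho> f = c" "\<rho> g = c"
proof -
  note car = y(1) fg[THEN P_carrier]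
  have "f \<otimes> (e c \<otimes> y) \<otimes> g = (f \<otimes> e c) \<otimes> y \<otimes> g" using car by (simp add: A.m_assoc)
  then show "\<rho> f = c" using nz car y(2) by (auto simp: e_P[OF fg(1)] split: if_splits)
  have "f \<otimes> (y \<otimes> e c) \<otimes> g = f \<otimes> y \<otimes> (e c \<otimes> g)" using car by (simp add: A.m_assoc)
  then show "\<rho> g = c" using nz car e_right[OF y] by (auto simp: e_P[OF fg(2)] split: if_splits)
qed

text \<open>A nonzero graded ideal contains a nonzero homogeneous cycle in some block
  \<open>f A g\<close>. Being invertible there, it puts \<open>g\<close> into the ideal. The
  isomorphisms between idempotents of the class are themselves cycles by their degree, so they
  spread membership from \<open>g\<close> to the whole class and thus to the unit
  \<open>e c\<close>.\<close>

lemma cycles_simple: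
  assumes c: "c \<in> \<rho> ` P"
  shows "simple_galg (subalg A (cycles c) (e c) D)"
proof -
  interpret C: graded_corner K A "cycles c" "e c" D by (rule cycles_corner)
  interpret SR: ring C.S by (rule C.S_ring)
  interpret S: galg K C.S using C.S_graded_algebra by (simp add: galg_def)
  obtain f0 where f0: "f0 \<in> P" "\<rho> f0 = c" using c by blast
  have "f0 \<in> cycles c" "f0 \<noteq> \<zero>" using P_in_cycles[OF f0(1)] P_nonzero[OF f0(1)] f0(2) by auto
  then have "carrier C.S \<noteq> {\<zero>\<^bsub>C.S\<^esub>}" by auto
  moreover have "I = carrier C.S" if I: "ideal I C.S" "homogeneous C.S I" and nz: "I \<noteq> {\<zero>\<^bsub>C.S\<^esub>}" for I
  proof -
    interpret I: ideal I C.S by (rule I)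
    have sub: "x \<in> cycles c" if "x \<in> I" for x using I.a_subset that by auto
    have I0: "\<zero> \<in> I" using I.zero_closed by simp
    have Iadd: "x \<oplus> y \<in> I" if "x \<in> I" "y \<in> I" for x y using I.a_closed[OF that] by simp
    have Il: "a \<otimes> x \<in> I" if "a \<in> cycles c" "x \<in> I" for a x using I.I_l_closed[of x a] that by simp
    have Ir: "x \<otimes> a \<in> I" if "a \<in> cycles c" "x \<in> I" for a x using I.I_r_closed[of x a] that by simp
    obtain x where x: "x \<in> I" "x \<noteq> \<zero>" using nz I0 by auto
    have xc: "x \<in> carrier A" using C.C_carrier[OF sub[OF x(1)]] .
    obtain n where n: "hcomp A n x \<noteq> \<zero>" using eq_zero_if_hcomp[OF xc] x(2) by blast
    define y where "y = hcomp A n x"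
    have "hcomp C.S n x \<in> I" using S.homogeneous_iff[of I] I(2) x(1) I.a_subset by blast
    then have yI: "y \<in> I" using C.S_hcomp[OF sub[OF x(1)]] by (simp add: y_def)
    have yg: "y \<in> grade A n" using xc by (simp add: y_def)
    have yc: "y \<in> carrier A" "e c \<otimes> y = y" "D y = \<zero>" using sub[OF yI] by (auto simp: cycles_def)
    obtain f g where fg: "f \<in> P" "g \<in> P" and z: "f \<otimes> y \<otimes> g \<noteq> \<zero>"
      using zero_if_blocks[OF yc(1)] n[folded y_def] by blast
    have \<rho>: "\<rho> f = c" "\<rho> g = c" using block_support[OF yc(1,2) fg z] by auto
    have fgC: "f \<in> cycles c" "g \<in> cycles c" using P_in_cycles[OF fg(1)] P_in_cycles[OF fg(2)] \<rho> by auto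
    let ?z = "f \<otimes> y \<otimes> g"
    have zI: "?z \<in> I" using Il Ir fgC yI by simp
    have "D ?z = \<zero>" using sub[OF zI] by (simp add: cycles_def)
    \<comment> \<open>A cycle in \<open>J\<close> is zero by \<open>D_inj\<close>.\<close>
    then have zJ: "?z \<notin> J" using D_inj[of ?z] z radical_closed(2) by auto
    obtain b where b: "n = \<delta> f - \<delta> g" "b \<in> corner A g (- n) f" "b \<otimes> ?z = g"
      using P_inv[OF fg corner_P[OF fg yg] zJ] by metis
    have "b \<in> cycles c" using corner_in_cycles[OF fg(2,1) \<rho>(2)] b by simp
    then have gI: "g \<in> I" using Il[OF _ zI] b(3) by metis
    have hI: "h \<in> I" if h: "h \<in> P" "\<rho> h = c" for h
    proof -
      obtain a b where ab: "a \<in> corner A h (\<delta> h - \<delta> g) g" "b \<in> corner A g (- (\<delta> h - \<delta> g)) h" "a \<otimes> b = h"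
        using P_iso[OF h(1) fg(2) HOL.trans[OF h(2) \<rho>(2)[symmetric]]] unfolding idem_iso_def by blast
      have "a \<in> cycles c" "b \<in> cycles c"
        using corner_in_cycles[OF h(1) fg(2) h(2) ab(1)] corner_in_cycles[OF fg(2) h(1) \<rho>(2), of b] ab(2) by auto
      \<comment> \<open>This product is \<open>h\<close>, since \<open>a g = a\<close> and
        \<open>a b = h\<close>.\<close>
      then have "(a \<otimes> g) \<otimes> b \<in> I" using Il Ir gI by simp
      moreover have "a \<otimes> g = a" using ab(1) by (simp add: corner_def)
      ultimately show ?thesis using ab(3) by simp
    qed
    have "(\<Oplus>h\<in>Q. h) \<in> I" if "Q \<subseteq> {f \<in> P. \<rho> f = c}" for Q
      using that
    proof (induction Q rule: infinite_finite_induct)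
      case (insert h Q)
      have "(\<Oplus>h\<in>insert h Q. h) = h \<oplus> (\<Oplus>h\<in>Q. h)"
        by (rule A.finsum_insert) (use insert P_carrier in auto)
      then show ?case using insert hI Iadd by simp
    qed (auto simp: I0)
    then have eI: "e c \<in> I" by (simp add: e_def)
    have "x \<in> I" if "x \<in> cycles c" for x using Ir[OF that eI] that by (simp add: cycles_def)
    then show ?thesis using sub by auto
  qed
  ultimately show ?thesis unfolding simple_galg_def by blast
qed

text \<open>Without radical elements, every homogeneous piece of a block \<open>f A g\<close> has
  degree \<open>\<delta> f - \<delta> g\<close>, where \<open>D\<close> vanishes.\<close>

lemma block_eq_cycles:
  assumes z: "\<And>x. \<lbrakk>x \<in> J; e c \<otimes> x = x\<rbrakk> \<Longrightarrow> x = \<zero>"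
  shows "block c = cycles c"
proof -
  have homog: "D y = \<zero>" if y: "y \<in> grade A n" "e c \<otimes> y = y" for n y
  proof (rule zero_if_blocks)
    have yc: "y \<in> carrier A" using y(1) by (rule grade_carrier)
    then show "D y \<in> carrier A" by (rule D_hom(1))
    fix f g assume fg: "f \<in> P" "g \<in> P"
    note car = yc fg[THEN P_carrier]
    have eq: "f \<otimes> D y \<otimes> g = D (f \<otimes> y \<otimes> g)" using D_left[OF fg(1)] D_right[OF fg(2)] car by simp
    show "f \<otimes> D y \<otimes> g = \<zero>"
    proof (cases "f \<otimes> y \<otimes> g = \<zero>")
      case True
      then show ?thesis using eq D_hom(3) by simp
    next
      case False
      have "e c \<otimes> (f \<otimes> y \<otimes> g) = (e c \<otimes> f) \<otimes> y \<otimes> g" using car by (simp add: A.m_assoc)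
      then have "e c \<otimes> (f \<otimes> y \<otimes> g) = f \<otimes> y \<otimes> g"
        using block_support[OF yc y(2) fg False] e_P[OF fg(1)] by simp
      then have "f \<otimes> y \<otimes> g \<notin> J" using z False by blast
      then have "f \<otimes> y \<otimes> g \<in> corner A f (\<delta> f - \<delta> g) g"
        using corner_cases[OF fg corner_P[OF fg y(1)] False] corner_P[OF fg y(1)] by auto
      then show ?thesis using corner_cycle[OF fg] eq by simp
    qed
  qed
  have "D x = \<zero>" if x: "x \<in> carrier A" "e c \<otimes> x = x" for x
  proof (rule eq_zero_if_hcomp)
    show "hcomp A n (D x) = \<zero>" for n
      using D_hcomp[OF x(1), of "n - 1"] homog[OF hcomp_grade[OF x(1)] hcomp_block[OF x], of "n - 1"] by simp
  qed (use x D_hom(1) in auto)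
  then show ?thesis by (auto simp: block_def cycles_def)
qed

text \<open>The relations for \<open>x\<close> are not arranged by choice: \<open>x x\<close> and
  the graded commutators of \<open>x\<close> with cycles lie in \<open>J\<close> and are killed by
  \<open>D\<close>, so injectivity makes them zero.\<close>

lemma contracting_element:
  assumes c: "c \<in> \<rho> ` P" and x0: "x0 \<in> J" "e c \<otimes> x0 = x0" "x0 \<noteq> \<zero>"
  obtains x where "x \<in> grade A (- 1)" "x \<in> block c" "D x = e c" "x \<otimes> x = \<zero>"
    "\<And>s n. \<lbrakk>s \<in> cycles c; s \<in> grade A n\<rbrakk> \<Longrightarrow> x \<otimes> s = signed A n (s \<otimes> x)"
proof -
  interpret C: graded_corner K A "cycles c" "e c" D by (rule cycles_corner)
  interpret SR: ring C.S by (rule C.S_ring)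
  interpret S: galg K C.S using C.S_graded_algebra by (simp add: galg_def)
  let ?I = "{D y | y. y \<in> J \<and> e c \<otimes> y = y}"
  have mem: "D y \<in> ?I" if "y \<in> J" "e c \<otimes> y = y" for y using that by blast
  have sub: "?I \<subseteq> cycles c"
    using D_hom(1) D_D radical_carrier by (auto simp: cycles_def simp flip: D_e_mult)
  have "ideal ?I C.S"
  proof (rule idealI)
    show "ring C.S" by (rule C.S_ring)
    show "subgroup ?I (add_monoid C.S)"
    proof (rule group.subgroupI)
      show "Group.group (add_monoid C.S)" by (rule SR.add.is_group)
      show "?I \<subseteq> carrier (add_monoid C.S)" using sub by simp
      show "?I \<noteq> {}" using x0 by blast
    next
      fix a assume "a \<in> ?I"
      then obtain y where y: "a = D y" "y \<in> J" "e c \<otimes> y = y" by blast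
      have yc: "y \<in> carrier A" using y(2) by simp
      have "inv\<^bsub>add_monoid C.S\<^esub> a = \<ominus> a" using C.S_neg[of a] sub y mem by (auto simp: a_inv_def)
      also have "\<dots> = D (\<ominus> y)" using yc y(1) D_hom by simp
      finally show "inv\<^bsub>add_monoid C.S\<^esub> a \<in> ?I"
        using mem[of "\<ominus> y"] radical_closed(6)[OF y(2)] y(3) yc by (simp add: A.r_minus)
    next
      fix a b assume "a \<in> ?I" "b \<in> ?I"
      then obtain y z where y: "a = D y" "y \<in> J" "e c \<otimes> y = y" "b = D z" "z \<in> J" "e c \<otimes> z = z" by blast
      have "a \<oplus> b = D (y \<oplus> z)" using y D_hom(2) by simp
      then show "a \<otimes>\<^bsub>add_monoid C.S\<^esub> b \<in> ?I"
        using mem[of "y \<oplus> z"] radical_closed(3)[OF y(2,5)] y by (simp add: A.r_distr)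
    qed
  next
    fix a s assume "a \<in> ?I" and "s \<in> carrier C.S"
    then obtain y where y: "a = D y" "y \<in> J" "e c \<otimes> y = y" and s: "s \<in> carrier A" "e c \<otimes> s = s" "D s = \<zero>"
      by (auto simp: cycles_def)
    have yc: "y \<in> carrier A" using y(2) by simp
    have "D (parity A s) = \<zero>" using D_parity[OF s(1)] s(3) additive_onD(3)[OF parity_additive] by simp
    \<comment> \<open>\<open>parity A s\<close> is again a cycle, so the first term of the Leibniz
      rule disappears and \<open>s \<otimes> D y\<close> is a value of \<open>D\<close> on the
      radical.\<close>
    then have 1: "s \<otimes> a = D (parity A s \<otimes> y)" using D_parity_mult[OF s(1) yc] yc s y(1) D_hom(1) by simp
    have "e c \<otimes> (parity A s \<otimes> y) = parity A s \<otimes> (e c \<otimes> y)"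
      using e_central[of "parity A s" c] s yc by (simp flip: A.m_assoc)
    then show "s \<otimes>\<^bsub>C.S\<^esub> a \<in> ?I"
      using mem[of "parity A s \<otimes> y"] radical_closed(5)[OF parity_carrier[OF s(1)] y(2)] 1 y(3) by simp
    have 2: "a \<otimes> s = D (y \<otimes> s)" using D_mult_cycle[OF s(1,3) yc] y(1) by simp
    have "e c \<otimes> (y \<otimes> s) = y \<otimes> s" using y(3) yc s by (simp flip: A.m_assoc)
    then show "a \<otimes>\<^bsub>C.S\<^esub> s \<in> ?I"
      using mem[of "y \<otimes> s"] radical_mult_right[OF y(2) s(1)] 2 by simp
  qed
  moreover have "homogeneous C.S ?I"
  proof -
    have "hcomp C.S n a \<in> ?I" if a: "a \<in> ?I" for a n
    proof -
      obtain y where y: "a = D y" "y \<in> J" "e c \<otimes> y = y" using a by blast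
      have "hcomp C.S n a = hcomp A n a" using C.S_hcomp sub a by blast
      also have "\<dots> = D (hcomp A (n - 1) y)" using D_hcomp[of y "n - 1"] y by simp
      finally show ?thesis using mem radical_closed(4)[OF y(2)] hcomp_block[OF radical_carrier[OF y(2)] y(3)] by simp
    qed
    moreover have "?I \<subseteq> carrier C.S" using sub by simp
    ultimately show ?thesis using S.homogeneous_iff by blast
  qed
  moreover have "D x0 \<noteq> \<zero>" using D_inj[OF x0(1)] x0(3) radical_closed(2) by auto
  then have "?I \<noteq> {\<zero>}" using mem[OF x0(1,2)] by auto
  ultimately have "?I = cycles c" using cycles_simple[OF c] unfolding simple_galg_def by auto
  then have "e c \<in> ?I" using C.unit(1) by simp
  then obtain y where y: "e c = D y" "y \<in> J" "e c \<otimes> y = y" by blast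
  have yc: "y \<in> carrier A" using y(2) by simp
  \<comment> \<open>\<open>e c\<close> has degree \<open>0\<close>, so it is the image of the
    component of degree \<open>- 1\<close> alone.\<close>
  define x where "x = hcomp A (- 1) y"
  have xg: "x \<in> grade A (- 1)" and xJ: "x \<in> J" and xb: "e c \<otimes> x = x"
    using yc radical_closed(4)[OF y(2)] hcomp_block[OF yc y(3)] by (auto simp: x_def)
  have xc: "x \<in> carrier A" using xJ by simp
  have Dx: "D x = e c" using D_hcomp[OF yc, of "- 1"] hcomp_same[OF e_grade, of 0 c] y(1) by (simp add: x_def)
  have "D (x \<otimes> x) = e c \<otimes> x \<ominus> x \<otimes> e c" using D_mult[OF xg xc] Dx by (simp add: signed_def a_minus_def)
  then have "D (x \<otimes> x) = \<zero>" using e_right[OF xc xb] xb xc by (simp add: a_minus_def A.r_neg)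
  then have xx: "x \<otimes> x = \<zero>" using D_inj[of "x \<otimes> x"] radical_closed(2,5) xc xJ by simp
  have "x \<otimes> s = signed A n (s \<otimes> x)" if s: "s \<in> cycles c" "s \<in> grade A n" for s n
  proof -
    have sc: "s \<in> carrier A" "e c \<otimes> s = s" "D s = \<zero>" using s(1) by (auto simp: cycles_def)
    let ?u = "x \<otimes> s \<ominus> signed A n (s \<otimes> x)"
    have uJ: "?u \<in> J"
      using radical_mult_right[OF xJ sc(1)] radical_signed radical_closed(5)[OF sc(1) xJ] radical_closed(7) by simp
    have "D (signed A n (s \<otimes> x)) = signed A n (D (s \<otimes> x))" using sc xc D_hom by (simp add: signed_def)
    also have "D (s \<otimes> x) = signed A n s"
      using D_mult[OF s(2) xc] sc Dx e_right[OF sc(1,2)] xc by simp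
    also have "signed A n (signed A n s) = s" using sc by (simp add: signed_def)
    finally have "D ?u = \<zero>"
      using D_mult_cycle[OF sc(1,3) xc] Dx sc xc D_hom by (simp add: a_minus_def A.r_neg)
    then have "?u = \<zero>" using D_inj[OF uJ] radical_closed(2) by simp
    then show ?thesis using sc xc by (simp add: A.r_right_minus_eq)
  qed
  then show ?thesis using that[OF xg _ Dx xx] xb xc by (simp add: block_def)
qed

end

section \<open>Transport of structure\<close>

text \<open>\<open>T\<close> carries the twisted structure of \<open>A\<close> along the bijection
  \<open>G\<close>. The inverse is paired with \<open>\<ominus> b\<close> because the composite with
  \<open>(G, G b)\<close> has second entry \<open>\<ominus> b \<oplus> H (G b)\<close>, which has to
  vanish.\<close>

lemma (in curved) transport:
  fixes T :: "('k, 'b) calg"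
  assumes b: "b \<in> grade A 1" and G: "bij_betw G (carrier A) (carrier T)"
    and mult: "\<And>x y. \<lbrakk>x \<in> carrier A; y \<in> carrier A\<rbrakk> \<Longrightarrow> G (x \<otimes> y) = G x \<otimes>\<^bsub>T\<^esub> G y"
    and add: "\<And>x y. \<lbrakk>x \<in> carrier A; y \<in> carrier A\<rbrakk> \<Longrightarrow> G (x \<oplus> y) = G x \<oplus>\<^bsub>T\<^esub> G y"
    and one: "G \<one> = \<one>\<^bsub>T\<^esub>" and zero: "G \<zero> = \<zero>\<^bsub>T\<^esub>"
    and smult: "\<And>k x. \<lbrakk>k \<in> carrier K; x \<in> carrier A\<rbrakk> \<Longrightarrow> G (k \<odot> x) = k \<odot>\<^bsub>T\<^esub> G x"
    and grade: "\<And>n. grade T n = G ` grade A n"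
    and diff: "\<And>x. x \<in> carrier A \<Longrightarrow> diff T (G x) = G (twist A b x)"
    and curv: "curv T = G (twisted_curv A b)"
  obtains H where "(G, G b) \<in> curved_hom K A T" "(H, \<ominus> b) \<in> curved_hom K T A"
    "\<And>x. x \<in> carrier A \<Longrightarrow> H (G x) = x" "\<And>y. y \<in> carrier T \<Longrightarrow> G (H y) = y"
proof -
  have GT: "G x \<in> carrier T" if "x \<in> carrier A" for x using bij_betwE[OF G] that by blast
  have hom: "G \<in> ring_hom A T" using GT mult add one by (intro ring_hom_memI) auto
  \<comment> \<open>The image of a ring under a homomorphism is a ring for the inherited operations;
    by surjectivity this image is \<open>T\<close> itself.\<close>
  have "T\<lparr>carrier := G ` carrier A, ring.zero := G \<zero>\<rparr> = T" using bij_betw_imp_surj_on[OF G] zero by simp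
  then have ringT: "ring T" using A.ring_hom_imp_img_ring[OF hom] by simp
  interpret T: ring T by (rule ringT)
  have neg: "G (\<ominus> x) = \<ominus>\<^bsub>T\<^esub> G x" if x: "x \<in> carrier A" for x
  proof -
    have "G (\<ominus> x) \<oplus>\<^bsub>T\<^esub> G x = \<zero>\<^bsub>T\<^esub>" using add[of "\<ominus> x" x] x zero by (simp add: A.l_neg)
    then show ?thesis using T.minus_equality[of "G (\<ominus> x)" "G x"] GT x by simp
  qed
  have minus: "G (x \<ominus> y) = G x \<ominus>\<^bsub>T\<^esub> G y" if "x \<in> carrier A" "y \<in> carrier A" for x y
    using that add neg by (simp add: a_minus_def)
  have bc: "b \<in> carrier A" and hc: "curv A \<in> carrier A" using b curv_degree grade_carrier by blast+
  have sgn: "signed T n (G x) = G (signed A n x)" if "x \<in> carrier A" for n x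
    using that neg by (simp add: signed_def)
  have gc: "gcomm T 1 n (G y) (G a) = G (gcomm A 1 n y a)" if "y \<in> carrier A" "a \<in> carrier A" for n y a
    using that by (simp add: gcomm_def mult[symmetric] sgn minus)
  have gcc: "gcomm A 1 n y a \<in> carrier A" if "y \<in> carrier A" "a \<in> carrier A" for n y a
    using that by (simp add: gcomm_def)
  have tw: "twist A b a \<oplus> gcomm A 1 n b a = diff A a" if a: "a \<in> grade A n" for a n
    using twist_homog[OF a bc] gcc[OF bc grade_carrier[OF a]] grade_carrier[OF a] diff_hom(1)
    by (simp add: add_minus_cancel)
  have twc: "twist A b a \<in> carrier A" if "a \<in> carrier A" for a
    using that bc diff_hom(1) by (simp add: twist_def)
  have tcc: "twisted_curv A b \<in> carrier A" using bc hc diff_hom(1) by (simp add: twisted_curv_def)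
  have "(G, G b) \<in> curved_hom K A T"
    unfolding curved_hom_def galg_hom_def k_linear_def
  proof (safe)
    show "G b \<in> grade T 1" using b grade by simp
    show "G (diff A a) = diff T (G a) \<oplus>\<^bsub>T\<^esub> gcomm T 1 n (G b) (G a)" if a: "a \<in> grade A n" for n a
    proof -
      have ac: "a \<in> carrier A" using a by (rule grade_carrier)
      show ?thesis unfolding diff[OF ac] gc[OF bc ac] add[OF twc[OF ac] gcc[OF bc ac], symmetric] tw[OF a] ..
    qed
    \<comment> \<open>The condition on curvatures pulled back to \<open>A\<close>. As
      \<open>b\<close> is odd, \<open>[b, b]\<close> is \<open>2 b b\<close>, which is what the
      signs in \<open>twisted_curv\<close> account for.\<close>
    have "twisted_curv A b \<oplus> twist A b b \<oplus> b \<otimes> b = curv A"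
    proof -
      have "twist A b b = diff A b \<ominus> (b \<otimes> b \<ominus> (\<ominus> b) \<otimes> b)"
        by (simp add: twist_def parity_homog[OF b] signed_def)
      then show ?thesis unfolding twisted_curv_def using bc hc diff_hom(1)[OF bc] by simp algebra
    qed
    then show "G (curv A) = curv T \<oplus>\<^bsub>T\<^esub> diff T (G b) \<oplus>\<^bsub>T\<^esub> G b \<otimes>\<^bsub>T\<^esub> G b"
      unfolding curv diff[OF bc] using add mult tcc twc bc by (metis A.add.m_closed A.m_closed)
  qed (use hom GT add smult grade in auto)
  moreover define H where "H = inv_into (carrier A) G"
  have HG: "H (G x) = x" if "x \<in> carrier A" for x
    unfolding H_def by (rule bij_betw_inv_into_left[OF G that])
  have GH: "G (H y) = y" if "y \<in> carrier T" for y
    unfolding H_def by (rule bij_betw_inv_into_right[OF G that])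
  have ex: "\<exists>x\<in>carrier A. y = G x" if "y \<in> carrier T" for y
    using bij_betw_imp_surj_on[OF G] that by blast
  have "(H, \<ominus> b) \<in> curved_hom K T A"
    unfolding curved_hom_def galg_hom_def k_linear_def
  proof (safe)
    show "H \<in> ring_hom T A"
    proof (rule ring_hom_memI)
      fix x y assume "x \<in> carrier T" "y \<in> carrier T"
      then obtain u v where u: "u \<in> carrier A" "x = G u" "v \<in> carrier A" "y = G v" using ex by blast
      show "H x \<in> carrier A" using u HG by simp
      show "H (x \<otimes>\<^bsub>T\<^esub> y) = H x \<otimes> H y" using u HG mult[symmetric] by simp
      show "H (x \<oplus>\<^bsub>T\<^esub> y) = H x \<oplus> H y" using u HG add[symmetric] by simp
    qed (simp add: one[symmetric] HG)
    show "H x \<in> carrier A" if "x \<in> carrier T" for x using ex[OF that] HG by auto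
    show "H (x \<oplus>\<^bsub>T\<^esub> y) = H x \<oplus> H y" if "x \<in> carrier T" "y \<in> carrier T" for x y
      using ex[OF that(1)] ex[OF that(2)] HG add[symmetric] by auto
    show "H (c \<odot>\<^bsub>T\<^esub> x) = c \<odot> H x" if "c \<in> carrier K" "x \<in> carrier T" for c x
      using ex[OF that(2)] that(1) HG smult[symmetric] by auto
    show "H a \<in> grade A n" if "a \<in> grade T n" for a n
      using that HG grade grade_carrier by auto
    show "\<ominus> b \<in> grade A 1" using b by simp
    show "H (diff T a) = diff A (H a) \<oplus> gcomm A 1 n (\<ominus> b) (H a)" if a: "a \<in> grade T n" for n a
    proof -
      obtain u where u: "u \<in> grade A n" "a = G u" using a grade by auto
      have uc: "u \<in> carrier A" using u(1) by (rule grade_carrier)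
      have "gcomm A 1 n (\<ominus> b) u = \<ominus> gcomm A 1 n b u"
        using uc bc by (simp add: gcomm_def A.l_minus A.r_minus signed_def a_minus_def A.minus_add)
      then have "twist A b u = diff A u \<oplus> gcomm A 1 n (\<ominus> b) u"
        using twist_homog[OF u(1) bc] by (simp add: a_minus_def)
      then show ?thesis using u(2) HG[OF uc] HG[OF twc[OF uc]] diff[OF uc] by simp
    qed
    have "twisted_curv A b = curv A \<oplus> diff A (\<ominus> b) \<oplus> (\<ominus> b) \<otimes> (\<ominus> b)"
      using bc hc diff_hom by (simp add: twisted_curv_def a_minus_def A.l_minus A.r_minus)
    then show "H (curv T) = curv A \<oplus> diff A (\<ominus> b) \<oplus> (\<ominus> b) \<otimes> (\<ominus> b)"
      using curv HG[OF tcc] by simp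
  qed
  ultimately show ?thesis using that HG GH by blast
qed

lemma (in curved) transport_curved_isomorphic:
  fixes T :: "('k, 'b) calg"
  assumes "b \<in> grade A 1" "bij_betw G (carrier A) (carrier T)"
    "\<And>x y. \<lbrakk>x \<in> carrier A; y \<in> carrier A\<rbrakk> \<Longrightarrow> G (x \<otimes> y) = G x \<otimes>\<^bsub>T\<^esub> G y"
    "\<And>x y. \<lbrakk>x \<in> carrier A; y \<in> carrier A\<rbrakk> \<Longrightarrow> G (x \<oplus> y) = G x \<oplus>\<^bsub>T\<^esub> G y"
    "G \<one> = \<one>\<^bsub>T\<^esub>" "G \<zero> = \<zero>\<^bsub>T\<^esub>"
    "\<And>k x. \<lbrakk>k \<in> carrier K; x \<in> carrier A\<rbrakk> \<Longrightarrow> G (k \<odot> x) = k \<odot>\<^bsub>T\<^esub> G x"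
    "\<And>n. grade T n = G ` grade A n"
    "\<And>x. x \<in> carrier A \<Longrightarrow> diff T (G x) = G (twist A b x)"
    "curv T = G (twisted_curv A b)"
  shows "curved_isomorphic K A T"
proof -
  obtain H where H: "(G, G b) \<in> curved_hom K A T" "(H, \<ominus> b) \<in> curved_hom K T A"
    "\<And>x. x \<in> carrier A \<Longrightarrow> H (G x) = x" "\<And>y. y \<in> carrier T \<Longrightarrow> G (H y) = y"
    using transport[OF assms] by blast
  have bc: "b \<in> carrier A" using assms(1) by (rule grade_carrier)
  have "is_curved_id A (curved_comp A (H, \<ominus> b) (G, G b))"
    using H(3) bc by (simp add: is_curved_id_def curved_comp_def A.l_neg)
  moreover have "G b \<oplus>\<^bsub>T\<^esub> G (\<ominus> b) = \<zero>\<^bsub>T\<^esub>"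
    using assms(4)[of b "\<ominus> b"] bc assms(6) by (simp add: A.r_neg)
  then have "is_curved_id T (curved_comp T (G, G b) (H, \<ominus> b))"
    using H(4) by (simp add: is_curved_id_def curved_comp_def)
  ultimately show ?thesis using H(1,2) unfolding curved_isomorphic_def by blast
qed

lemma (in curved) transport_dg_isomorphic:
  fixes T :: "('k, 'b) calg"
  assumes bij: "bij_betw G (carrier A) (carrier T)"
    "\<And>x y. \<lbrakk>x \<in> carrier A; y \<in> carrier A\<rbrakk> \<Longrightarrow> G (x \<otimes> y) = G x \<otimes>\<^bsub>T\<^esub> G y"
    "\<And>x y. \<lbrakk>x \<in> carrier A; y \<in> carrier A\<rbrakk> \<Longrightarrow> G (x \<oplus> y) = G x \<oplus>\<^bsub>T\<^esub> G y"
    "G \<one> = \<one>\<^bsub>T\<^esub>" "G \<zero> = \<zero>\<^bsub>T\<^esub>"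
    "\<And>k x. \<lbrakk>k \<in> carrier K; x \<in> carrier A\<rbrakk> \<Longrightarrow> G (k \<odot> x) = k \<odot>\<^bsub>T\<^esub> G x"
    "\<And>n. grade T n = G ` grade A n"
    and d: "\<And>x. x \<in> carrier A \<Longrightarrow> diff T (G x) = G (diff A x)"
    and h: "curv T = G (curv A)"
  shows "dg_isomorphic K A T"
proof -
  have tw: "twist A \<zero> x = diff A x" if "x \<in> carrier A" for x
    using that diff_hom(1) by (simp add: twist_def a_minus_def)
  have hc: "curv A \<in> carrier A" using curv_degree grade_carrier by blast
  have tc: "twisted_curv A \<zero> = curv A"
    using hc diff_hom(3) by (simp add: twisted_curv_def a_minus_def)
  show ?thesis
  proof (rule transport[OF grade_zero bij])
    show "diff T (G x) = G (twist A \<zero> x)" if "x \<in> carrier A" for x using d tw that by simp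
    show "curv T = G (twisted_curv A \<zero>)" using h tc by simp
    fix H assume H: "(G, G \<zero>) \<in> curved_hom K A T" "(H, \<ominus> \<zero>) \<in> curved_hom K T A"
      "\<And>x. x \<in> carrier A \<Longrightarrow> H (G x) = x" "\<And>y. y \<in> carrier T \<Longrightarrow> G (H y) = y"
    then have "(G, \<zero>\<^bsub>T\<^esub>) \<in> curved_hom K A T" "(H, \<zero>) \<in> curved_hom K T A" using bij(5) by simp_all
    then show ?thesis using H(3,4) unfolding dg_isomorphic_def by blast
  qed
qed

section \<open>Recognising tensor products with the acyclic dual numbers\<close>

abbreviation (input) "EK \<equiv> acyclic_dual_numbers"

lemma acyclic_dual_numbers_simps [simp]:
  "grade (EK K) j = (if j = 0 then carrier K \<times> {\<zero>\<^bsub>K\<^esub>} else if j = - 1 then {\<zero>\<^bsub>K\<^esub>} \<times> carrier K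
     else {(\<zero>\<^bsub>K\<^esub>, \<zero>\<^bsub>K\<^esub>)})"
  "(u, v) \<oplus>\<^bsub>EK K\<^esub> (u', v') = (u \<oplus>\<^bsub>K\<^esub> u', v \<oplus>\<^bsub>K\<^esub> v')"
  "(u, v) \<otimes>\<^bsub>EK K\<^esub> (u', v') = (u \<otimes>\<^bsub>K\<^esub> u', u \<otimes>\<^bsub>K\<^esub> v' \<oplus>\<^bsub>K\<^esub> v \<otimes>\<^bsub>K\<^esub> u')"
  "c \<odot>\<^bsub>EK K\<^esub> (u, v) = (c \<otimes>\<^bsub>K\<^esub> u, c \<otimes>\<^bsub>K\<^esub> v)"
  "\<one>\<^bsub>EK K\<^esub> = (\<one>\<^bsub>K\<^esub>, \<zero>\<^bsub>K\<^esub>)"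
  "diff (EK K) (u, v) = (v, \<zero>\<^bsub>K\<^esub>)"
  "curv (EK K) = (\<zero>\<^bsub>K\<^esub>, \<zero>\<^bsub>K\<^esub>)"
  by (simp_all add: acyclic_dual_numbers_def)

text \<open>A block with a contracting element, taken as an algebra of its own. The bound
  \<open>N\<close> supplies one finite range of degrees for all normal forms.\<close>

locale contractible = curved K A
  for K :: "('k, 'm) ring_scheme" and A :: "('k, 'a) calg" (structure) +
  fixes x :: 'a and N :: int
  assumes curv_zero: "curv A = \<zero>"
    and x_grade: "x \<in> grade A (- 1)" and x_diff: "diff A x = \<one>" and x_square: "x \<otimes> x = \<zero>"
    and x_commute: "\<lbrakk>s \<in> grade A n; diff A s = \<zero>\<rbrakk> \<Longrightarrow> x \<otimes> s = signed A n (s \<otimes> x)"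
    and bounded: "N < \<bar>n\<bar> \<Longrightarrow> grade A n = {\<zero>}"
begin

abbreviation Z where "Z \<equiv> {s \<in> carrier A. diff A s = \<zero>}"
abbreviation S where "S \<equiv> subalg A Z \<one> (diff A)"
abbreviation FS where "FS \<equiv> formal_sums S (EK K)"
abbreviation (input) uK where "uK \<equiv> (\<one>\<^bsub>K\<^esub>, \<zero>\<^bsub>K\<^esub>)"
abbreviation (input) xK where "xK \<equiv> (\<zero>\<^bsub>K\<^esub>, \<one>\<^bsub>K\<^esub>)"
abbreviation (input) oK where "oK \<equiv> (\<zero>\<^bsub>K\<^esub>, \<zero>\<^bsub>K\<^esub>)"
abbreviation teq where "teq \<equiv> tensor_eq K S (EK K)"

lemma xc [simp]: "x \<in> carrier A"
  using x_grade by (rule grade_carrier)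

lemma diff_diff_zero: "y \<in> carrier A \<Longrightarrow> diff A (diff A y) = \<zero>"
proof (induction rule: homog_induct)
  case (homog n y)
  then show ?case using diff_diff[OF homog] curv_zero grade_carrier[OF homog] by (simp add: gcomm_def a_minus_def)
next
  case (add y z)
  then show ?case by (simp add: diff_hom)
qed

lemma Z_corner: "graded_corner K A Z \<one> (diff A)"
proof (intro graded_corner.intro graded_corner_axioms.intro)
  have d1: "diff A \<one> = \<zero>"
  proof -
    have "diff A \<one> = diff A \<one> \<oplus> diff A \<one>" using diff_mult[OF grade_one A.one_closed] diff_hom(1)[of \<one>] by (simp add: signed_def)
    then show ?thesis using diff_hom(1)[of \<one>] by simp
  qed
  then show "\<one> \<in> Z" by simp
  show "submodule Z K A" by (rule submoduleI) (auto simp: diff_hom diff_smult)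
  show "hcomp A n y \<in> Z" if "y \<in> Z" for n y
    using hcomp_additive_shift[OF diff_additive diff_degree, of y n] that by simp
  show "y \<otimes> z \<in> Z" if "y \<in> Z" "z \<in> Z" for y z
  proof -
    have z: "z \<in> carrier A" "diff A z = \<zero>" using that by auto
    have "diff A (y \<otimes> z) = diff A y \<otimes> z" if "y \<in> carrier A" for y
    proof (rule additive_eq[OF _ _ _ that])
      show "additive_on A (\<lambda>y. diff A (y \<otimes> z))" "additive_on A (\<lambda>y. diff A y \<otimes> z)"
        using additive_on_comp diff_additive additive_on_mult(2)[OF z(1)] by blast+
      show "diff A (y \<otimes> z) = diff A y \<otimes> z" if "y \<in> grade A n" for n y
        using diff_mult[OF that z(1)] z grade_carrier[OF that] diff_hom(1) by simp
    qed
    then show ?thesis using that by simp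
  qed
qed (auto simp: galg_axioms grade_one diff_additive diff_smult diff_degree diff_mult diff_hom diff_diff_zero)

text \<open>The natural map from the tensor product to \<open>A\<close>, on symbols; the isomorphism
  sought is its inverse.\<close>

definition sym_val :: "int \<times> 'a \<times> int \<times> ('k \<times> 'k) \<Rightarrow> 'a" where
  "sym_val = (\<lambda>(i, a, j, u, v). u \<odot> a \<oplus> (v \<odot> a) \<otimes> x)"

definition sym_ok :: "int \<times> 'a \<times> int \<times> ('k \<times> 'k) \<Rightarrow> bool" where
  "sym_ok = (\<lambda>(i, a, j, b). a \<in> grade S i \<and> b \<in> grade (EK K) j)"

lemma FS_iff: "M \<in> FS \<longleftrightarrow> (\<forall>s\<in>#M. sym_ok s)"
  by (auto simp: formal_sums_def sym_ok_def)

text \<open>The case \<open>zero\<close> collects the symbols whose second entry is zero in an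
  arbitrary degree \<open>j\<close>. They cannot be avoided, since differentiating a symbol with
  \<open>j = 0\<close> produces one with \<open>j = 1\<close>.\<close>

lemma sym_okE:
  assumes "sym_ok s"
  obtains (unit) i a u where "s = (i, a, 0, (u, \<zero>\<^bsub>K\<^esub>))" "a \<in> grade A i" "a \<in> carrier A" "diff A a = \<zero>"
      "u \<in> carrier K" "sym_val s = u \<odot> a"
  | (x) i a v where "s = (i, a, - 1, (\<zero>\<^bsub>K\<^esub>, v))" "a \<in> grade A i" "a \<in> carrier A" "diff A a = \<zero>"
      "v \<in> carrier K" "sym_val s = (v \<odot> a) \<otimes> x"
  | (zero) i a j where "s = (i, a, j, oK)" "a \<in> grade A i" "a \<in> carrier A" "diff A a = \<zero>"
      "sym_val s = \<zero>"
  using assms that by (cases s) (auto simp: sym_ok_def sym_val_def split: if_splits)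

lemma sym_val_carrier: "sym_ok s \<Longrightarrow> sym_val s \<in> carrier A"
  by (erule sym_okE) auto

text \<open>The guards make \<open>sum_step\<close> commute on the whole type, as \<^const>\<open>fold_mset\<close> requires.\<close>
definition sum_step where
  "sum_step s y = (if sym_ok s \<and> y \<in> carrier A then sym_val s \<oplus> y else y)"

definition sum_val :: "('a, 'k \<times> 'k) formal_sum \<Rightarrow> 'a" where
  "sum_val M = fold_mset sum_step \<zero> M"

interpretation sum_step: comp_fun_commute sum_step
  by unfold_locales (auto simp: sum_step_def fun_eq_iff sym_val_carrier A.a_lcomm)

lemma sum_val_empty [simp]: "sum_val {#} = \<zero>"
  by (simp add: sum_val_def)

lemma sum_val_carrier [simp]: "sum_val M \<in> carrier A"
  by (induction M) (auto simp: sum_val_def sum_step_def sym_val_carrier)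

lemma sum_val_add: "sym_ok s \<Longrightarrow> sum_val (add_mset s M) = sym_val s \<oplus> sum_val M"
  using sum_val_carrier[of M] by (simp add: sum_val_def sum_step_def)

lemma sum_val_union: "\<lbrakk>M \<in> FS; M' \<in> FS\<rbrakk> \<Longrightarrow> sum_val (M + M') = sum_val M \<oplus> sum_val M'"
  by (induction M) (auto simp: FS_iff sum_val_add sym_val_carrier A.a_assoc)

lemma FS_union [simp]: "M + M' \<in> FS \<longleftrightarrow> M \<in> FS \<and> M' \<in> FS"
  by (auto simp: FS_iff)

lemma FS_empty [simp]: "{#} \<in> FS"
  by (simp add: FS_iff)

lemma FS_add [simp]: "add_mset s M \<in> FS \<longleftrightarrow> sym_ok s \<and> M \<in> FS"
  by (auto simp: FS_iff)

text \<open>Each defining relation preserves values, so evaluation descends to classes. Its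
  injectivity is the harder half and goes through normal forms.\<close>

lemma tensor_eq_sound: "teq M M' \<Longrightarrow> M \<in> FS \<and> M' \<in> FS \<and> sum_val M = sum_val M'"
proof (induction rule: tensor_eq.induct)
  case (zero b j i)
  have "sym_ok (i, \<zero>, j, b)" using zero by (simp add: sym_ok_def diff_hom)
  moreover have "sym_val (i, \<zero>, j, b) = \<zero>"
    using zero by (cases b) (auto simp: sym_val_def split: if_splits)
  ultimately show ?case by (simp add: sum_val_add)
next
  case (add_left a i a' b j)
  obtain u v where b: "b = (u, v)" by (cases b)
  have c: "a \<in> carrier A" "a' \<in> carrier A" using add_left by auto
  have uv: "u \<in> carrier K" "v \<in> carrier K" using add_left(3) b by (auto split: if_splits)
  have "sym_val (i, a \<oplus> a', j, b) = sym_val (i, a, j, b) \<oplus> sym_val (i, a', j, b)"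
    using c uv by (simp add: sym_val_def b smult_r_distr A.l_distr A.a_ac)
  moreover have "sym_ok (i, a \<oplus> a', j, b)" "sym_ok (i, a, j, b)" "sym_ok (i, a', j, b)"
    using add_left by (simp_all add: sym_ok_def diff_hom)
  ultimately show ?case by (simp add: sum_val_add sym_val_carrier)
next
  case (add_right a i b j b')
  obtain u v u' v' where b: "b = (u, v)" "b' = (u', v')" by (cases b, cases b')
  have c: "a \<in> carrier A" using add_right by auto
  have uv: "u \<in> carrier K" "v \<in> carrier K" "u' \<in> carrier K" "v' \<in> carrier K"
    using add_right(2,3) b by (auto split: if_splits)
  have "sym_val (i, a, j, b \<oplus>\<^bsub>EK K\<^esub> b') = sym_val (i, a, j, b) \<oplus> sym_val (i, a, j, b')"
    using c uv by (simp add: sym_val_def b smult_l_distr A.l_distr A.a_ac)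
  moreover have "sym_ok (i, a, j, b \<oplus>\<^bsub>EK K\<^esub> b')" "sym_ok (i, a, j, b)" "sym_ok (i, a, j, b')"
    using add_right b by (auto simp: sym_ok_def split: if_splits)
  ultimately show ?case by (simp add: sum_val_add sym_val_carrier)
next
  case (smult c a i b j)
  obtain u v where b: "b = (u, v)" by (cases b)
  have a: "a \<in> carrier A" using smult by auto
  have uv: "u \<in> carrier K" "v \<in> carrier K" using smult(3) b by (auto split: if_splits)
  have "sym_val (i, c \<odot> a, j, b) = sym_val (i, a, j, c \<odot>\<^bsub>EK K\<^esub> b)"
    using a uv smult(1) by (simp add: sym_val_def b K.m_comm flip: smult_assoc1)
  moreover have "sym_ok (i, c \<odot> a, j, b)" "sym_ok (i, a, j, c \<odot>\<^bsub>EK K\<^esub> b)"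
    using smult b by (auto simp: sym_ok_def diff_smult split: if_splits)
  ultimately show ?case by (simp add: sum_val_add sym_val_carrier)
qed (auto simp: sum_val_union)

text \<open>\<open>y = (y - x dy) + x dy\<close>, where \<open>y - x dy\<close> and \<open>dy\<close> are cycles.\<close>
definition sym_part1 where "sym_part1 n y = (n, y \<ominus> x \<otimes> diff A y, 0::int, uK)"
definition sym_part2 where "sym_part2 n y = (n + 1, signed A (n + 1) (diff A y), - 1::int, xK)"

lemma x_diff_grade: "y \<in> grade A n \<Longrightarrow> x \<otimes> diff A y \<in> grade A n"
  using grade_mult[OF x_grade diff_degree] by simp

lemma part_cycle: "y \<in> grade A n \<Longrightarrow> diff A (y \<ominus> x \<otimes> diff A y) = \<zero>"
proof -
  assume y: "y \<in> grade A n"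
  have yc: "y \<in> carrier A" using y by (rule grade_carrier)
  have "diff A (x \<otimes> diff A y) = diff A y"
    using diff_mult[OF x_grade diff_hom(1)[OF yc]] yc diff_hom(1)[OF yc] by (simp add: x_diff diff_diff_zero)
  then show ?thesis using yc by (simp add: diff_hom a_minus_def A.r_neg)
qed

lemma part_ok: "y \<in> grade A n \<Longrightarrow> sym_ok (sym_part1 n y) \<and> sym_ok (sym_part2 n y)"
proof -
  assume y: "y \<in> grade A n"
  have yc: "y \<in> carrier A" using y by (rule grade_carrier)
  have "diff A (signed A (n + 1) (diff A y)) = \<zero>"
    using yc by (simp add: signed_def diff_hom diff_diff_zero)
  then show ?thesis using y yc part_cycle[OF y] x_diff_grade[OF y] diff_degree[OF y] diff_hom(1)[OF yc]
    by (simp add: sym_ok_def sym_part1_def sym_part2_def)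
qed

text \<open>The sign in \<open>sym_part2\<close> is the one picked up when \<open>x\<close> moves to
  the right past the cycle \<open>diff A y\<close>, which has degree \<open>n + 1\<close>.\<close>

lemma part_val:
  assumes y: "y \<in> grade A n"
  shows "sum_val {#sym_part1 n y, sym_part2 n y#} = y"
proof -
  have yc: "y \<in> carrier A" using y by (rule grade_carrier)
  have dc: "diff A y \<in> carrier A" using diff_hom(1)[OF yc] .
  have "x \<otimes> diff A y = signed A (n + 1) (diff A y \<otimes> x)"
    using x_commute[OF diff_degree[OF y]] diff_diff_zero[OF yc] by simp
  then have "sym_val (sym_part2 n y) = x \<otimes> diff A y"
    using dc by (simp add: sym_val_def sym_part2_def signed_mult_left)
  moreover have "sym_val (sym_part1 n y) = y \<ominus> x \<otimes> diff A y"
    using dc yc by (simp add: sym_val_def sym_part1_def)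
  ultimately show ?thesis using part_ok[OF y] dc yc by (simp add: sum_val_add add_minus_cancel)
qed

lemma teq_refl: "M \<in> FS \<Longrightarrow> teq M M"
  by (rule tensor_eq.refl)

lemma pair_mset: "{#s, t#} = {#s#} + {#t#}"
  by simp

lemma part_add:
  assumes y: "y \<in> grade A n" and z: "z \<in> grade A n"
  shows "teq {#sym_part1 n (y \<oplus> z), sym_part2 n (y \<oplus> z)#}
    ({#sym_part1 n y, sym_part2 n y#} + {#sym_part1 n z, sym_part2 n z#})"
proof -
  have c: "y \<in> carrier A" "z \<in> carrier A" using y z grade_carrier by blast+
  note dc = diff_hom(1)[OF c(1)] diff_hom(1)[OF c(2)]
  have 1: "(y \<oplus> z) \<ominus> x \<otimes> diff A (y \<oplus> z) = (y \<ominus> x \<otimes> diff A y) \<oplus> (z \<ominus> x \<otimes> diff A z)"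
    using c dc by (simp add: diff_hom A.r_distr minus_add_minus)
  have 2: "signed A (n + 1) (diff A (y \<oplus> z)) = signed A (n + 1) (diff A y) \<oplus> signed A (n + 1) (diff A z)"
    using c dc by (simp add: diff_hom signed_add)
  have "teq {#sym_part1 n (y \<oplus> z)#} {#sym_part1 n y, sym_part1 n z#}"
    unfolding sym_part1_def 1
    using tensor_eq.add_left[of "y \<ominus> x \<otimes> diff A y" S n "z \<ominus> x \<otimes> diff A z" "uK" "EK K" 0 K]
      part_ok[OF y] part_ok[OF z] by (simp add: sym_ok_def sym_part1_def)
  moreover have "teq {#sym_part2 n (y \<oplus> z)#} {#sym_part2 n y, sym_part2 n z#}"
    unfolding sym_part2_def 2
    using tensor_eq.add_left[of "signed A (n + 1) (diff A y)" S "n + 1" "signed A (n + 1) (diff A z)" "xK" "EK K" "- 1" K]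
      part_ok[OF y] part_ok[OF z] by (simp add: sym_ok_def sym_part2_def)
  ultimately have "teq ({#sym_part1 n (y \<oplus> z)#} + {#sym_part2 n (y \<oplus> z)#})
      ({#sym_part1 n y, sym_part1 n z#} + {#sym_part2 n y, sym_part2 n z#})"
    by (rule tensor_eq.plus)
  then show ?thesis by (simp add: add_mset_commute)
qed

lemma part_zero: "teq {#sym_part1 n \<zero>, sym_part2 n \<zero>#} {#}"
proof -
  have "teq {#sym_part1 n \<zero>#} {#}" "teq {#sym_part2 n \<zero>#} {#}"
    using tensor_eq.zero[of "uK" "EK K" 0 K S n]
      tensor_eq.zero[of "xK" "EK K" "- 1" K S "n + 1"]
    by (simp_all add: sym_part1_def sym_part2_def diff_hom a_minus_def)
  from tensor_eq.plus[OF this] show ?thesis by (simp add: add_mset_commute)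
qed

text \<open>The sum runs over a fixed range instead of the support of \<open>y\<close>, so that
  normal forms of different elements can be added degree by degree.\<close>

definition normal_form :: "'a \<Rightarrow> ('a, 'k \<times> 'k) formal_sum" where
  "normal_form y = (\<Sum>n\<in>{-N..N}. {#sym_part1 n (hcomp A n y), sym_part2 n (hcomp A n y)#})"

lemma teq_sum:
  assumes "\<And>n. n \<in> I \<Longrightarrow> teq (f n) (g n)"
  shows "teq (sum f I) (sum g I)"
  using assms
proof (induction I rule: infinite_finite_induct)
  case (insert n I)
  then show ?case by (simp add: tensor_eq.plus)
qed (simp_all add: teq_refl)

lemma FS_sum: "(\<And>n. n \<in> I \<Longrightarrow> f n \<in> FS) \<Longrightarrow> sum f I \<in> FS"
  by (induction I rule: infinite_finite_induct) auto

lemma sum_val_sum: "(\<And>n. n \<in> I \<Longrightarrow> f n \<in> FS) \<Longrightarrow> sum_val (sum f I) = (\<Oplus>n\<in>I. sum_val (f n))"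
proof (induction I rule: infinite_finite_induct)
  case (insert n I)
  then have "sum_val (sum f (insert n I)) = sum_val (f n) \<oplus> sum_val (sum f I)"
    by (simp add: sum_val_union FS_sum)
  moreover have "(\<Oplus>n\<in>insert n I. sum_val (f n)) = sum_val (f n) \<oplus> (\<Oplus>n\<in>I. sum_val (f n))"
    by (rule A.finsum_insert) (use insert in auto)
  ultimately show ?case using insert by simp
qed auto

lemma hcomp_out:
  assumes "y \<in> carrier A" "n \<notin> {-N..N}" shows "hcomp A n y = \<zero>"
proof -
  have "N < \<bar>n\<bar>" using assms(2) by auto
  from bounded[OF this] show ?thesis using hcomp_grade[OF assms(1), of n] by simp
qed

lemma normal_form_FS: "y \<in> carrier A \<Longrightarrow> normal_form y \<in> FS"
  unfolding normal_form_def using part_ok[OF hcomp_grade] by (intro FS_sum) simp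

lemma sum_val_normal_form:
  assumes y: "y \<in> carrier A"
  shows "sum_val (normal_form y) = y"
proof -
  have "sum_val (normal_form y) = (\<Oplus>n\<in>{-N..N}. sum_val {#sym_part1 n (hcomp A n y), sym_part2 n (hcomp A n y)#})"
    unfolding normal_form_def using part_ok[OF hcomp_grade[OF y]] by (intro sum_val_sum) simp
  also have "\<dots> = (\<Oplus>n\<in>{-N..N}. hcomp A n y)"
    by (rule A.finsum_cong') (use part_val[OF hcomp_grade[OF y]] y in auto)
  also have "\<dots> = y" using hcomp_sum[OF y _ hcomp_out[OF y], of "{-N..N}"] by simp
  finally show ?thesis .
qed

lemma normal_form_add:
  assumes "y \<in> carrier A" "z \<in> carrier A"
  shows "teq (normal_form (y \<oplus> z)) (normal_form y + normal_form z)"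
proof -
  have "teq (normal_form (y \<oplus> z)) (\<Sum>n\<in>{-N..N}. {#sym_part1 n (hcomp A n y), sym_part2 n (hcomp A n y)#} +
      {#sym_part1 n (hcomp A n z), sym_part2 n (hcomp A n z)#})"
    unfolding normal_form_def using assms part_add[OF hcomp_grade hcomp_grade] by (intro teq_sum) simp
  then show ?thesis by (simp only: sum.distrib normal_form_def)
qed

lemma normal_form_homog:
  assumes y: "y \<in> grade A i"
  shows "teq (normal_form y) {#sym_part1 i y, sym_part2 i y#}"
proof (cases "i \<in> {-N..N}")
  case True
  have "normal_form y = {#sym_part1 i (hcomp A i y), sym_part2 i (hcomp A i y)#} +
      (\<Sum>n\<in>{-N..N} - {i}. {#sym_part1 n (hcomp A n y), sym_part2 n (hcomp A n y)#})"
    unfolding normal_form_def using True by (intro sum.remove) auto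
  moreover have "teq (\<Sum>n\<in>{-N..N} - {i}. {#sym_part1 n (hcomp A n y), sym_part2 n (hcomp A n y)#})
      (\<Sum>n\<in>{-N..N} - {i}. {#})"
    by (rule teq_sum) (use part_zero hcomp_same[OF y] in auto)
  ultimately show ?thesis
    using tensor_eq.plus[OF teq_refl[of "{#sym_part1 i y, sym_part2 i y#}"]] part_ok[OF y] hcomp_same[OF y, of i]
    by fastforce
next
  case False
  \<comment> \<open>Outside the range of summation there is nothing but zero, and then both sides
    reduce to the empty sum.\<close>
  then have y0: "y = \<zero>" using hcomp_out[OF grade_carrier[OF y] False] hcomp_same[OF y, of i] by simp
  have "teq (normal_form y) (\<Sum>n\<in>{-N..N}. {#})"
    unfolding normal_form_def by (rule teq_sum) (use part_zero y0 hcomp_hom(2) in auto)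
  moreover have "teq (\<Sum>n\<in>{-N..N}. {#}) {#sym_part1 i y, sym_part2 i y#}"
    using tensor_eq.sym[OF part_zero[of i]] y0 by simp
  ultimately show ?thesis by (rule tensor_eq.trans)
qed

text \<open>The relation \<open>zero\<close> removes symbols whose left entry vanishes; the scalar
  \<open>\<zero>\<close> carries the vanishing from the right entry to the left.\<close>

lemma teq_zero_scalar:
  assumes a: "a \<in> grade A i" "diff A a = \<zero>"
  shows "teq {#(i, a, j, oK)#} {#}"
proof -
  have ac: "a \<in> carrier A" using a(1) by (rule grade_carrier)
  have "teq {#(i, \<zero>\<^bsub>K\<^esub> \<odot> a, j, oK)#} {#(i, a, j, \<zero>\<^bsub>K\<^esub> \<odot>\<^bsub>EK K\<^esub> oK)#}"
    using tensor_eq.smult[of "\<zero>\<^bsub>K\<^esub>" K a S i "oK" "EK K" j] a ac by simp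
  then have "teq {#(i, \<zero>, j, oK)#} {#(i, a, j, oK)#}" using ac by simp
  moreover have "teq {#(i, \<zero>, j, oK)#} {#}"
    using tensor_eq.zero[of "oK" "EK K" j K S i] by simp
  ultimately show ?thesis using tensor_eq.trans tensor_eq.sym by blast
qed

text \<open>Of the two parts of \<open>sym_val s\<close>, one has a vanishing left entry and the
  other is \<open>s\<close> up to moving a scalar across.\<close>

lemma normal_form_sym:
  assumes s: "sym_ok s"
  shows "teq (normal_form (sym_val s)) {#s#}"
  using s
proof (cases rule: sym_okE)
  case (unit i a u)
  let ?y = "u \<odot> a"
  have y: "?y \<in> grade A i" "diff A ?y = \<zero>" using unit by (simp_all add: diff_smult)
  note yc = grade_carrier[OF y(1)]
  have p1: "sym_part1 i ?y = (i, ?y, 0, uK)" using y(2) yc by (simp add: sym_part1_def a_minus_def)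
  have p2: "sym_part2 i ?y = (i + 1, \<zero>, - 1, xK)" using y(2) by (simp add: sym_part2_def)
  have "teq {#sym_part2 i ?y#} {#}"
    unfolding p2 using tensor_eq.zero[of "xK" "EK K" "- 1" K S "i + 1"] by simp
  moreover have "teq {#sym_part1 i ?y#} {#s#}"
    unfolding p1 unit(1) using tensor_eq.smult[of u K a S i "uK" "EK K" 0] unit by simp
  ultimately have "teq ({#sym_part1 i ?y#} + {#sym_part2 i ?y#}) ({#s#} + {#})" by (intro tensor_eq.plus)
  from tensor_eq.trans[OF normal_form_homog[OF y(1), unfolded pair_mset] this] show ?thesis
    using unit(6) by simp
next
  case (x i a v)
  let ?a = "v \<odot> a" let ?y = "?a \<otimes> x"
  have a: "?a \<in> grade A i" "diff A ?a = \<zero>" using x by (simp_all add: diff_smult)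
  note ac = grade_carrier[OF a(1)]
  have y: "?y \<in> grade A (i - 1)" using grade_mult[OF a(1) x_grade] by simp
  have dy: "diff A ?y = signed A i ?a" using diff_mult[OF a(1) xc] a(2) ac by (simp add: x_diff)
  \<comment> \<open>Here \<open>x \<otimes> diff A ?y = ?y\<close>, so the first part is zero and
    the second returns \<open>?a\<close> with its sign squared away.\<close>
  have xa: "x \<otimes> signed A i ?a = ?y"
    using x_commute[OF a] ac by (simp add: signed_mult_right signed_signed) (simp add: signed_def)
  have p1: "sym_part1 (i - 1) ?y = (i - 1, \<zero>, 0, uK)"
    using ac by (simp add: sym_part1_def dy xa a_minus_def A.r_neg)
  have p2: "sym_part2 (i - 1) ?y = (i, ?a, - 1, xK)"
    using ac by (simp add: sym_part2_def dy signed_signed) (simp add: signed_def)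
  have "teq {#sym_part1 (i - 1) ?y#} {#}"
    unfolding p1 using tensor_eq.zero[of "uK" "EK K" 0 K S "i - 1"] by simp
  moreover have "teq {#sym_part2 (i - 1) ?y#} {#s#}"
    unfolding p2 x(1) using tensor_eq.smult[of v K a S i "xK" "EK K" "- 1"] x by simp
  ultimately have "teq ({#sym_part1 (i - 1) ?y#} + {#sym_part2 (i - 1) ?y#}) ({#} + {#s#})"
    by (intro tensor_eq.plus)
  from tensor_eq.trans[OF normal_form_homog[OF y, unfolded pair_mset] this] show ?thesis
    using x(6) by simp
next
  case (zero i a j)
  have "teq (normal_form \<zero>) {#}"
    using normal_form_homog[OF grade_zero, of 0] part_zero tensor_eq.trans by blast
  moreover have "teq {#} {#s#}" using teq_zero_scalar[OF zero(2,4)] zero(1) by (simp add: tensor_eq.sym)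
  ultimately show ?thesis unfolding zero(5) by (rule tensor_eq.trans)
qed

text \<open>A formal sum can be recovered from its value up to equivalence, which makes evaluation
  injective on classes.\<close>

lemma normal_form_eq: "M \<in> FS \<Longrightarrow> teq (normal_form (sum_val M)) M"
proof (induction M)
  case empty
  then show ?case using tensor_eq.trans[OF normal_form_homog[OF grade_zero, of 0] part_zero] by simp
next
  case (add s M)
  then have s: "sym_ok s" and M: "M \<in> FS" by auto
  have "teq (normal_form (sum_val (add_mset s M))) (normal_form (sym_val s) + normal_form (sum_val M))"
    using normal_form_add[OF sym_val_carrier[OF s] sum_val_carrier] by (simp add: sum_val_add[OF s])
  moreover have "teq (normal_form (sym_val s) + normal_form (sum_val M)) ({#s#} + M)"
    by (rule tensor_eq.plus[OF normal_form_sym[OF s] add.IH[OF M]])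
  ultimately have "teq (normal_form (sum_val (add_mset s M))) ({#s#} + M)" by (rule tensor_eq.trans)
  then show ?case by simp
qed

lemma tensor_eq_iff:
  assumes "M \<in> FS" "M' \<in> FS"
  shows "teq M M' \<longleftrightarrow> sum_val M = sum_val M'"
proof
  assume "sum_val M = sum_val M'"
  then have "teq (normal_form (sum_val M)) M'" using normal_form_eq[OF assms(2)] by simp
  with tensor_eq.sym[OF normal_form_eq[OF assms(1)]] show "teq M M'" by (rule tensor_eq.trans)
qed (use tensor_eq_sound in blast)

end

section \<open>Algebra structure of the tensor product\<close>

context contractible begin

interpretation C: graded_corner K A Z \<one> "diff A" by (rule Z_corner)

abbreviation fmult where "fmult \<equiv> formal_mult S (EK K)"
abbreviation fdiff where "fdiff \<equiv> formal_diff S (EK K)"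
abbreviation tclass where "tclass \<equiv> tensor_class K S (EK K)"

definition sym_mult :: "int \<times> 'a \<times> int \<times> ('k \<times> 'k) \<Rightarrow> int \<times> 'a \<times> int \<times> ('k \<times> 'k) \<Rightarrow> int \<times> 'a \<times> int \<times> ('k \<times> 'k)" where
  "sym_mult = (\<lambda>(i, a, j, b) (i', a', j', b').
     (i + i', signed S (j * i') (a \<otimes>\<^bsub>S\<^esub> a'), j + j', b \<otimes>\<^bsub>EK K\<^esub> b'))"

definition sym_diff :: "int \<times> 'a \<times> int \<times> ('k \<times> 'k) \<Rightarrow> ('a, 'k \<times> 'k) formal_sum" where
  "sym_diff = (\<lambda>(i, a, j, b). {#(i + 1, diff S a, j, b), (i, signed S i a, j + 1, diff (EK K) b)#})"

definition sym_smult :: "'k \<Rightarrow> int \<times> 'a \<times> int \<times> ('k \<times> 'k) \<Rightarrow> int \<times> 'a \<times> int \<times> ('k \<times> 'k)" where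
  "sym_smult c = (\<lambda>(i, a, j, b). (i, c \<odot>\<^bsub>S\<^esub> a, j, b))"

lemma formal_mult_eq: "fmult M M' = (\<Sum>s\<in>#M. image_mset (sym_mult s) M')"
proof -
  have "(\<lambda>(i, a, j, b). image_mset (\<lambda>(i', a', j', b').
        (i + i', signed S (j * i') (a \<otimes>\<^bsub>S\<^esub> a'), j + j', b \<otimes>\<^bsub>EK K\<^esub> b')) M') = (\<lambda>s. image_mset (sym_mult s) M')"
    by (simp add: fun_eq_iff sym_mult_def split_def)
  then show ?thesis by (simp add: formal_mult_def)
qed

lemma formal_diff_eq: "fdiff M = (\<Sum>s\<in>#M. sym_diff s)"
  by (simp add: formal_diff_def sym_diff_def)

lemma smult_mult_smult:
  assumes "k \<in> carrier K" "l \<in> carrier K" "y \<in> carrier A" "z \<in> carrier A"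
  shows "(k \<odot> y) \<otimes> (l \<odot> z) = (k \<otimes>\<^bsub>K\<^esub> l) \<odot> (y \<otimes> z)"
proof -
  have "(k \<odot> y) \<otimes> (l \<odot> z) = k \<odot> (y \<otimes> (l \<odot> z))" by (rule smult_mult_left) (use assms in auto)
  also have "y \<otimes> (l \<odot> z) = l \<odot> (y \<otimes> z)" by (rule smult_mult_right) (use assms in auto)
  finally show ?thesis using assms by (simp add: smult_assoc1)
qed

lemma x_absorb:
  assumes a: "a \<in> grade A i" "diff A a = \<zero>" and b: "b \<in> grade A j" "diff A b = \<zero>"
  shows "(a \<otimes> x) \<otimes> b = signed A j ((a \<otimes> b) \<otimes> x)" "(a \<otimes> x) \<otimes> (b \<otimes> x) = \<zero>"
proof -
  have c: "a \<in> carrier A" "b \<in> carrier A" using a(1) b(1) grade_carrier by blast+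
  show 1: "(a \<otimes> x) \<otimes> b = signed A j ((a \<otimes> b) \<otimes> x)"
    using c by (simp add: A.m_assoc x_commute[OF b] signed_mult_right)
  have "(a \<otimes> x) \<otimes> (b \<otimes> x) = ((a \<otimes> x) \<otimes> b) \<otimes> x" using c by (simp add: A.m_assoc)
  also have "\<dots> = signed A j ((a \<otimes> b) \<otimes> (x \<otimes> x))" unfolding 1 using c by (simp add: signed_mult_left A.m_assoc)
  finally show "(a \<otimes> x) \<otimes> (b \<otimes> x) = \<zero>" using c by (simp add: x_square)
qed

text \<open>The sign \<open>(-1)^(j i')\<close> is trivial for \<open>j = 0\<close>, and for
  \<open>j = - 1\<close> it is the sign from moving \<open>x\<close> past \<open>a'\<close>. Where
  \<open>j\<close> does not fit the coefficient \<open>u\<close> or \<open>v\<close>, that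
  coefficient is zero and the corresponding terms vanish on both sides.\<close>

lemma sym_mult_ok:
  assumes s: "sym_ok s" and t: "sym_ok t"
  shows "sym_ok (sym_mult s t) \<and> sym_val (sym_mult s t) = sym_val s \<otimes> sym_val t"
proof -
  obtain i a j u v where s': "s = (i, a, j, u, v)" by (cases s)
  obtain i' a' j' u' v' where t': "t = (i', a', j', u', v')" by (cases t)
  have a: "a \<in> grade A i" "a \<in> carrier A" "diff A a = \<zero>" using s by (auto simp: sym_ok_def s')
  have a': "a' \<in> grade A i'" "a' \<in> carrier A" "diff A a' = \<zero>" using t by (auto simp: sym_ok_def t')
  have uv: "u \<in> carrier K" "v \<in> carrier K" "j = 0 \<or> u = \<zero>\<^bsub>K\<^esub>" "j = - 1 \<or> v = \<zero>\<^bsub>K\<^esub>"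
    using s by (auto simp: sym_ok_def s' split: if_splits)
  have uv': "u' \<in> carrier K" "v' \<in> carrier K" "j' = 0 \<or> u' = \<zero>\<^bsub>K\<^esub>" "j' = - 1 \<or> v' = \<zero>\<^bsub>K\<^esub>"
    using t by (auto simp: sym_ok_def t' split: if_splits)
  let ?p = "signed A (j * i') (a \<otimes> a')"
  have aa: "a \<otimes> a' \<in> Z" "a \<otimes> a' \<in> grade A (i + i')" using C.mult[of a a'] a a' by (simp_all add: grade_mult)
  have pS: "signed S (j * i') (a \<otimes>\<^bsub>S\<^esub> a') = ?p" using C.S_signed[OF aa(1)] by simp
  have pg: "?p \<in> grade A (i + i')" "?p \<in> Z"
    using aa by (auto simp: signed_def diff_hom)
  note pc = grade_carrier[OF pg(1)]
  have e: "sym_mult s t = (i + i', ?p, j + j', u \<otimes>\<^bsub>K\<^esub> u', u \<otimes>\<^bsub>K\<^esub> v' \<oplus>\<^bsub>K\<^esub> v \<otimes>\<^bsub>K\<^esub> u')"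
    unfolding s' t' sym_mult_def by (simp add: pS[simplified])
  have "sym_ok (sym_mult s t)"
    unfolding e sym_ok_def using pg uv uv' by auto
  moreover have "sym_val (sym_mult s t) = sym_val s \<otimes> sym_val t"
  proof -
    let ?q = "a \<otimes> a'"
    have 1: "(u \<odot> a) \<otimes> (u' \<odot> a') = (u \<otimes>\<^bsub>K\<^esub> u') \<odot> ?p"
    proof (cases "j = 0")
      case True
      then show ?thesis using a a' uv uv' by (simp add: signed_def smult_mult_smult)
    next
      case False
      then have "u = \<zero>\<^bsub>K\<^esub>" using uv by simp
      then show ?thesis using a a' uv uv' pc by simp
    qed
    have 2: "(u \<odot> a) \<otimes> ((v' \<odot> a') \<otimes> x) = ((u \<otimes>\<^bsub>K\<^esub> v') \<odot> ?p) \<otimes> x"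
    proof (cases "j = 0")
      case True
      then show ?thesis using a a' uv uv' smult_mult_smult[of u v' a a']
        by (simp add: signed_def flip: A.m_assoc)
    next
      case False
      then have "u = \<zero>\<^bsub>K\<^esub>" using uv by simp
      then show ?thesis using a a' uv uv' pc by simp
    qed
    have 3: "((v \<odot> a) \<otimes> x) \<otimes> (u' \<odot> a') = ((v \<otimes>\<^bsub>K\<^esub> u') \<odot> ?p) \<otimes> x"
    proof (cases "j = - 1")
      case True
      have "((v \<odot> a) \<otimes> x) \<otimes> (u' \<odot> a') = (v \<otimes>\<^bsub>K\<^esub> u') \<odot> ((a \<otimes> x) \<otimes> a')"
        using a a' uv uv' smult_mult_smult[of v u' "a \<otimes> x" a'] by (simp add: smult_mult_left)
      moreover have "?p = signed A i' ?q" using True by (simp add: signed_def)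
      ultimately show ?thesis using a a' uv uv' x_absorb(1)[OF a(1,3) a'(1,3)]
        by (simp add: smult_mult_left signed_mult_left)
    next
      case False
      then have "v = \<zero>\<^bsub>K\<^esub>" using uv by simp
      then show ?thesis using a a' uv uv' pc by simp
    qed
    \<comment> \<open>Matches the absence of a term \<open>v v'\<close> from the product of dual
      numbers.\<close>
    have 4: "((v \<odot> a) \<otimes> x) \<otimes> ((v' \<odot> a') \<otimes> x) = \<zero>"
      using x_absorb(2)[of "v \<odot> a" i "v' \<odot> a'" i'] a a' uv uv' by (simp add: diff_smult)
    have "sym_val s \<otimes> sym_val t = ((u \<odot> a) \<otimes> (u' \<odot> a') \<oplus> (u \<odot> a) \<otimes> ((v' \<odot> a') \<otimes> x)) \<oplus>
        (((v \<odot> a) \<otimes> x) \<otimes> (u' \<odot> a') \<oplus> ((v \<odot> a) \<otimes> x) \<otimes> ((v' \<odot> a') \<otimes> x))"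
      using a a' uv uv' by (simp add: sym_val_def s' t' A.l_distr A.r_distr A.a_ac)
    also have "\<dots> = (u \<otimes>\<^bsub>K\<^esub> u') \<odot> ?p \<oplus> (((u \<otimes>\<^bsub>K\<^esub> v') \<odot> ?p) \<otimes> x \<oplus> ((v \<otimes>\<^bsub>K\<^esub> u') \<odot> ?p) \<otimes> x)"
      unfolding 1 2 3 4 using uv uv' pc by (simp add: A.a_assoc)
    also have "\<dots> = sym_val (sym_mult s t)"
      unfolding e sym_val_def using uv uv' pc by (simp add: smult_l_distr A.l_distr)
    finally show ?thesis by simp
  qed
  ultimately show ?thesis by blast
qed

lemma formal_mult_val:
  assumes "M \<in> FS" "M' \<in> FS"
  shows "fmult M M' \<in> FS \<and> sum_val (fmult M M') = sum_val M \<otimes> sum_val M'"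
proof -
  have 1: "image_mset (sym_mult s) M' \<in> FS \<and> sum_val (image_mset (sym_mult s) M') = sym_val s \<otimes> sum_val M'"
    if s: "sym_ok s" for s
    using assms(2)
  proof (induction M')
    case empty
    then show ?case using sym_val_carrier[OF s] by simp
  next
    case (add t M')
    then have t: "sym_ok t" "M' \<in> FS" by auto
    then show ?case
      using add.IH sym_mult_ok[OF s t(1)] sym_val_carrier[OF s] sym_val_carrier[OF t(1)]
      by (simp add: sum_val_add A.r_distr)
  qed
  show ?thesis
    using assms(1)
  proof (induction M)
    case empty
    then show ?case by (simp add: formal_mult_eq)
  next
    case (add s M)
    then have s: "sym_ok s" "M \<in> FS" by auto
    have "fmult (add_mset s M) M' = image_mset (sym_mult s) M' + fmult M M'"
      by (simp add: formal_mult_eq)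
    then show ?case
      using add.IH[OF s(2)] 1[OF s(1)] sym_val_carrier[OF s(1)] s
      by (simp add: sum_val_union sum_val_add A.l_distr)
  qed
qed

text \<open>The symbol with \<open>diff S a\<close> has value zero because \<open>a\<close> is a
  cycle. The only contribution comes from \<open>diff A x = \<one>\<close>, with the sign of moving
  the differential past \<open>a\<close>.\<close>

lemma sym_diff_ok:
  assumes s: "sym_ok s"
  shows "sym_diff s \<in> FS \<and> sum_val (sym_diff s) = diff A (sym_val s)"
  using s
proof (cases rule: sym_okE)
  case (unit i a u)
  have z: "a \<in> Z" using unit by simp
  have sg: "signed S i a = signed A i a" "signed A i a \<in> grade S i"
    using C.S_signed[OF z] unit by (auto simp: signed_def diff_hom)
  have "sym_diff s = {#(i + 1, \<zero>, 0, (u, \<zero>\<^bsub>K\<^esub>)), (i, signed A i a, 1, oK)#}"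
    using unit sg by (simp add: sym_diff_def)
  moreover have "sym_ok (i + 1, \<zero>, 0, (u, \<zero>\<^bsub>K\<^esub>))" "sym_ok (i, signed A i a, 1, oK)"
    using unit sg by (simp_all add: sym_ok_def diff_hom)
  moreover have "sym_val (i + 1, \<zero>, 0, (u, \<zero>\<^bsub>K\<^esub>)) = \<zero>" "sym_val (i, signed A i a, 1, oK) = \<zero>"
    using unit by (simp_all add: sym_val_def)
  ultimately show ?thesis using unit by (simp add: sum_val_add diff_smult)
next
  case (x i a v)
  have z: "a \<in> Z" using x by simp
  have sg: "signed S i a = signed A i a" "signed A i a \<in> grade S i"
    using C.S_signed[OF z] x by (auto simp: signed_def diff_hom)
  have "sym_diff s = {#(i + 1, \<zero>, - 1, (\<zero>\<^bsub>K\<^esub>, v)), (i, signed A i a, 0, (v, \<zero>\<^bsub>K\<^esub>))#}"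
    using x sg by (simp add: sym_diff_def)
  moreover have "sym_ok (i + 1, \<zero>, - 1, (\<zero>\<^bsub>K\<^esub>, v))" "sym_ok (i, signed A i a, 0, (v, \<zero>\<^bsub>K\<^esub>))"
    using x sg by (simp_all add: sym_ok_def diff_hom)
  moreover have "sym_val (i + 1, \<zero>, - 1, (\<zero>\<^bsub>K\<^esub>, v)) = \<zero>" "sym_val (i, signed A i a, 0, (v, \<zero>\<^bsub>K\<^esub>)) = v \<odot> signed A i a"
    using x by (simp_all add: sym_val_def)
  moreover have "diff A (sym_val s) = v \<odot> signed A i a"
    using diff_mult[of "v \<odot> a" i x] x by (simp add: diff_smult x_diff signed_smult diff_hom)
  ultimately show ?thesis using x by (simp add: sum_val_add)
next
  case (zero i a j)
  have z: "a \<in> Z" using zero by simp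
  have sg: "signed S i a = signed A i a" "signed A i a \<in> grade S i"
    using C.S_signed[OF z] zero by (auto simp: signed_def diff_hom)
  have "sym_diff s = {#(i + 1, \<zero>, j, oK), (i, signed A i a, j + 1, oK)#}"
    using zero sg by (simp add: sym_diff_def)
  moreover have "sym_ok (i + 1, \<zero>, j, oK)" "sym_ok (i, signed A i a, j + 1, oK)"
    using zero sg by (simp_all add: sym_ok_def diff_hom)
  moreover have "sym_val (i + 1, \<zero>, j, oK) = \<zero>" "sym_val (i, signed A i a, j + 1, oK) = \<zero>"
    using zero by (simp_all add: sym_val_def)
  ultimately show ?thesis using zero by (simp add: sum_val_add diff_hom)
qed

lemma formal_diff_val:
  "M \<in> FS \<Longrightarrow> fdiff M \<in> FS \<and> sum_val (fdiff M) = diff A (sum_val M)"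
proof (induction M)
  case (add s M)
  then have s: "sym_ok s" "M \<in> FS" by auto
  then show ?case using add.IH sym_diff_ok[OF s(1)] sym_val_carrier[OF s(1)]
    by (simp add: formal_diff_eq sum_val_union sum_val_add diff_hom)
qed (simp add: formal_diff_eq diff_hom)

lemma sym_smult_ok:
  assumes c: "c \<in> carrier K" and s: "sym_ok s"
  shows "sym_ok (sym_smult c s) \<and> sym_val (sym_smult c s) = c \<odot> sym_val s"
proof -
  obtain i a j u v where s': "s = (i, a, j, u, v)" by (cases s)
  have a: "a \<in> grade A i" "a \<in> carrier A" "diff A a = \<zero>" using s by (auto simp: sym_ok_def s')
  have uv: "u \<in> carrier K" "v \<in> carrier K" using s by (auto simp: sym_ok_def s' split: if_splits)
  have "u \<odot> (c \<odot> a) = c \<odot> (u \<odot> a)" "v \<odot> (c \<odot> a) = c \<odot> (v \<odot> a)"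
    using a uv c K.m_comm[of _ c] by (simp_all flip: smult_assoc1)
  then have "sym_val (sym_smult c s) = c \<odot> sym_val s"
    using a uv c by (simp add: sym_val_def sym_smult_def s' smult_r_distr smult_mult_left)
  then show ?thesis using a c s by (simp add: sym_ok_def sym_smult_def s' diff_smult)
qed

lemma smult_val:
  assumes c: "c \<in> carrier K"
  shows "M \<in> FS \<Longrightarrow> image_mset (sym_smult c) M \<in> FS \<and> sum_val (image_mset (sym_smult c) M) = c \<odot> sum_val M"
proof (induction M)
  case (add s M)
  then have s: "sym_ok s" "M \<in> FS" by auto
  then show ?case using add.IH sym_smult_ok[OF c s(1)] sym_val_carrier[OF s(1)] c
    by (simp add: sum_val_add smult_r_distr)
qed (use c in simp)

lemma pure_grade:
  assumes "M \<in> FS" "\<forall>(i, a, j, b)\<in>set_mset M. i + j = n"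
  shows "sum_val M \<in> grade A n"
  using assms
proof (induction M)
  case (add s M)
  then have s: "sym_ok s" "M \<in> FS" by auto
  have "sym_val s \<in> grade A n"
    using s(1)
  proof (cases rule: sym_okE)
    case (x i a v)
    then have "i + - 1 = n" using add.prems(2) by simp
    then show ?thesis using x grade_mult[of "v \<odot> a" i x "- 1"] x_grade by simp
  qed (use add.prems(2) in auto)
  then show ?case using add s by (simp add: sum_val_add)
qed simp

text \<open>A fibre of the evaluation. Fibres coincide with equivalence classes of formal sums, so
  classes are indexed by \<open>A\<close> without choosing representatives.\<close>

definition val_class :: "'a \<Rightarrow> ('a, 'k \<times> 'k) formal_sum set" where
  "val_class y = {M \<in> FS. sum_val M = y}"

lemma tensor_class_eq:
  assumes M: "M \<in> FS" shows "tclass M = val_class (sum_val M)"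
proof -
  have "teq M M' \<longleftrightarrow> M' \<in> FS \<and> sum_val M' = sum_val M" for M'
  proof
    assume "teq M M'"
    from tensor_eq_sound[OF this] show "M' \<in> FS \<and> sum_val M' = sum_val M" by simp
  next
    assume "M' \<in> FS \<and> sum_val M' = sum_val M"
    then show "teq M M'" using tensor_eq_iff[OF M] by simp
  qed
  then show ?thesis unfolding tensor_class_def val_class_def by (rule Collect_cong)
qed

lemma val_class_nonempty: "y \<in> carrier A \<Longrightarrow> \<exists>M. M \<in> val_class y"
  using normal_form_FS sum_val_normal_form by (auto simp: val_class_def)

text \<open>Operations on classes are unions over all representatives; the union collapses once each
  representative gives the same class.\<close>

lemma UN_const_eq: "\<lbrakk>\<exists>M. M \<in> U; \<And>M. M \<in> U \<Longrightarrow> f M = c\<rbrakk> \<Longrightarrow> (\<Union>M\<in>U. f M) = c"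
  by blast

lemma dg_isomorphic_tensor: "dg_isomorphic K A (tensor_calg K S (EK K))"
proof (rule transport_dg_isomorphic)
  let ?T = "tensor_calg K S (EK K)"
  show "bij_betw val_class (carrier A) (carrier ?T)"
  proof (rule bij_betw_imageI)
    show "inj_on val_class (carrier A)"
    proof (rule inj_onI)
      fix y z assume "y \<in> carrier A" "val_class y = val_class z"
      then show "y = z" using val_class_nonempty[of y] by (auto simp: val_class_def)
    qed
    have "carrier ?T = (\<lambda>M. val_class (sum_val M)) ` FS"
      by (simp add: tensor_calg_def tensor_class_eq cong: image_cong)
    also have "\<dots> = val_class ` carrier A"
    proof (intro equalityI subsetI)
      fix U assume "U \<in> val_class ` carrier A"
      then obtain y where "y \<in> carrier A" "U = val_class y" by blast
      then show "U \<in> (\<lambda>M. val_class (sum_val M)) ` FS"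
        using normal_form_FS sum_val_normal_form by (intro image_eqI[of _ _ "normal_form y"]) auto
    qed auto
    finally show "val_class ` carrier A = carrier ?T" by simp
  qed
  show "val_class (y \<otimes> z) = val_class y \<otimes>\<^bsub>?T\<^esub> val_class z" if yz: "y \<in> carrier A" "z \<in> carrier A" for y z
  proof -
    have "(\<Union>M\<in>val_class y. \<Union>M'\<in>val_class z. tclass (fmult M M')) = val_class (y \<otimes> z)"
    proof (intro UN_const_eq val_class_nonempty yz)
      fix M M' assume "M \<in> val_class y" "M' \<in> val_class z"
      then have "M \<in> FS" "M' \<in> FS" "sum_val M = y" "sum_val M' = z" by (auto simp: val_class_def)
      then show "tclass (fmult M M') = val_class (y \<otimes> z)"
        using formal_mult_val[of M M'] tensor_class_eq by simp
    qed
    then show ?thesis by (simp add: tensor_calg_def)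
  qed
  show "val_class (y \<oplus> z) = val_class y \<oplus>\<^bsub>?T\<^esub> val_class z" if yz: "y \<in> carrier A" "z \<in> carrier A" for y z
  proof -
    have "(\<Union>M\<in>val_class y. \<Union>M'\<in>val_class z. tclass (M + M')) = val_class (y \<oplus> z)"
    proof (intro UN_const_eq val_class_nonempty yz)
      fix M M' assume "M \<in> val_class y" "M' \<in> val_class z"
      then have "M \<in> FS" "M' \<in> FS" "sum_val M = y" "sum_val M' = z" by (auto simp: val_class_def)
      then show "tclass (M + M') = val_class (y \<oplus> z)"
        using sum_val_union[of M M'] tensor_class_eq by simp
    qed
    then show ?thesis by (simp add: tensor_calg_def)
  qed
  have one_ok: "sym_ok (0, \<one>, 0, uK)" using C.unit by (simp add: sym_ok_def grade_one)
  have "sum_val {#(0, \<one>, 0, uK)#} = \<one>"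
    using one_ok by (simp add: sum_val_add) (simp add: sym_val_def)
  then have "tclass {#(0, \<one>, 0, uK)#} = val_class \<one>"
    using tensor_class_eq[of "{#(0, \<one>, 0, uK)#}"] one_ok by simp
  then show "val_class \<one> = \<one>\<^bsub>?T\<^esub>" by (simp add: tensor_calg_def)
  show "val_class \<zero> = \<zero>\<^bsub>?T\<^esub>" by (simp add: tensor_calg_def tensor_class_eq)
  show "val_class (c \<odot> y) = c \<odot>\<^bsub>?T\<^esub> val_class y" if cy: "c \<in> carrier K" "y \<in> carrier A" for c y
  proof -
    have "(\<Union>M\<in>val_class y. tclass (image_mset (sym_smult c) M)) = val_class (c \<odot> y)"
    proof (intro UN_const_eq val_class_nonempty cy)
      fix M assume "M \<in> val_class y"
      then have "M \<in> FS" "sum_val M = y" by (auto simp: val_class_def)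
      then show "tclass (image_mset (sym_smult c) M) = val_class (c \<odot> y)"
        using smult_val[OF cy(1), of M] tensor_class_eq by simp
    qed
    then show ?thesis by (simp add: tensor_calg_def sym_smult_def)
  qed
  show "grade ?T n = val_class ` grade A n" for n
  proof (intro equalityI subsetI)
    fix U assume "U \<in> grade ?T n"
    then obtain M where M: "M \<in> FS" "\<forall>(i, a, j, b)\<in>set_mset M. i + j = n" "U = tclass M"
      by (auto simp: tensor_calg_def)
    then show "U \<in> val_class ` grade A n" using pure_grade[OF M(1,2)] tensor_class_eq[OF M(1)] by blast
  next
    fix U assume "U \<in> val_class ` grade A n"
    then obtain y where y: "y \<in> grade A n" "U = val_class y" by blast
    let ?M = "{#sym_part1 n y, sym_part2 n y#}"
    have "?M \<in> FS" using part_ok[OF y(1)] by simp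
    moreover have "\<forall>(i, a, j, b)\<in>set_mset ?M. i + j = n" by (simp add: sym_part1_def sym_part2_def)
    moreover have "U = tclass ?M"
      using tensor_class_eq[OF \<open>?M \<in> FS\<close>] part_val[OF y(1)] y(2) by simp
    ultimately show "U \<in> grade ?T n" unfolding tensor_calg_def by auto
  qed
  show "diff ?T (val_class y) = val_class (diff A y)" if y: "y \<in> carrier A" for y
  proof -
    have "(\<Union>M\<in>val_class y. tclass (fdiff M)) = val_class (diff A y)"
    proof (intro UN_const_eq val_class_nonempty y)
      fix M assume "M \<in> val_class y"
      then have "M \<in> FS" "sum_val M = y" by (auto simp: val_class_def)
      then show "tclass (fdiff M) = val_class (diff A y)"
        using formal_diff_val[of M] tensor_class_eq by simp
    qed
    then show ?thesis by (simp add: tensor_calg_def)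
  qed
  \<comment> \<open>The curvature of the tensor product consists of two symbols, each with a zero
    entry.\<close>
  have ok: "sym_ok (2, \<zero>, 0, uK)" "sym_ok (0, \<one>, 2, oK)"
    using C.unit by (simp_all add: sym_ok_def grade_one diff_hom)
  have "sum_val {#(2, \<zero>, 0, uK), (0, \<one>, 2, oK)#} = \<zero>"
    using ok by (simp add: sum_val_add) (simp add: sym_val_def)
  then have "tclass {#(2, \<zero>, 0, uK), (0, \<one>, 2, oK)#} = val_class \<zero>"
    using tensor_class_eq[of "{#(2, \<zero>, 0, uK), (0, \<one>, 2, oK)#}"] ok by simp
  then show "curv ?T = val_class (curv A)" by (simp add: tensor_calg_def curv_zero)
qed

end

section \<open>Decomposition into blocks\<close>

context peirce_dg begin

text \<open>Whether the block meets the radical in a nonzero element decides between the two types.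
  If it does not, the block equals its simple algebra of cycles and \<open>D\<close> is zero on
  it.\<close>

lemma block_curved_simple:
  assumes bounded: "\<And>n. N < \<bar>n\<bar> \<Longrightarrow> grade A n = {\<zero>}" and c: "c \<in> \<rho> ` P"
  shows "curved_simple K (subalg A (block c) (e c) D)"
proof -
  interpret B: graded_corner K A "block c" "e c" D by (rule block_corner)
  interpret C: graded_corner K A "cycles c" "e c" D by (rule cycles_corner)
  show ?thesis
  proof (cases "\<exists>x0\<in>J. e c \<otimes> x0 = x0 \<and> x0 \<noteq> \<zero>")
    case False
    then have "block c = cycles c" by (intro block_eq_cycles) blast
    then have "simple_galg B.S" using cycles_simple[OF c] by simp
    then show ?thesis using B.S_dg by (simp add: curved_simple_def)
  next
    case True
    then obtain x where x: "x \<in> grade A (- 1)" "x \<in> block c" "D x = e c" "x \<otimes> x = \<zero>"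
      "\<And>s n. \<lbrakk>s \<in> cycles c; s \<in> grade A n\<rbrakk> \<Longrightarrow> x \<otimes> s = signed A n (s \<otimes> x)"
      using contracting_element[OF c] by blast
    have cyc: "{s \<in> block c. D s = \<zero>} = cycles c" by (auto simp: block_def cycles_def)
    interpret X: contractible K B.S x N
    proof (intro contractible.intro contractible_axioms.intro)
      show "curved K B.S" using B.S_dg by (simp add: dg_algebra_def curved_def)
      show "x \<otimes>\<^bsub>B.S\<^esub> s = signed B.S n (s \<otimes>\<^bsub>B.S\<^esub> x)" if "s \<in> grade B.S n" "diff B.S s = \<zero>\<^bsub>B.S\<^esub>" for s n
      proof -
        have s: "s \<in> cycles c" "s \<in> block c" "s \<in> grade A n" using that cyc by auto
        show ?thesis using x(5)[OF s(1,3)] B.S_signed[OF B.mult[OF s(2) x(2)]] by simp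
      qed
      show "grade B.S n = {\<zero>\<^bsub>B.S\<^esub>}" if "N < \<bar>n\<bar>" for n
        using bounded[OF that] B.C_closed(1) by auto
    qed (use x in simp_all)
    \<comment> \<open>The cycles of the block, formed inside the block as an algebra, are the cycles
      \<open>C.S\<close> formed inside \<open>A\<close>; hence the tensor factor is the algebra
      already known to be simple.\<close>
    have eq: "subalg B.S {s \<in> carrier B.S. diff B.S s = \<zero>\<^bsub>B.S\<^esub>} \<one>\<^bsub>B.S\<^esub> (diff B.S) = C.S"
    proof -
      have "(\<lambda>n. grade A n \<inter> block c \<inter> cycles c) = (\<lambda>n. grade A n \<inter> cycles c)"
        by (auto simp: block_def cycles_def)
      then show ?thesis using cyc by (simp add: subalg_def)
    qed
    have "dg_isomorphic K B.S (tensor_calg K C.S (acyclic_dual_numbers K))"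
      using X.dg_isomorphic_tensor unfolding eq .
    moreover have "\<forall>s\<in>carrier C.S. diff C.S s = \<zero>\<^bsub>C.S\<^esub>" by (simp add: cycles_def)
    ultimately show ?thesis
      unfolding curved_simple_def using B.S_dg C.S_dg cycles_simple[OF c] by blast
  qed
qed

lemma e_expand:
  assumes y: "y \<in> carrier A"
  shows "y = (\<Oplus>c\<in>\<rho> ` P. e c \<otimes> y)"
  using additive_on_finsum[OF additive_on_mult(2)[OF y], of "\<rho> ` P" e] e_sum y by simp

end

context curved begin

text \<open>Splitting along complete orthogonal central idempotents killed by the twisted
  differential. The morphism component \<open>b\<close> accounts for the passage from
  \<open>d\<close> to \<open>twist A b\<close>, and \<open>h\<close> makes the curvatures of the
  factors zero.\<close>

lemma block_product:
  fixes n :: nat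
  assumes pd: "peirce_dg K A P \<rho> \<delta> (twist A b)" and b: "b \<in> grade A 1" and h: "twisted_curv A b = \<zero>"
    and \<iota>: "bij_betw \<iota> {..<n} (\<rho> ` P)"
  shows "curved_isomorphic K A (prod_calg {..<n} (\<lambda>i. subalg A (peirce_dg.block A P \<rho> (\<iota> i))
    (peirce_diff.e A P \<rho> (\<iota> i)) (twist A b)))"
proof -
  interpret pd: peirce_dg K A P \<rho> \<delta> "twist A b" by (rule pd)
  define \<epsilon> where "\<epsilon> i = pd.e (\<iota> i)" for i
  define C where "C i = pd.block (\<iota> i)" for i
  have C: "C i = {x \<in> carrier A. \<epsilon> i \<otimes> x = x}" for i by (simp add: C_def \<epsilon>_def pd.block_def)
  have \<epsilon>c [simp]: "\<epsilon> i \<in> carrier A" for i by (simp add: \<epsilon>_def)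
  have \<epsilon>0: "\<epsilon> i \<in> grade A 0" for i by (simp add: \<epsilon>_def pd.e_grade)
  have inj: "\<iota> i = \<iota> j \<longleftrightarrow> i = j" if "i < n" "j < n" for i j
    using bij_betw_imp_inj_on[OF \<iota>] that by (auto simp: inj_on_def)
  have \<epsilon>m: "\<epsilon> i \<otimes> \<epsilon> j = (if i = j then \<epsilon> i else \<zero>)" if "i < n" "j < n" for i j
    using pd.e_mult inj[OF that] by (simp add: \<epsilon>_def)
  have \<epsilon>\<epsilon>: "\<epsilon> i \<otimes> (\<epsilon> i \<otimes> y) = \<epsilon> i \<otimes> y" if "y \<in> carrier A" for i y
    using that pd.e_mult[of "\<iota> i" "\<iota> i"] by (simp add: \<epsilon>_def flip: A.m_assoc)
  have expand: "y = (\<Oplus>i\<in>{..<n}. \<epsilon> i \<otimes> y)" if y: "y \<in> carrier A" for y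
  proof -
    have "(\<Oplus>c\<in>\<iota> ` {..<n}. pd.e c \<otimes> y) = (\<Oplus>i\<in>{..<n}. pd.e (\<iota> i) \<otimes> y)"
      by (rule A.finsum_reindex) (use y bij_betw_imp_inj_on[OF \<iota>] in auto)
    then show ?thesis using pd.e_expand[OF y] bij_betw_imp_surj_on[OF \<iota>] by (simp add: \<epsilon>_def)
  qed
  define G where "G y = (\<lambda>i\<in>{..<n}. \<epsilon> i \<otimes> y)" for y
  let ?T = "prod_calg {..<n} (\<lambda>i. subalg A (C i) (\<epsilon> i) (twist A b))"
  have GC: "G y \<in> (\<Pi>\<^sub>E i\<in>{..<n}. C i)" if "y \<in> carrier A" for y
    using that by (auto simp: G_def C \<epsilon>\<epsilon>)
  \<comment> \<open>Adding up the coordinates inverts \<open>G\<close>, because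
    \<open>\<epsilon> j\<close> annihilates all summands but the one with index
    \<open>j\<close>.\<close>
  have sum: "(\<Oplus>i\<in>{..<n}. w i) \<in> carrier A \<and> G (\<Oplus>i\<in>{..<n}. w i) = w" if w: "w \<in> (\<Pi>\<^sub>E i\<in>{..<n}. C i)" for w
  proof -
    have wc: "w i \<in> carrier A" "\<epsilon> i \<otimes> w i = w i" if "i < n" for i using w that by (auto simp: C PiE_def Pi_def)
    have "\<epsilon> j \<otimes> (\<Oplus>i\<in>{..<n}. w i) = w j" if j: "j < n" for j
    proof -
      have "\<epsilon> j \<otimes> (\<Oplus>i\<in>{..<n}. w i) = (\<Oplus>i\<in>{..<n}. \<epsilon> j \<otimes> w i)"
        by (rule additive_on_finsum[OF additive_on_mult(1)[OF \<epsilon>c]]) (use wc in auto)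
      also have "\<dots> = (\<Oplus>i\<in>{..<n}. if j = i then w i else \<zero>)"
      proof (rule A.finsum_cong')
        fix i assume "i \<in> {..<n}"
        then have i: "i < n" by simp
        have "\<epsilon> j \<otimes> (\<epsilon> i \<otimes> w i) = (\<epsilon> j \<otimes> \<epsilon> i) \<otimes> w i" using wc(1)[OF i] by (simp add: A.m_assoc)
        then show "\<epsilon> j \<otimes> w i = (if j = i then w i else \<zero>)" using wc[OF i] \<epsilon>m[OF j i] by auto
      qed (use wc in auto)
      also have "\<dots> = w j" by (rule A.add.finprod_singleton) (use wc j in auto)
      finally show ?thesis .
    qed
    then have "G (\<Oplus>i\<in>{..<n}. w i) = w"
      using w by (auto simp: G_def fun_eq_iff PiE_def extensional_def)
    moreover have "(\<Oplus>i\<in>{..<n}. w i) \<in> carrier A" by (rule A.finsum_closed) (use wc in auto)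
    ultimately show ?thesis by simp
  qed
  have "curved_isomorphic K A ?T"
  proof (rule transport_curved_isomorphic[OF b])
    show "bij_betw G (carrier A) (carrier ?T)"
    proof (rule bij_betw_imageI)
      show "inj_on G (carrier A)"
      proof (rule inj_onI)
        fix y z assume yz: "y \<in> carrier A" "z \<in> carrier A" "G y = G z"
        have "\<epsilon> i \<otimes> y = \<epsilon> i \<otimes> z" if "i < n" for i using fun_cong[OF yz(3), of i] that by (simp add: G_def)
        then have "(\<Oplus>i\<in>{..<n}. \<epsilon> i \<otimes> y) = (\<Oplus>i\<in>{..<n}. \<epsilon> i \<otimes> z)"
          by (intro A.finsum_cong') (use yz in auto)
        then show "y = z" using expand[OF yz(1)] expand[OF yz(2)] by simp
      qed
      show "G ` carrier A = carrier ?T"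
      proof (intro equalityI subsetI)
        fix w assume "w \<in> carrier ?T"
        then have "w \<in> (\<Pi>\<^sub>E i\<in>{..<n}. C i)" by (simp add: prod_calg_def)
        from sum[OF this] show "w \<in> G ` carrier A" by (metis image_eqI)
      qed (use GC in \<open>auto simp: prod_calg_def\<close>)
    qed
    show "grade ?T m = G ` grade A m" for m
    proof (intro equalityI subsetI)
      fix w assume "w \<in> grade ?T m"
      then have w: "w \<in> (\<Pi>\<^sub>E i\<in>{..<n}. grade A m \<inter> C i)" by (simp add: prod_calg_def)
      then have "w \<in> (\<Pi>\<^sub>E i\<in>{..<n}. C i)" by (auto simp: PiE_def Pi_def)
      moreover have "(\<Oplus>i\<in>{..<n}. w i) \<in> grade A m" using w by (intro grade_finsum) auto
      ultimately show "w \<in> G ` grade A m" using sum by (metis image_eqI)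
    next
      fix w assume "w \<in> G ` grade A m"
      then obtain y where y: "y \<in> grade A m" "w = G y" by blast
      have "\<epsilon> i \<otimes> y \<in> grade A m" for i using \<epsilon>0 y(1) by simp
      then show "w \<in> grade ?T m"
        using GC[OF grade_carrier[OF y(1)]] y(2) by (auto simp: prod_calg_def G_def PiE_def Pi_def)
    qed
    show "G (y \<otimes> z) = G y \<otimes>\<^bsub>?T\<^esub> G z" if yz: "y \<in> carrier A" "z \<in> carrier A" for y z
    proof -
      have "\<epsilon> i \<otimes> (y \<otimes> z) = (\<epsilon> i \<otimes> y) \<otimes> (\<epsilon> i \<otimes> z)" for i
      proof -
        have c: "\<epsilon> i \<otimes> y = y \<otimes> \<epsilon> i" unfolding \<epsilon>_def by (rule pd.e_central[OF yz(1)])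
        have "(\<epsilon> i \<otimes> y) \<otimes> (\<epsilon> i \<otimes> z) = y \<otimes> (\<epsilon> i \<otimes> (\<epsilon> i \<otimes> z))" unfolding c using yz by (simp add: A.m_assoc)
        also have "\<dots> = (y \<otimes> \<epsilon> i) \<otimes> z" unfolding \<epsilon>\<epsilon>[OF yz(2)] using yz by (simp add: A.m_assoc)
        also have "\<dots> = \<epsilon> i \<otimes> (y \<otimes> z)" unfolding c[symmetric] using yz by (simp add: A.m_assoc)
        finally show ?thesis by simp
      qed
      then show ?thesis by (simp add: G_def prod_calg_def fun_eq_iff)
    qed
    show "diff ?T (G y) = G (twist A b y)" if y: "y \<in> carrier A" for y
      using pd.D_e_mult[OF y] by (simp add: G_def prod_calg_def fun_eq_iff \<epsilon>_def)
    show "curv ?T = G (twisted_curv A b)" unfolding h by (simp add: G_def prod_calg_def fun_eq_iff)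
  qed (simp_all add: G_def prod_calg_def fun_eq_iff A.r_distr smult_mult_right)
  then show ?thesis by (simp add: C_def \<epsilon>_def)
qed

end

theorem proposition7p7:
  fixes K :: "('k, 'm) ring_scheme" and B :: "('k, 'a) calg"
  assumes "perfect_field K"
    and "curved_algebra K B"
    and "fin_dim K B"
    and "curved_semisimple B"
  shows "\<exists>(n::nat) (R :: nat \<Rightarrow> ('k, 'a) calg).
           (\<forall>i<n. curved_simple K (R i)) \<and>
           curved_isomorphic K B (prod_calg {..<n} R)"
proof -
  interpret curved K B using assms(2) by (simp add: curved_def)
  interpret fdalg K B using assms(3) by unfold_locales
  obtain N where N: "\<And>n. N < \<bar>n\<bar> \<Longrightarrow> grade B n = {\<zero>\<^bsub>B\<^esub>}" using bounded_if_fin_dim[OF fd] by blast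
  obtain P \<rho> \<delta> where frame: "peirce_frame B P \<rho> \<delta>" using peirce_frame_exists by blast
  define b where "b = (\<Oplus>\<^bsub>B\<^esub>p\<in>P. diff B p \<otimes>\<^bsub>B\<^esub> p)"
  have P: "finite P" "P \<subseteq> grade B 0" "(\<Oplus>\<^bsub>B\<^esub>p\<in>P. p) = \<one>\<^bsub>B\<^esub>"
    "\<And>p q. \<lbrakk>p \<in> P; q \<in> P\<rbrakk> \<Longrightarrow> p \<otimes>\<^bsub>B\<^esub> q = (if p = q then p else \<zero>\<^bsub>B\<^esub>)"
    using frame by (auto simp: peirce_frame_def)
  have b: "b \<in> grade B 1"
    unfolding b_def
  proof (rule grade_finsum)
    fix p assume "p \<in> P"
    then have "p \<in> grade B 0" using P(2) by blast
    from grade_mult[OF diff_degree[OF this] this] show "diff B p \<otimes>\<^bsub>B\<^esub> p \<in> grade B 1" by simp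
  qed
  have bc: "b \<in> carrier B" using b by (rule grade_carrier)
  let ?D = "twist B b"
  have lin: "k_linear K B B ?D" using bc by (rule twist_linear)
  have inj: "x = \<zero>\<^bsub>B\<^esub>" if x: "x \<in> J" "?D x \<in> J" for x
  proof -
    have xc: "x \<in> carrier B" using x(1) by simp
    let ?c = "b \<otimes>\<^bsub>B\<^esub> x \<ominus>\<^bsub>B\<^esub> parity B x \<otimes>\<^bsub>B\<^esub> b"
    \<comment> \<open>Adding back the commutator with \<open>b\<close>, which stays in
      \<open>J\<close>, turns the twisted differential into \<open>diff B\<close>, to which
      semisimplicity applies.\<close>
    have "?c \<in> J"
      using radical_closed(5)[OF bc x(1)] radical_mult_right[OF radical_parity[OF x(1)] bc] by (rule radical_closed(7))
    then have "?D x \<oplus>\<^bsub>B\<^esub> ?c \<in> J" using x(2) radical_closed(3) by blast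
    moreover have "?D x \<oplus>\<^bsub>B\<^esub> ?c = diff B x"
      unfolding twist_def using xc bc diff_hom(1)[OF xc] by (intro add_minus_cancel(3)) auto
    ultimately have "x \<in> curved_radical B" using x(1) by (simp add: curved_radical_def)
    then show ?thesis using assms(4) by (simp add: curved_semisimple_def)
  qed
  have pdiff: "peirce_diff K B P \<rho> \<delta> ?D"
  proof (intro peirce_diff.intro peirce_diff_axioms.intro)
    show "galg K B" by (rule galg_axioms)
    show "additive_on B ?D" using lin by (rule k_linear_additive)
    show "?D f = \<zero>\<^bsub>B\<^esub>" if "f \<in> P" for f
      using twist_kills[OF P(1,2,4,3) that b_def] .
  qed (use frame twist_degree[OF b] twist_mult[OF bc] inj in auto)
  interpret pd: peirce_diff K B P \<rho> \<delta> ?D by (rule pdiff)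
  \<comment> \<open>Since \<open>?D f = 0\<close>, the identity for \<open>?D (?D f)\<close> says
    that the twisted curvature commutes with every idempotent of the frame.\<close>
  have h: "twisted_curv B b = \<zero>\<^bsub>B\<^esub>"
  proof (rule pd.central_degree_2)
    have "diff B b \<in> grade B 2" "b \<otimes>\<^bsub>B\<^esub> b \<in> grade B 2"
      using diff_degree[OF b] grade_mult[OF b b] by simp_all
    then show h2: "twisted_curv B b \<in> grade B 2" using curv_degree by (simp add: twisted_curv_def)
    fix f assume f: "f \<in> P"
    have "twisted_curv B b \<otimes>\<^bsub>B\<^esub> f \<ominus>\<^bsub>B\<^esub> f \<otimes>\<^bsub>B\<^esub> twisted_curv B b = \<zero>\<^bsub>B\<^esub>"
      using twist_twist[OF b pd.P_grade[OF f]] pd.D_idem[OF f] pd.D_hom(3) by simp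
    then show "twisted_curv B b \<otimes>\<^bsub>B\<^esub> f = f \<otimes>\<^bsub>B\<^esub> twisted_curv B b"
      using pd.P_carrier[OF f] grade_carrier[OF h2] by (simp add: A.r_right_minus_eq)
  qed
  have pd: "peirce_dg K B P \<rho> \<delta> ?D"
  proof (intro peirce_dg.intro pdiff peirce_dg_axioms.intro)
    show "?D (k \<odot>\<^bsub>B\<^esub> x) = k \<odot>\<^bsub>B\<^esub> ?D x" if "k \<in> carrier K" "x \<in> carrier B" for k x
      using lin that by (simp add: k_linear_def)
    show "?D (?D x) = \<zero>\<^bsub>B\<^esub>" if "x \<in> carrier B" for x
      using that
    proof (induction rule: homog_induct)
      case (homog n x)
      then show ?case using twist_twist[OF b homog] h grade_carrier[OF homog] by (simp add: a_minus_def)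
    next
      case (add x y)
      then show ?case using pd.D_hom(1,2) by simp
    qed
  qed
  interpret dg: peirce_dg K B P \<rho> \<delta> ?D by (rule pd)
  \<comment> \<open>For the zero algebra \<open>P\<close> is empty, and the product has no
    factors.\<close>
  obtain \<iota> where "bij_betw \<iota> {0..<card (\<rho> ` P)} (\<rho> ` P)"
    using ex_bij_betw_nat_finite P(1) by blast
  then have \<iota>: "bij_betw \<iota> {..<card (\<rho> ` P)} (\<rho> ` P)" by (simp add: atLeast0LessThan)
  let ?R = "\<lambda>i. subalg B (dg.block (\<iota> i)) (pd.e (\<iota> i)) ?D"
  have "curved_simple K (?R i)" if "i < card (\<rho> ` P)" for i
  proof (rule dg.block_curved_simple[OF N])
    show "\<iota> i \<in> \<rho> ` P" using bij_betwE[OF \<iota>] that by simp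
  qed
  moreover have "curved_isomorphic K B (prod_calg {..<card (\<rho> ` P)} ?R)"
    using block_product[OF pd b h \<iota>] .
  ultimately show ?thesis by (intro exI[of _ "card (\<rho> ` P)"] exI[of _ ?R] conjI allI impI)
qed

end
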